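(* Let $d\geqslant4$, $u\in\mathbb{R}^d\setminus\{0\}$ and let $n\geqslant1$ be an integer. The quadratic Wasserstein distance between $\widetilde{\theta_{u,n}}$ and $\mu_n$ satisfies $$\mathcal{W}_2^2\big(\widetilde{\theta_{u,n}},\mu_n\big)\leqslant\frac{2}{2n\left(1-\cos\frac{\pi}{2n+1}\right)}\left(-\log\big(2m(u,d)(2\pi)^{d/2}\big)-\frac{d}{2m(u,d)}\int_{\Delta_2}\log(\sigma^2)\,p^d_{t-s}(u)\,ds\,dt\right).$$
   Context: $W$ is a $d$-dimensional Brownian motion on $[0,1]$ started at $0$; $\Delta_2=\{(s,t)\in[0,1]^2:s<t\}$; $p^d_\varepsilon(z)=(2\pi\varepsilon)^{-d/2}\exp(-\|z\|^2/(2\varepsilon))$; $m(u,d)=\int_{\Delta_2}p^d_{t-s}(u)\,ds\,dt$. $\mu_n$ is the law on $\mathbb{R}^{d\times n}$ of $(W(\frac1n),W(\frac2n),\dots,W(1))$. For $(s,t)\in\Delta_2$, $\alpha_j=\lambda\big([s,t]\cap[\frac{j-1}n,\frac jn]\big)$ ($\lambda$ = Lebesgue measure), $j=1,\dots,n$, and $\sigma^2=t-s-n\sum_{j=1}^n\alpha_j^2$, a function of $(s,t)$. Sobolev spaces: $L^2(\sigma(W))$ variables have an Itô–Wiener expansion $\eta=\sum_kI_k(f_k)$ into multiple Itô integrals; $\mathbb{D}^{2,\gamma}$ ($\gamma\in\mathbb{R}$) is the completion of finite sums $\sum_{k=0}^NI_k(f_k)$ for the norm $\|\eta\|_{2,\gamma}^2=\sum_k(k+1)^\gamma\mathbb{E}I_k(f_k)^2$;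 $(\cdot,\cdot)$ is the duality pairing between $\bigcup_{\alpha>0}\mathbb{D}^{2,-\alpha}$ and $\bigcap_{\alpha>0}\mathbb{D}^{2,\alpha}$ extending $\mathbb{E}(\Phi F)$. $\rho_2(u)=\lim_{\varepsilon\to0}\int_{\Delta_2}p^d_\varepsilon(W(t)-W(s)-u)\,ds\,dt$, a limit existing in $\mathbb{D}^{2,\gamma}$ for every $\gamma<(4-d)/2$, which is a positive generalized Wiener functional. $\theta_{u,n}$ is the finite positive measure on $\mathbb{R}^{d\times n}$ determined by $$\int f\,d\theta_{u,n}=\big(f(W(\tfrac1n),\dots,W(1)),\rho_2(u)\big)\quad\text{for all }f\in C_b^\infty(\mathbb{R}^{d\times n}).$$ Its total mass is $m(u,d)$, and $\widetilde{\theta_{u,n}}=\theta_{u,n}/m(u,d)$ is a probability measure. For probability measures $\nu_1,\nu_2$ with finite second moment on $\mathbb{R}^{d\times n}$ (Euclidean metric), $\mathcal{W}_2^2(\nu_1,\nu_2)=\inf_\nu\int\int\|x-y\|^2\,\nu(dx,dy)$, the infimum over all couplings $\nu$ of $\nu_1$ and $\nu_2$. *)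

theory Defs
  imports "HOL-Probability.Probability"
begin

definition heat_kernel :: "real \<Rightarrow> 'v::euclidean_space \<Rightarrow> real" where
  "heat_kernel \<epsilon> z = (2 * pi * \<epsilon>) powr (- real DIM('v) / 2) * exp (- (norm z)\<^sup>2 / (2 * \<epsilon>))"

locale brownian_motion = prob_space M for M :: "'a measure" +
  fixes W :: "real \<Rightarrow> 'a \<Rightarrow> real ^ 'd"
  assumes measurable: "t \<in> {0..1} \<Longrightarrow> W t \<in> borel_measurable M"
    and start: "\<omega> \<in> space M \<Longrightarrow> W 0 \<omega> = 0"
    and continuous_paths: "\<omega> \<in> space M \<Longrightarrow> continuous_on {0..1} (\<lambda>t. W t \<omega>)"
    and gaussian_increments: "0 \<le> s \<Longrightarrow> s < t \<Longrightarrow> t \<le> 1 \<Longrightarrow>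
      distributed M lborel (\<lambda>\<omega>. W t \<omega> - W s \<omega>) (\<lambda>z. ennreal (heat_kernel (t - s) z))"
    and independent_increments: "mono \<tau> \<Longrightarrow> range \<tau> \<subseteq> {0..1} \<Longrightarrow>
      indep_vars (\<lambda>_. borel) (\<lambda>i \<omega>. W (\<tau> (Suc i)) \<omega> - W (\<tau> i) \<omega>) {..<(N::nat)}"

definition square_integrable :: "'a measure \<Rightarrow> ('a \<Rightarrow> real) \<Rightarrow> bool" where
  "square_integrable M X \<longleftrightarrow> X \<in> borel_measurable M \<and> integrable M (\<lambda>x. (X x)\<^sup>2)"

definition L2_tendsto :: "'a measure \<Rightarrow> (nat \<Rightarrow> 'a \<Rightarrow> real) \<Rightarrow> ('a \<Rightarrow> real) \<Rightarrow> bool" where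
  "L2_tendsto M Xs X \<longleftrightarrow> (\<forall>m. square_integrable M (Xs m)) \<and> square_integrable M X \<and>
     (\<lambda>m. \<integral>x. (Xs m x - X x)\<^sup>2 \<partial>M) \<longlonglongrightarrow> 0"

text \<open>The white noise of a \<open>d\<close>-dimensional Brownian motion is indexed by time and component, so
  a kernel of order \<open>k\<close> is a function on the \<open>k\<close>-th power of \<open>[0,1] \<times> {1,\<dots>,d}\<close>.\<close>

definition kernel_space :: "nat \<Rightarrow> (nat \<Rightarrow> real \<times> 'd::finite) measure" where
  "kernel_space k = PiM {..<k} (\<lambda>_. restrict_space lborel {0..1} \<Otimes>\<^sub>M count_space UNIV)"

text \<open>\<open>elementary_ito W k f X\<close>: the kernel \<open>f\<close> is a finite linear combination of indicators of boxes
  \<open>A\<^sub>1 \<times> \<dots> \<times> A\<^sub>k\<close> with pairwise disjoint sides (so it vanishes on the diagonals), and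
  \<open>X\<close> is the same combination of the products \<open>W(A\<^sub>1) \<cdots> W(A\<^sub>k)\<close>.\<close>

inductive elementary_ito ::
  "(real \<Rightarrow> 'a \<Rightarrow> real ^ 'd) \<Rightarrow> nat \<Rightarrow> ((nat \<Rightarrow> real \<times> 'd) \<Rightarrow> real) \<Rightarrow> ('a \<Rightarrow> real) \<Rightarrow> bool"
  for W :: "real \<Rightarrow> 'a \<Rightarrow> real ^ 'd" and k :: nat where
  zero: "elementary_ito W k (\<lambda>_. 0) (\<lambda>_. 0)"
| add_box: "elementary_ito W k (\<lambda>x. f x + c * indicator (PiE {..<k} (\<lambda>i. {a i<..b i} \<times> {e i})) x)
    (\<lambda>\<omega>. X \<omega> + c * (\<Prod>i<k. (W (b i) \<omega> - W (a i) \<omega>) $ e i))"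
  if "elementary_ito W k f X"
    and "\<And>i. i < k \<Longrightarrow> 0 \<le> a i \<and> a i \<le> b i \<and> b i \<le> 1"
    and "\<And>i j. i < k \<Longrightarrow> j < k \<Longrightarrow> i \<noteq> j \<Longrightarrow> ({a i<..b i} \<times> {e i}) \<inter> ({a j<..b j} \<times> {e j}) = {}"

text \<open>\<open>X = I\<^sub>k(f)\<close> almost surely, for a square-integrable kernel \<open>f\<close>, not necessarily symmetric
  (symmetrising \<open>f\<close> does not change \<open>I\<^sub>k(f)\<close>).\<close>

definition is_multiple_ito ::
  "'a measure \<Rightarrow> (real \<Rightarrow> 'a \<Rightarrow> real ^ 'd) \<Rightarrow> nat \<Rightarrow> ((nat \<Rightarrow> real \<times> 'd) \<Rightarrow> real) \<Rightarrow> ('a \<Rightarrow> real) \<Rightarrow> bool"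
  where
  "is_multiple_ito M W k f X \<longleftrightarrow>
     (\<exists>fs Xs. (\<forall>m. elementary_ito W k (fs m) (Xs m)) \<and>
        L2_tendsto (kernel_space k) fs f \<and> L2_tendsto M Xs X)"

definition wiener_chaos :: "'a measure \<Rightarrow> (real \<Rightarrow> 'a \<Rightarrow> real ^ 'd) \<Rightarrow> nat \<Rightarrow> ('a \<Rightarrow> real) set" where
  "wiener_chaos M W k = {X. \<exists>f. is_multiple_ito M W k f X}"

definition ito_wiener_expansion ::
  "'a measure \<Rightarrow> (real \<Rightarrow> 'a \<Rightarrow> real ^ 'd) \<Rightarrow> ('a \<Rightarrow> real) \<Rightarrow> (nat \<Rightarrow> 'a \<Rightarrow> real) \<Rightarrow> bool" where
  "ito_wiener_expansion M W \<eta> F \<longleftrightarrow>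
     (\<forall>k. F k \<in> wiener_chaos M W k) \<and> L2_tendsto M (\<lambda>N \<omega>. \<Sum>k\<le>N. F k \<omega>) \<eta>"

text \<open>Distinct chaoses are orthogonal for the weighted norm and each chaos is complete. Hence the
  completion of the finite sums is the space of all sequences of chaos components with finite
  weighted norm, and its elements are represented by these sequences. A random variable in
  \<open>L\<^sup>2(\<sigma>(W))\<close> corresponds to its expansion, and the duality pairing is the one for which
  components of different order are orthogonal.\<close>

definition sobolev_sq_norm :: "'a measure \<Rightarrow> real \<Rightarrow> (nat \<Rightarrow> 'a \<Rightarrow> real) \<Rightarrow> real" where
  "sobolev_sq_norm M \<gamma> F = (\<Sum>k. real (k + 1) powr \<gamma> * (\<integral>\<omega>. (F k \<omega>)\<^sup>2 \<partial>M))"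

definition sobolev ::
  "'a measure \<Rightarrow> (real \<Rightarrow> 'a \<Rightarrow> real ^ 'd) \<Rightarrow> real \<Rightarrow> (nat \<Rightarrow> 'a \<Rightarrow> real) set" where
  "sobolev M W \<gamma> = {F. (\<forall>k. F k \<in> wiener_chaos M W k) \<and>
     summable (\<lambda>k. real (k + 1) powr \<gamma> * (\<integral>\<omega>. (F k \<omega>)\<^sup>2 \<partial>M))}"

definition dual_pairing ::
  "'a measure \<Rightarrow> (nat \<Rightarrow> 'a \<Rightarrow> real) \<Rightarrow> (nat \<Rightarrow> 'a \<Rightarrow> real) \<Rightarrow> real" where
  "dual_pairing M F R = (\<Sum>k. \<integral>\<omega>. F k \<omega> * R k \<omega> \<partial>M)"

definition Delta2 :: "(real \<times> real) set" where
  "Delta2 = {(s, t). 0 \<le> s \<and> s < t \<and> t \<le> 1}"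

definition rho2_approx ::
  "(real \<Rightarrow> 'a \<Rightarrow> real ^ 'd) \<Rightarrow> real ^ 'd \<Rightarrow> real \<Rightarrow> 'a \<Rightarrow> real" where
  "rho2_approx W u \<epsilon> \<omega> = (LINT (s, t):Delta2|lborel. heat_kernel \<epsilon> (W t \<omega> - W s \<omega> - u))"

definition is_rho2 ::
  "'a measure \<Rightarrow> (real \<Rightarrow> 'a \<Rightarrow> real ^ 'd) \<Rightarrow> real ^ 'd \<Rightarrow> (nat \<Rightarrow> 'a \<Rightarrow> real) \<Rightarrow> bool" where
  "is_rho2 M W u \<rho> \<longleftrightarrow>
     (\<exists>\<rho>s. (\<forall>\<epsilon>>0. ito_wiener_expansion M W (rho2_approx W u \<epsilon>) (\<rho>s \<epsilon>)) \<and>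
       (\<forall>\<gamma> < (4 - real CARD('d)) / 2.
          (\<forall>\<epsilon>>0. \<rho>s \<epsilon> \<in> sobolev M W \<gamma>) \<and> \<rho> \<in> sobolev M W \<gamma> \<and>
          ((\<lambda>\<epsilon>. sobolev_sq_norm M \<gamma> (\<lambda>k \<omega>. \<rho>s \<epsilon> k \<omega> - \<rho> k \<omega>)) \<longlongrightarrow> 0) (at_right 0)))"

primrec iterated_deriv ::
  "'v list \<Rightarrow> ('v::euclidean_space \<Rightarrow> real) \<Rightarrow> 'v \<Rightarrow> real" where
  "iterated_deriv [] f = f"
| "iterated_deriv (b # bs) f = (\<lambda>x. frechet_derivative (iterated_deriv bs f) (at x) b)"

definition Cb_infinity :: "('v::euclidean_space \<Rightarrow> real) set" where
  "Cb_infinity = {f. \<forall>bs. set bs \<subseteq> Basis \<longrightarrow>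
     bounded (range (iterated_deriv bs f)) \<and> (\<forall>x. iterated_deriv bs f differentiable (at x))}"

text \<open>The space of \<open>d \<times> n\<close> matrices is \<open>(real ^ 'd) ^ 'n\<close> with \<open>n = CARD('n)\<close>; the columns are
  numbered from \<open>1\<close> to \<open>n\<close> along the linear order of the index type.\<close>

definition column_number :: "'n::{finite,linorder} \<Rightarrow> nat" where
  "column_number j = card {i. i \<le> j}"

definition grid_values ::
  "(real \<Rightarrow> 'a \<Rightarrow> real ^ 'd) \<Rightarrow> 'a \<Rightarrow> (real ^ 'd) ^ 'n::{finite,linorder}" where
  "grid_values W \<omega> = (\<chi> j. W (real (column_number j) / real CARD('n)) \<omega>)"

definition mu ::
  "'a measure \<Rightarrow> (real \<Rightarrow> 'a \<Rightarrow> real ^ 'd) \<Rightarrow> ((real ^ 'd) ^ 'n::{finite,linorder}) measure" where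
  "mu M W = distr M borel (grid_values W)"

text \<open>For a generalized functional \<open>\<rho>\<close>: the finite measure \<open>\<theta>\<close> with
  \<open>\<integral> f d\<theta> = (f(W(1/n),\<dots>,W(1)), \<rho>)\<close>, where \<open>f(W(1/n),\<dots>,W(1))\<close> enters
  through its expansion \<open>F\<close>.\<close>

definition is_theta ::
  "'a measure \<Rightarrow> (real \<Rightarrow> 'a \<Rightarrow> real ^ 'd) \<Rightarrow> (nat \<Rightarrow> 'a \<Rightarrow> real) \<Rightarrow>
     ((real ^ 'd) ^ 'n::{finite,linorder}) measure \<Rightarrow> bool" where
  "is_theta M W \<rho> \<theta> \<longleftrightarrow> sets \<theta> = sets borel \<and> finite_measure \<theta> \<and>
     (\<forall>f\<in>Cb_infinity. \<exists>F. ito_wiener_expansion M W (\<lambda>\<omega>. f (grid_values W \<omega>)) F \<and>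
        (\<forall>\<alpha>>0. F \<in> sobolev M W \<alpha>) \<and> (\<integral>x. f x \<partial>\<theta>) = dual_pairing M F \<rho>)"

definition mass :: "real ^ 'd \<Rightarrow> real" where
  "mass u = (LINT (s, t):Delta2|lborel. heat_kernel (t - s) u)"

definition alpha :: "nat \<Rightarrow> nat \<Rightarrow> real \<Rightarrow> real \<Rightarrow> real" where
  "alpha n j s t = measure lborel ({s..t} \<inter> {(real j - 1) / real n..real j / real n})"

definition sigma_sq :: "nat \<Rightarrow> real \<Rightarrow> real \<Rightarrow> real" where
  "sigma_sq n s t = t - s - real n * (\<Sum>j=1..n. (alpha n j s t)\<^sup>2)"

definition couplings :: "'v::euclidean_space measure \<Rightarrow> 'v measure \<Rightarrow> ('v \<times> 'v) measure set" where
  "couplings \<nu>1 \<nu>2 = {\<nu>. sets \<nu> = sets (borel \<Otimes>\<^sub>M borel) \<and> prob_space \<nu> \<and>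
     distr \<nu> borel fst = \<nu>1 \<and> distr \<nu> borel snd = \<nu>2}"

definition wasserstein2_sq :: "'v::euclidean_space measure \<Rightarrow> 'v measure \<Rightarrow> ennreal" where
  "wasserstein2_sq \<nu>1 \<nu>2 = (INF \<nu>\<in>couplings \<nu>1 \<nu>2. \<integral>\<^sup>+ (x, y). ennreal ((norm (x - y))\<^sup>2) \<partial>\<nu>)"

end

theory Submission imports Defs "HOL-Real_Asymp.Real_Asymp" begin

text \<open>
  Conditionally on \<open>W t - W s = u\<close> the grid values of \<open>W\<close> have the law of
  \<open>X + c (u - (W t - W s))\<close>, where \<open>X\<close> are the unconditioned grid values and \<open>c\<close> are the
  regression coefficients of \<open>X\<close> on \<open>W t - W s\<close>. The normalised measure \<open>\<theta>\<close> is the mixture of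
  these conditional laws over \<open>(s, t)\<close> with density \<open>p(t - s, u) / m\<close>, where \<open>m\<close> is its mass. Using
  the same path in both components gives a coupling with \<open>\<mu>\<close> of cost
  \<open>|c|\<^sup>2 (|u|\<^sup>2 + d (t - s))\<close> for fixed \<open>(s, t)\<close>, so no general transport inequality is needed. The
  discrete Wirtinger inequality bounds \<open>|c|\<^sup>2\<close> by \<open>(t - s - \<sigma>\<^sup>2) / (\<kappa> (t - s)\<^sup>2)\<close>, where \<open>\<kappa>\<close> is the smallest
  eigenvalue of the inverse covariance of \<open>X\<close>. Two applications of \<open>ln x \<le> x - 1\<close>, to
  \<open>\<sigma>\<^sup>2 / (t - s)\<close> and to \<open>2 m / p(t - s, u)\<close>, then give the bound.

  To identify \<open>\<theta>\<close>, orthogonality of the chaoses turns the duality pairing with the approximations of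
  \<open>\<rho>\<^sub>2(u)\<close> into expectations, and these are computed with the bridge decomposition, which in turn
  follows from the Cameron--Martin formula for finitely many times.
\<close>

section \<open>The heat kernel\<close>

text \<open>\<open>Delta2\<close> has area 1/2, so 2 is the uniform density on it, and
  \<open>ln x \<le> x - 1\<close> at 2m/p is the Gibbs inequality comparing the time law p/m with
  the uniform law: an entropy bound hidden in a scalar estimate. It is effective because -2 ln p
  equals |u|^2/(t-s) + d ln(t-s) up to a constant, which are the very terms left over once the cost
  is estimated by ln(\<sigma>^2/(t-s)). Two obstacles shape the rest. For d at least 4 the limit
  \<rho> lives only in Sobolev spaces of negative index, so \<theta> is visible only through smooth
  functionals: it has to be identified by test functions in \<open>Cb_infinity\<close>, and the
  limit in the smoothing parameter has to be taken under the integral over \<open>Delta2\<close>.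
  The dominating constant comes from u being nonzero, because the heat kernel is bounded uniformly
  in time away from the origin. Secondly, a Bochner integral of a non-integrable function is 0, so
  ln(\<sigma>^2) p must be shown to be integrable, although \<sigma>^2 tends to 0 as s approaches t
  and vanishes when s and t are both grid points.\<close>

lemma heat_kernel_pos: "0 < \<epsilon> \<Longrightarrow> 0 < heat_kernel \<epsilon> z"
  by (simp add: heat_kernel_def)

lemma heat_kernel_nonneg [simp]: "0 \<le> heat_kernel \<epsilon> z"
  by (simp add: heat_kernel_def)

lemma borel_measurable_heat_kernel [measurable (raw)]:
  fixes g :: "'a \<Rightarrow> 'v::euclidean_space"
  assumes [measurable]: "f \<in> borel_measurable M" "g \<in> borel_measurable M"
  shows "(\<lambda>x. heat_kernel (f x) (g x)) \<in> borel_measurable M" unfolding heat_kernel_def by measurable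

lemma heat_kernel_le: "0 < \<epsilon> \<Longrightarrow> heat_kernel \<epsilon> (z::'v::euclidean_space) \<le> (2 * pi * \<epsilon>) powr (- real DIM('v) / 2)"
  unfolding heat_kernel_def by (intro mult_left_le) auto

text \<open>The product form reduces total mass and moments to one-dimensional normal
  integrals.\<close>

lemma heat_kernel_eq_prod_normal_density:
  fixes z :: "'v::euclidean_space"
  assumes "0 < \<epsilon>"
  shows "heat_kernel \<epsilon> z = (\<Prod>b\<in>Basis. normal_density 0 (sqrt \<epsilon>) (z \<bullet> b))"
proof -
  have "(\<Prod>b\<in>(Basis::'v set). normal_density 0 (sqrt \<epsilon>) (z \<bullet> b)) =
      (1 / sqrt (2 * pi * \<epsilon>)) ^ DIM('v) * exp (\<Sum>b\<in>Basis. - (z \<bullet> b)\<^sup>2 / (2 * \<epsilon>))"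
    using assms by (simp add: normal_density_def prod.distrib exp_sum prod_dividef power_one_over)
  also have "(\<Sum>b\<in>Basis. - (z \<bullet> b)\<^sup>2 / (2 * \<epsilon>)) = - (norm z)\<^sup>2 / (2 * \<epsilon>)"
    unfolding power2_norm_eq_inner euclidean_inner[of z z]
    by (simp add: sum_divide_distrib sum_negf power2_eq_square)
  also have "(1 / sqrt (2 * pi * \<epsilon>)) ^ DIM('v) = (2 * pi * \<epsilon>) powr (- real DIM('v) / 2)"
  proof -
    have "(2 * pi * \<epsilon>) powr (- real DIM('v) / 2) = ((2 * pi * \<epsilon>) powr (-1/2)) powr real DIM('v)"
      by (simp add: powr_powr)
    also have "(2 * pi * \<epsilon>) powr (-1/2) = 1 / sqrt (2 * pi * \<epsilon>)"
      using assms by (simp add: powr_minus powr_half_sqrt inverse_eq_divide flip: minus_divide_left)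
    also have "(1 / sqrt (2 * pi * \<epsilon>)) powr real DIM('v) = (1 / sqrt (2 * pi * \<epsilon>)) ^ DIM('v)"
      using assms by (simp add: powr_realpow)
    finally show ?thesis by simp
  qed
  finally show ?thesis by (simp add: heat_kernel_def)
qed

lemma nn_integral_normal_density:
  assumes "0 < \<sigma>" shows "(\<integral>\<^sup>+x. ennreal (normal_density \<mu> \<sigma> x) \<partial>lborel) = 1"
  using assms by (subst nn_integral_eq_integral) auto

lemma nn_integral_heat_kernel:
  assumes "0 < \<epsilon>"
  shows "(\<integral>\<^sup>+z. ennreal (heat_kernel \<epsilon> (z::'v::euclidean_space)) \<partial>lborel) = 1"
proof -
  have "(\<integral>\<^sup>+z. ennreal (heat_kernel \<epsilon> (z::'v)) \<partial>lborel) =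
    (\<integral>\<^sup>+z. (\<Prod>b\<in>Basis. ennreal (normal_density 0 (sqrt \<epsilon>) (z \<bullet> b))) \<partial>(lborel::'v measure))"
    using assms by (simp add: heat_kernel_eq_prod_normal_density prod_ennreal)
  also have "\<dots> = (\<Prod>b\<in>(Basis::'v set). 1)"
    using assms by (subst nn_integral_lborel_prod) (simp_all add: nn_integral_normal_density)
  finally show ?thesis by simp
qed

text \<open>Even powers keep every factor nonnegative, so the product formula for nonnegative
  integrals applies without any integrability argument. The case \<open>k = 1\<close> gives the
  second moment.\<close>

lemma nn_integral_heat_kernel_coordinate_power:
  assumes "0 < \<epsilon>" "b \<in> Basis"
  shows "(\<integral>\<^sup>+z. ennreal (heat_kernel \<epsilon> z * (z \<bullet> b) ^ (2 * k)) \<partial>(lborel::'v::euclidean_space measure)) =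
    (\<integral>\<^sup>+x. ennreal (normal_density 0 (sqrt \<epsilon>) x * x ^ (2 * k)) \<partial>lborel)"
proof -
  let ?f = "\<lambda>c x. ennreal (normal_density 0 (sqrt \<epsilon>) x * (if c = b then x ^ (2 * k) else 1))"
  have "(\<integral>\<^sup>+z. ennreal (heat_kernel \<epsilon> z * (z \<bullet> b) ^ (2 * k)) \<partial>(lborel::'v measure)) =
    (\<integral>\<^sup>+z. (\<Prod>c\<in>Basis. ?f c (z \<bullet> c)) \<partial>(lborel::'v measure))"
  proof (rule nn_integral_cong)
    fix z :: 'v
    have "(\<Prod>c\<in>Basis. ?f c (z \<bullet> c)) = ennreal (\<Prod>c\<in>Basis. normal_density 0 (sqrt \<epsilon>) (z \<bullet> c) * (if c = b then (z \<bullet> c) ^ (2 * k) else 1))"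
      by (intro prod_ennreal) (auto simp: power_mult)
    also have "\<dots> = ennreal (heat_kernel \<epsilon> z * (z \<bullet> b) ^ (2 * k))"
      using assms by (simp add: prod.distrib heat_kernel_eq_prod_normal_density prod.delta)
    finally show "ennreal (heat_kernel \<epsilon> z * (z \<bullet> b) ^ (2 * k)) = (\<Prod>c\<in>Basis. ?f c (z \<bullet> c))" ..
  qed
  also have "\<dots> = (\<Prod>c\<in>(Basis::'v set). (\<integral>\<^sup>+x. ?f c x \<partial>lborel))"
    by (subst nn_integral_lborel_prod) (auto simp: power_mult)
  also have "\<dots> = (\<Prod>c\<in>(Basis::'v set). if c = b then (\<integral>\<^sup>+x. ennreal (normal_density 0 (sqrt \<epsilon>) x * x ^ (2 * k)) \<partial>lborel) else 1)"
    using assms by (intro prod.cong refl) (simp add: nn_integral_normal_density)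
  also have "\<dots> = (\<integral>\<^sup>+x. ennreal (normal_density 0 (sqrt \<epsilon>) x * x ^ (2 * k)) \<partial>lborel)"
    using assms by (simp add: prod.delta)
  finally show ?thesis .
qed

lemma nn_integral_heat_kernel_norm_sq:
  assumes "0 < \<epsilon>"
  shows "(\<integral>\<^sup>+z. ennreal (heat_kernel \<epsilon> z * (norm z)\<^sup>2) \<partial>(lborel::'v::euclidean_space measure)) =
    ennreal (real DIM('v) * \<epsilon>)"
proof -
  have *: "(\<integral>\<^sup>+x. ennreal (normal_density 0 (sqrt \<epsilon>) x * x ^ 2) \<partial>lborel) = ennreal \<epsilon>"
    using normal_moment_even[of "sqrt \<epsilon>" 0 1] assms
    by (subst nn_integral_eq_integral) (auto simp: has_bochner_integral_iff fact_numeral)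
  have "(\<integral>\<^sup>+z. ennreal (heat_kernel \<epsilon> z * (norm z)\<^sup>2) \<partial>(lborel::'v measure)) =
     (\<integral>\<^sup>+z. (\<Sum>b\<in>Basis. ennreal (heat_kernel \<epsilon> z * (z \<bullet> b) ^ (2 * 1))) \<partial>(lborel::'v measure))"
    by (intro nn_integral_cong, unfold power2_norm_eq_inner, subst euclidean_inner)
       (simp add: sum_distrib_left power2_eq_square sum_ennreal)
  also have "\<dots> = (\<Sum>b\<in>(Basis::'v set). ennreal \<epsilon>)"
    using assms by (subst nn_integral_sum) (auto simp: nn_integral_heat_kernel_coordinate_power[where k=1, simplified] *)
  also have "\<dots> = ennreal (real DIM('v) * \<epsilon>)"
    using assms by (simp add: ennreal_mult ennreal_of_nat_eq_real_of_nat)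
  finally show ?thesis .
qed

text \<open>The Gaussian factor beats the blow-up of the normalisation as the time tends to 0. With
  \<open>a\<close> half the dimension and \<open>y\<close> the exponent at distance
  \<open>r\<close>, raising \<open>y / a \<le> exp (y / a)\<close> to the power \<open>a\<close>
  gives \<open>exp (- y) \<le> (a / y) powr a\<close>, and the powers of \<epsilon> then cancel.
  This uniformity in time is the source of all later domination over \<open>Delta2\<close>.\<close>

lemma heat_kernel_bound_away_from_0:
  assumes "0 < r"
  obtains K where "0 < K" "\<And>\<epsilon> z. 0 < \<epsilon> \<Longrightarrow> r \<le> norm z \<Longrightarrow> heat_kernel \<epsilon> (z::'v::euclidean_space) \<le> K"
proof
  define a where "a = real DIM('v) / 2"
  have a: "a > 0" by (simp add: a_def)
  show "0 < (a / (pi * r\<^sup>2)) powr a" using a assms by simp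
  fix \<epsilon> :: real and z :: 'v assume *: "0 < \<epsilon>" "r \<le> norm z"
  define y where "y = r\<^sup>2 / (2 * \<epsilon>)"
  have y: "y > 0" using * assms by (simp add: y_def)
  have "y / a \<le> exp (y / a)" using exp_ge_add_one_self[of "y / a"] by linarith
  then have "(y / a) powr a \<le> exp (y / a) powr a" using y a by (intro powr_mono2) auto
  also have "\<dots> = exp y" using a by (simp add: powr_def)
  finally have 1: "exp (- y) \<le> (a / y) powr a"
    using y a by (simp add: exp_minus powr_divide field_simps)
  have "exp (- (norm z)\<^sup>2 / (2 * \<epsilon>)) \<le> exp (- y)"
    using * assms by (simp add: y_def divide_right_mono power_mono)
  also note 1
  finally have "heat_kernel \<epsilon> z \<le> (2 * pi * \<epsilon>) powr (- a) * (a / y) powr a"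
    unfolding heat_kernel_def by (simp add: a_def mult_left_mono)
  also have "\<dots> = (a / y / (2 * pi * \<epsilon>)) powr a"
    using a y * by (simp add: powr_minus powr_divide powr_mult field_simps)
  also have "a / y / (2 * pi * \<epsilon>) = a / (pi * r\<^sup>2)" using * assms by (simp add: y_def field_simps)
  finally show "heat_kernel \<epsilon> z \<le> (a / (pi * r\<^sup>2)) powr a" .
qed

text \<open>Completing the square: this ratio of densities is the Cameron--Martin factor of a single
  increment, with drift \<open>w\<close> per unit of time.\<close>

lemma heat_kernel_shift:
  assumes "0 < \<epsilon>"
  shows "heat_kernel \<epsilon> (z - \<epsilon> *\<^sub>R w) = heat_kernel \<epsilon> z * exp (w \<bullet> z - \<epsilon> * (norm w)\<^sup>2 / 2)"
proof -
  have "- (norm (z - \<epsilon> *\<^sub>R w))\<^sup>2 / (2 * \<epsilon>) = - (norm z)\<^sup>2 / (2 * \<epsilon>) + (w \<bullet> z - \<epsilon> * (norm w)\<^sup>2 / 2)"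
    using assms unfolding power2_norm_eq_inner inner_diff_left inner_diff_right
    by (simp add: inner_commute field_simps)
  then show ?thesis by (simp only: heat_kernel_def exp_add mult.assoc)
qed

lemma nn_integral_lborel_translate:
  fixes c :: "'v::euclidean_space"
  assumes [measurable]: "f \<in> borel_measurable borel"
  shows "(\<integral>\<^sup>+x. f (x + c) \<partial>lborel) = (\<integral>\<^sup>+x. f x \<partial>lborel)"
proof -
  have "(\<integral>\<^sup>+x. f x \<partial>lborel) = (\<integral>\<^sup>+x. f x \<partial>distr lborel borel ((+) c))"
    by (simp add: lborel_distr_plus)
  also have "\<dots> = (\<integral>\<^sup>+x. f (x + c) \<partial>lborel)" by (subst nn_integral_distr) (auto simp: add.commute)
  finally show ?thesis ..
qed

lemma nn_integral_lborel_reflect: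
  fixes c :: "'v::euclidean_space"
  assumes [measurable]: "f \<in> borel_measurable borel"
  shows "(\<integral>\<^sup>+x. f (c - x) \<partial>lborel) = (\<integral>\<^sup>+x. f x \<partial>lborel)"
proof -
  have "lborel = density (distr lborel borel (\<lambda>x::'v. c + (-1) *\<^sub>R x)) (\<lambda>_. ennreal (\<bar>-1\<bar>^DIM('v)))"
    by (rule lborel_affine) auto
  then have "lborel = distr lborel borel (\<lambda>x::'v. c - x)" by (simp add: density_1)
  then have "(\<integral>\<^sup>+x. f x \<partial>lborel) = (\<integral>\<^sup>+x. f x \<partial>distr lborel borel (\<lambda>x. c - x))" by metis
  also have "\<dots> = (\<integral>\<^sup>+x. f (c - x) \<partial>lborel)" by (subst nn_integral_distr) auto
  finally show ?thesis ..
qed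

text \<open>The kernel is even, so the integral can be averaged over \<open>z\<close> and
  \<open>-z\<close>; the parallelogram identity then removes the cross term, and no signed integral
  occurs.\<close>

lemma nn_integral_heat_kernel_shifted_norm_sq:
  assumes "0 < \<epsilon>"
  shows "(\<integral>\<^sup>+z. ennreal (heat_kernel \<epsilon> z * (norm (u - z))\<^sup>2) \<partial>(lborel::'v::euclidean_space measure)) =
    ennreal ((norm u)\<^sup>2 + real DIM('v) * \<epsilon>)"
proof -
  let ?I = "\<integral>\<^sup>+z. ennreal (heat_kernel \<epsilon> z * (norm (u - z))\<^sup>2) \<partial>(lborel::'v measure)"
  have "?I = (\<integral>\<^sup>+z. ennreal (heat_kernel \<epsilon> z * (norm (u + z))\<^sup>2) \<partial>(lborel::'v measure))"
    by (subst nn_integral_lborel_reflect[symmetric, where c=0]) (simp_all add: heat_kernel_def)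
  then have "?I + ?I = (\<integral>\<^sup>+z. ennreal (heat_kernel \<epsilon> z * (norm (u - z))\<^sup>2) + ennreal (heat_kernel \<epsilon> z * (norm (u + z))\<^sup>2) \<partial>(lborel::'v measure))"
    by (subst nn_integral_add) auto
  also have "\<dots> = (\<integral>\<^sup>+z. ennreal (2 * (norm u)\<^sup>2) * ennreal (heat_kernel \<epsilon> z) + 2 * ennreal (heat_kernel \<epsilon> z * (norm z)\<^sup>2) \<partial>(lborel::'v measure))"
  proof (rule nn_integral_cong)
    fix z :: 'v
    have "heat_kernel \<epsilon> z * (norm (u - z))\<^sup>2 + heat_kernel \<epsilon> z * (norm (u + z))\<^sup>2 =
      2 * (norm u)\<^sup>2 * heat_kernel \<epsilon> z + 2 * (heat_kernel \<epsilon> z * (norm z)\<^sup>2)"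
      unfolding power2_norm_eq_inner by (simp add: inner_simps inner_commute algebra_simps)
    then show "ennreal (heat_kernel \<epsilon> z * (norm (u - z))\<^sup>2) + ennreal (heat_kernel \<epsilon> z * (norm (u + z))\<^sup>2) =
      ennreal (2 * (norm u)\<^sup>2) * ennreal (heat_kernel \<epsilon> z) + 2 * ennreal (heat_kernel \<epsilon> z * (norm z)\<^sup>2)"
      by (simp flip: ennreal_plus ennreal_mult' ennreal_mult'' ennreal_numeral)
  qed
  also have "\<dots> = ennreal (2 * (norm u)\<^sup>2) + 2 * ennreal (real DIM('v) * \<epsilon>)"
    using assms by (simp add: nn_integral_add nn_integral_cmult nn_integral_heat_kernel nn_integral_heat_kernel_norm_sq)
  also have "\<dots> = 2 * ennreal ((norm u)\<^sup>2 + real DIM('v) * \<epsilon>)"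
    using assms by (simp add: algebra_simps flip: ennreal_plus ennreal_mult' ennreal_mult'' ennreal_numeral)
  finally have "2 * ?I = 2 * ennreal ((norm u)\<^sup>2 + real DIM('v) * \<epsilon>)" by (simp add: mult_2)
  then show ?thesis by (simp add: ennreal_mult_cancel_left)
qed

section \<open>Measures determined by smooth bounded functions\<close>

definition logistic :: "real \<Rightarrow> real" where "logistic y = 1 / (1 + exp (- y))"

lemma one_plus_exp_neq_0 [simp]: "1 + exp (x::real) \<noteq> 0"
  using exp_gt_zero[of x] by linarith

lemma logistic_bounds: "0 \<le> logistic y" "logistic y \<le> 1"
proof -
  have "0 < 1 + exp (- y)" by (intro add_pos_pos) auto
  then show "0 \<le> logistic y" "logistic y \<le> 1" by (auto simp: logistic_def divide_le_eq)
qed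

lemma DERIV_logistic: "(logistic has_real_derivative logistic y * (1 - logistic y)) (at y)"
  unfolding logistic_def
  by (rule derivative_eq_intros refl | simp)+ (simp add: field_simps power2_eq_square)

text \<open>The logistic function L satisfies L' = L (1 - L), so polynomials in logistic functions
  of affine forms are closed under directional derivatives, and all of them are bounded. This yields
  enough members of \<open>Cb_infinity\<close> without bump functions.\<close>

inductive_set logistic_algebra :: "('v::euclidean_space \<Rightarrow> real) set" where
  const: "(\<lambda>_. c) \<in> logistic_algebra"
| logistic: "(\<lambda>x. logistic (v \<bullet> x + c)) \<in> logistic_algebra"
| add: "f \<in> logistic_algebra \<Longrightarrow> g \<in> logistic_algebra \<Longrightarrow> (\<lambda>x. f x + g x) \<in> logistic_algebra"
| mult: "f \<in> logistic_algebra \<Longrightarrow> g \<in> logistic_algebra \<Longrightarrow> (\<lambda>x. f x * g x) \<in> logistic_algebra"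

lemma logistic_algebra_bounded: "f \<in> logistic_algebra \<Longrightarrow> bounded (range f)"
proof (induction rule: logistic_algebra.induct)
  case (const c) then show ?case by simp
next
  case (logistic v c) then show ?case by (rule boundedI[where B=1]) (auto simp: logistic_bounds)
next
  case (add f g)
  then show ?case using bounded_plus_comp[of f UNIV g] by simp
next
  case (mult f g)
  then obtain A B where "\<And>x. \<bar>f x\<bar> \<le> A" "\<And>x. \<bar>g x\<bar> \<le> B" by (auto simp: bounded_real)
  then show ?case
    by (intro boundedI[where B="A * B"]) (auto simp: abs_mult intro!: mult_mono order_trans[OF abs_ge_zero, of _ A])
qed

lemma logistic_algebra_has_derivative:
  "f \<in> logistic_algebra \<Longrightarrow>
    \<exists>f'. (\<forall>x. (f has_derivative f' x) (at x)) \<and> (\<forall>b. (\<lambda>x. f' x b) \<in> logistic_algebra)"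
proof (induction rule: logistic_algebra.induct)
  case (const c)
  then show ?case by (intro exI[of _ "\<lambda>_ _. 0"]) (auto intro: logistic_algebra.const)
next
  case (logistic v c)
  let ?L = "\<lambda>x. logistic (v \<bullet> x + c)"
  have "(?L has_derivative (\<lambda>b. ?L x * (1 + (-1) * ?L x) * (v \<bullet> b))) (at x)" for x
  proof -
    have "((\<lambda>x. v \<bullet> x + c) has_derivative (\<lambda>b. v \<bullet> b)) (at x)"
      by (auto intro!: derivative_eq_intros)
    from has_derivative_compose[OF this DERIV_logistic[unfolded has_field_derivative_def]]
    show ?thesis by (simp add: mult_ac)
  qed
  moreover have "(\<lambda>x. ?L x * (1 + (-1) * ?L x) * (v \<bullet> b)) \<in> logistic_algebra" for b
    by (intro logistic_algebra.intros)
  ultimately show ?case by (intro exI[of _ "\<lambda>x b. ?L x * (1 + (-1) * ?L x) * (v \<bullet> b)"]) blast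
next
  case (add f g)
  then obtain f' g' where "\<forall>x. (f has_derivative f' x) (at x)" "\<forall>b. (\<lambda>x. f' x b) \<in> logistic_algebra"
    "\<forall>x. (g has_derivative g' x) (at x)" "\<forall>b. (\<lambda>x. g' x b) \<in> logistic_algebra" by blast
  then show ?case by (intro exI[of _ "\<lambda>x b. f' x b + g' x b"])
       (auto intro!: logistic_algebra.add has_derivative_add)
next
  case (mult f g)
  then obtain f' g' where *: "\<And>x. (f has_derivative f' x) (at x)" "\<And>b. (\<lambda>x. f' x b) \<in> logistic_algebra"
    "\<And>x. (g has_derivative g' x) (at x)" "\<And>b. (\<lambda>x. g' x b) \<in> logistic_algebra" by blast
  show ?case by (intro exI[of _ "\<lambda>x b. f x * g' x b + f' x b * g x"] conjI allI
        has_derivative_mult * logistic_algebra.add logistic_algebra.mult mult.hyps)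
qed

lemma logistic_algebra_subset_Cb_infinity: "logistic_algebra \<subseteq> Cb_infinity"
proof
  fix f :: "'a \<Rightarrow> real" assume f: "f \<in> logistic_algebra"
  have "iterated_deriv bs f \<in> logistic_algebra" for bs
  proof (induction bs)
    case (Cons b bs)
    obtain f' where "\<And>x. (iterated_deriv bs f has_derivative f' x) (at x)" "\<And>b. (\<lambda>x. f' x b) \<in> logistic_algebra"
      using logistic_algebra_has_derivative[OF Cons] by blast
    moreover from this(1) have "frechet_derivative (iterated_deriv bs f) (at x) = f' x" for x
      by (metis frechet_derivative_at)
    ultimately show ?case by simp
  qed (simp add: f)
  then show "f \<in> Cb_infinity" unfolding Cb_infinity_def
    using logistic_algebra_bounded logistic_algebra_has_derivative by (auto simp: differentiable_def) blast
qed

lemma logistic_algebra_prod: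
  "finite I \<Longrightarrow> (\<And>i. i \<in> I \<Longrightarrow> f i \<in> logistic_algebra) \<Longrightarrow> (\<lambda>x. \<Prod>i\<in>I. f i x) \<in> logistic_algebra"
  by (induction I rule: finite_induct) (auto intro: logistic_algebra.intros)

text \<open>The two scales make the limit exact at the boundary: the quadratic term wins for
  positive \<open>y\<close>, while at \<open>y = 0\<close> the shift by \<open>- real m\<close>
  forces the limit 0 instead of 1/2.\<close>

lemma logistic_tendsto_indicator:
  "(\<lambda>m. logistic (real m ^ 2 * y - real m)) \<longlonglongrightarrow> indicator {0<..} y"
proof (cases "y > 0")
  case True
  have "filterlim (\<lambda>m. real m ^ 2 * y - real m) at_top sequentially" using True by real_asymp
  moreover have "(logistic \<longlongrightarrow> 1) at_top" unfolding logistic_def by real_asymp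
  ultimately show ?thesis using True filterlim_compose[of logistic] by simp
next
  case False
  have "filterlim (\<lambda>m. - real m) at_bot sequentially" by real_asymp
  then have "filterlim (\<lambda>m. real m ^ 2 * y - real m) at_bot sequentially"
    by (rule filterlim_at_bot_mono) (use False in \<open>auto simp: mult_nonneg_nonpos\<close>)
  moreover have "(logistic \<longlongrightarrow> 0) at_bot" unfolding logistic_def by real_asymp
  ultimately show ?thesis using False filterlim_compose[of logistic] by simp
qed

lemma continuous_on_Cb_infinity: "f \<in> Cb_infinity \<Longrightarrow> continuous_on UNIV f"
  unfolding Cb_infinity_def
  by (auto simp: continuous_on_eq_continuous_at dest!: spec[of _ "[]"] intro: differentiable_imp_continuous_within)

lemma borel_measurable_Cb_infinity: "f \<in> Cb_infinity \<Longrightarrow> f \<in> borel_measurable borel"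
  by (intro borel_measurable_continuous_onI continuous_on_Cb_infinity)

text \<open>Open boxes form a generator stable under intersection, and their indicators are bounded
  limits of products of logistic functions. These products take values in [0,1], so testing with
  such functions suffices; this lets later computations stay with nonnegative integrals.\<close>

lemma finite_measure_eqI_Cb_infinity:
  fixes \<mu> \<nu> :: "'v::euclidean_space measure"
  assumes sets: "sets \<mu> = sets borel" "sets \<nu> = sets borel"
    and fin: "finite_measure \<mu>" "finite_measure \<nu>"
    and eq: "\<And>f. f \<in> Cb_infinity \<Longrightarrow> (\<And>x. 0 \<le> f x \<and> f x \<le> 1) \<Longrightarrow> (\<integral>x. f x \<partial>\<mu>) = (\<integral>x. f x \<partial>\<nu>)"
  shows "\<mu> = \<nu>"
proof -
  interpret \<mu>: finite_measure \<mu> by fact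
  interpret \<nu>: finite_measure \<nu> by fact
  have [measurable_cong]: "sets \<mu> = sets borel" "sets \<nu> = sets borel" by (fact sets)+
  \<comment> \<open>One logistic factor for each face of the box \<open>box a c\<close>. The
    coefficients are written out so that each argument is literally of the form
    \<open>v \<bullet> x + c\<close> required by \<open>logistic_algebra\<close>.\<close>
  define h where "h m a c = (\<lambda>x. \<Prod>b\<in>Basis. logistic (((real m)\<^sup>2 *\<^sub>R b) \<bullet> x + (- (real m)\<^sup>2 * (a \<bullet> b) - real m)) *
      logistic ((- (real m)\<^sup>2 *\<^sub>R b) \<bullet> x + ((real m)\<^sup>2 * (c \<bullet> b) - real m)))" for m and a c :: 'v
  have h_alg: "h m a c \<in> Cb_infinity" for m a c unfolding h_def
    by (intro subsetD[OF logistic_algebra_subset_Cb_infinity] logistic_algebra_prod logistic_algebra.mult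
        logistic_algebra.logistic finite_Basis)
  have h_bounds: "0 \<le> h m a c x \<and> h m a c x \<le> 1" for m a c x
    unfolding h_def by (intro conjI prod_nonneg prod_le_1 ballI mult_nonneg_nonneg mult_le_one logistic_bounds)
  have h_lim: "(\<lambda>m. h m a c x) \<longlonglongrightarrow> indicator (box a c) x" for a c x
  proof -
    have "(\<lambda>m. h m a c x) \<longlonglongrightarrow>
        (\<Prod>b\<in>Basis. indicator {0<..} (x \<bullet> b - a \<bullet> b) * indicator {0<..} (c \<bullet> b - x \<bullet> b))"
    proof -
      have "h m a c x = (\<Prod>b\<in>Basis. logistic ((real m)\<^sup>2 * (x \<bullet> b - a \<bullet> b) - real m) *
         logistic ((real m)\<^sup>2 * (c \<bullet> b - x \<bullet> b) - real m))" for m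
        unfolding h_def by (intro prod.cong refl) (simp add: inner_commute algebra_simps)
      then show ?thesis by (simp only:) (intro tendsto_prod tendsto_mult logistic_tendsto_indicator)
    qed
    also have "(\<Prod>b\<in>Basis. indicator {0<..} (x \<bullet> b - a \<bullet> b) * indicator {0<..} (c \<bullet> b - x \<bullet> b)) =
      (indicator (box a c) x :: real)"
    proof (cases "x \<in> box a c")
      case True
      then show ?thesis by (simp add: mem_box)
    next
      case False
      then obtain b where "b \<in> Basis" "\<not> (a \<bullet> b < x \<bullet> b \<and> x \<bullet> b < c \<bullet> b)" by (auto simp: mem_box)
      then have "(\<Prod>b\<in>Basis. indicator {0<..} (x \<bullet> b - a \<bullet> b) * indicator {0<..} (c \<bullet> b - x \<bullet> b)) = (0::real)"
        by (intro prod_zero finite_Basis bexI[of _ b]) auto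
      then show ?thesis using False by simp
    qed
    finally show ?thesis .
  qed
  have meas_h [measurable]: "h m a c \<in> borel_measurable borel" for m a c
    by (rule borel_measurable_Cb_infinity[OF h_alg])
  have box: "measure \<mu> (box a c) = measure \<nu> (box a c)" for a c
  proof -
    have lim: "(\<lambda>m. \<integral>x. h m a c x \<partial>N) \<longlonglongrightarrow> measure N (box a c)"
      if N: "finite_measure N" "sets N = sets borel" for N
    proof -
      interpret finite_measure N by fact
      have [measurable_cong]: "sets N = sets borel" by fact
      have "(\<lambda>m. \<integral>x. h m a c x \<partial>N) \<longlonglongrightarrow> (\<integral>x. indicator (box a c) x \<partial>N)"
        by (rule integral_dominated_convergence[where w="\<lambda>_. 1"])
           (use h_bounds in \<open>auto intro!: h_lim\<close>)
      then show ?thesis using sets_eq_imp_space_eq[OF N(2)] by simp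
    qed
    show ?thesis by (rule LIMSEQ_unique[OF lim[OF fin(1) sets(1)]])
         (use lim[OF fin(2) sets(2)] eq[OF h_alg h_bounds] in simp)
  qed
  show ?thesis
  proof (rule measure_eqI_generator_eq)
    let ?E = "range (\<lambda>(a, c). box a c :: 'v set)"
    show "Int_stable ?E"
    proof (rule Int_stableI)
      fix A B :: "'v set" assume "A \<in> ?E" "B \<in> ?E"
      then obtain a c a' c' where "A = box a c" "B = box a' c'" by auto
      then have "A \<inter> B = box (\<Sum>b\<in>Basis. max (a \<bullet> b) (a' \<bullet> b) *\<^sub>R b) (\<Sum>b\<in>Basis. min (c \<bullet> b) (c' \<bullet> b) *\<^sub>R b)"
        by (auto simp: mem_box)
      then show "A \<inter> B \<in> ?E" by auto
    qed
    show "?E \<subseteq> Pow UNIV" by auto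
    show "emeasure \<mu> X = emeasure \<nu> X" if X: "X \<in> ?E" for X
    proof -
      obtain p where "X = (\<lambda>(a, c). box a c) p" using X by (rule rangeE)
      then have "X = box (fst p) (snd p)" by (simp add: case_prod_beta)
      then show ?thesis by (simp only: \<mu>.emeasure_eq_measure \<nu>.emeasure_eq_measure box)
    qed
    have "sets (borel :: 'v measure) = sigma_sets UNIV ?E"
      by (subst borel_eq_box, rule sets_measure_of) blast
    then show "sets \<mu> = sigma_sets UNIV ?E" "sets \<nu> = sigma_sets UNIV ?E" by (simp_all only: sets)
    show "range (\<lambda>n::nat. box (- (real n *\<^sub>R One)) (real n *\<^sub>R One)) \<subseteq> ?E" by auto
    show "(\<Union>i::nat. box (- (real i *\<^sub>R One)) (real i *\<^sub>R One)) = (UNIV :: 'v set)"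
      by (rule UN_box_eq_UNIV)
    show "emeasure \<mu> (box (- (real i *\<^sub>R One)) (real i *\<^sub>R One)) \<noteq> \<infinity>" for i by simp
  qed
qed

section \<open>Conditional variances and a discrete Wirtinger inequality\<close>

lemma two_mult_le_weighted_squares:
  assumes "0 < (p::real)" "0 < q"
  shows "2 * (x * y) \<le> x\<^sup>2 * (q / p) + y\<^sup>2 * (p / q)"
proof -
  have "0 \<le> (x * q - y * p)\<^sup>2 / (p * q)" using assms by simp
  also have "\<dots> = x\<^sup>2 * (q / p) + y\<^sup>2 * (p / q) - 2 * (x * y)"
    using assms by (simp add: field_simps power2_eq_square)
  finally show ?thesis by simp
qed

text \<open>The constant is the lowest eigenvalue of the discrete Laplacian on 0, ..., n with
  Dirichlet condition at 0 and a free end at n. The ground state is sin(j \<theta>); the free end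
  asks for sin((n+1) \<theta>) = sin(n \<theta>), whose smallest positive solution is \<theta> =
  pi/(2n+1), and there the ground state is positive. The induction carries a boundary term that
  vanishes at n for exactly this reason.\<close>

lemma discrete_wirtinger:
  fixes x :: "nat \<Rightarrow> real"
  assumes "1 \<le> n" "x 0 = 0"
  shows "2 * (1 - cos (pi / (2 * real n + 1))) * (\<Sum>j=1..n. (x j)\<^sup>2) \<le> (\<Sum>j=1..n. (x j - x (j - 1))\<^sup>2)"
proof -
  define \<theta> where "\<theta> = pi / (2 * real n + 1)"
  define \<phi> where "\<phi> j = sin (real j * \<theta>)" for j
  define l where "l = 2 * (1 - cos \<theta>)"
  have pos: "\<phi> j > 0" if "1 \<le> j" "j \<le> n + 1" for j
  proof -
    have "real j * pi < pi * (2 * real n + 1)" using that assms by (simp add: mult.commute)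
    then show ?thesis unfolding \<phi>_def \<theta>_def using that assms
      by (intro sin_gt_zero) (auto simp: divide_less_eq)
  qed
  have rec: "\<phi> (Suc (Suc k)) = 2 * cos \<theta> * \<phi> (Suc k) - \<phi> k" for k
  proof -
    have *: "real (Suc (Suc k)) * \<theta> = real (Suc k) * \<theta> + \<theta>" "real k * \<theta> = real (Suc k) * \<theta> - \<theta>"
      by (auto simp: algebra_simps)
    show ?thesis unfolding \<phi>_def * sin_add sin_diff by simp
  qed
  have last: "\<phi> (Suc n) = \<phi> n"
  proof -
    have "real (Suc n) * \<theta> = pi - real n * \<theta>" by (simp add: \<theta>_def field_simps)
    then show ?thesis by (simp only: \<phi>_def sin_pi_minus)
  qed
  \<comment> \<open>Each difference is bounded below by Picone's inequality with the ground state \<open>\<phi>\<close>.\<close>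
  have "l * (\<Sum>j=1..k. (x j)\<^sup>2) + (x k)\<^sup>2 * (\<phi> (Suc k) / \<phi> k - 1) \<le> (\<Sum>j=1..k. (x j - x (j - 1))\<^sup>2)"
    if "1 \<le> k" "k \<le> n" for k using that
  proof (induction k rule: dec_induct)
    case base
    have "\<phi> 2 / \<phi> 1 = 2 * cos \<theta>" using rec[of 0] pos[of 1] by (simp add: numeral_2_eq_2 \<phi>_def)
    then have "l * (x 1)\<^sup>2 + (x 1)\<^sup>2 * (\<phi> 2 / \<phi> 1 - 1) = (x 1)\<^sup>2" by (simp add: l_def algebra_simps)
    then show ?case using assms by (simp add: numeral_2_eq_2)
  next
    case (step k)
    have p: "\<phi> k > 0" "\<phi> (Suc k) > 0" using step by (auto intro!: pos)
    have "\<phi> (Suc (Suc k)) / \<phi> (Suc k) = 2 * cos \<theta> - \<phi> k / \<phi> (Suc k)"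
      using p by (simp add: rec diff_divide_distrib)
    then have "l * (x (Suc k))\<^sup>2 + (x (Suc k))\<^sup>2 * (\<phi> (Suc (Suc k)) / \<phi> (Suc k) - 1) =
        (x (Suc k))\<^sup>2 - (x (Suc k))\<^sup>2 * (\<phi> k / \<phi> (Suc k))"
      unfolding l_def by (simp only:) (simp add: algebra_simps)
    also have "\<dots> \<le> (x (Suc k) - x k)\<^sup>2 + (x k)\<^sup>2 * (\<phi> (Suc k) / \<phi> k - 1)"
      using two_mult_le_weighted_squares[OF p(1) p(2), of "x k" "x (Suc k)"]
      by (simp add: power2_diff algebra_simps)
    finally show ?case using step by (simp add: algebra_simps)
  qed
  from this[of n] show ?thesis using assms pos[of n] by (simp add: last l_def \<theta>_def)
qed

text \<open>\<open>overlap s t q\<close> is the length of \<open>[s,t] \<inter> [0,q]\<close>, that is, the covariance (per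
  component) of \<open>W(t) - W(s)\<close> and \<open>W(q)\<close>.\<close>

definition overlap :: "real \<Rightarrow> real \<Rightarrow> real \<Rightarrow> real" where
  "overlap s t q = min t q - min s q"

lemma borel_measurable_overlap [measurable (raw)]:
  assumes [measurable]: "f \<in> borel_measurable M" "g \<in> borel_measurable M"
  shows "(\<lambda>x. overlap (f x) (g x) q) \<in> borel_measurable M" unfolding overlap_def by measurable

lemma alpha_eq_overlap:
  assumes "s < t" "1 \<le> n"
  shows "alpha n j s t = overlap s t (real j / real n) - overlap s t ((real j - 1) / real n)"
proof -
  have "(real j - 1) / real n \<le> real j / real n" using assms by (simp add: divide_right_mono)
  moreover have "overlap s t b - overlap s t a = measure lborel ({s..t} \<inter> {a..b})" if "a \<le> b" for a b
  proof -
    have "{s..t} \<inter> {a..b} = {max s a..min t b}" by auto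
    moreover have "measure lborel {max s a..min t b} = max 0 (min t b - max s a)"
      by (cases "max s a \<le> min t b") auto
    ultimately show ?thesis using that assms by (auto simp: overlap_def min_def max_def)
  qed
  ultimately show ?thesis by (simp add: alpha_def)
qed

lemma alpha_bounds:
  assumes "1 \<le> n" shows "0 \<le> alpha n j s t" "alpha n j s t \<le> 1 / real n"
proof -
  show "0 \<le> alpha n j s t" by (simp add: alpha_def)
  have "alpha n j s t \<le> measure lborel {(real j - 1) / real n..real j / real n}"
    unfolding alpha_def by (intro measure_mono_fmeasurable) (auto simp: fmeasurable_def emeasure_lborel_Icc_eq)
  also have "\<dots> = 1 / real n" using assms by (simp add: divide_right_mono diff_divide_distrib)
  finally show "alpha n j s t \<le> 1 / real n" .
qed

lemma sum_alpha:
  assumes "0 \<le> s" "s < t" "t \<le> 1" "1 \<le> n"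
  shows "(\<Sum>j=1..n. alpha n j s t) = t - s"
proof -
  have "(\<Sum>j=1..n. alpha n j s t) = (\<Sum>j=Suc 0..n. overlap s t (real j / real n) - overlap s t (real (j - 1) / real n))"
    using assms by (intro sum.cong) (auto simp: alpha_eq_overlap of_nat_diff)
  also have "\<dots> = overlap s t (real n / real n) - overlap s t (real 0 / real n)"
    by (rule sum_telescope'') (use assms in auto)
  finally show ?thesis using assms by (simp add: overlap_def)
qed

lemma sigma_sq_eq:
  assumes "0 \<le> s" "s < t" "t \<le> 1" "1 \<le> n"
  shows "sigma_sq n s t = (\<Sum>j=1..n. alpha n j s t * (1 - real n * alpha n j s t))"
  unfolding sigma_sq_def sum_alpha[OF assms, symmetric]
  by (simp add: algebra_simps power2_eq_square sum_subtractf sum_distrib_left)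

lemma sigma_sq_le: "1 \<le> n \<Longrightarrow> sigma_sq n s t \<le> t - s"
  by (simp add: sigma_sq_def sum_nonneg)

text \<open>In \<open>sigma_sq_eq\<close> only the summand of the cell containing \<open>t\<close>
  is kept. The remaining factors of the product are at most 1 and serve to make the bound
  independent of that cell. The estimate is crude, but its logarithm splits into ln(t-s) and the
  ln|t-k/n|, all with integrable singularities.\<close>

lemma sigma_sq_ge:
  assumes st: "0 \<le> s" "s < t" "t \<le> 1" and n: "1 \<le> n"
  shows "(t - s) * (\<Prod>k\<le>n. \<bar>t - real k / real n\<bar>) \<le> sigma_sq n s t"
proof -
  have nonneg: "0 \<le> alpha n j s t * (1 - real n * alpha n j s t)" for j
    using alpha_bounds[OF n, of j s t] n by (intro mult_nonneg_nonneg) (auto simp: field_simps)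
  \<comment> \<open>The cell containing \<open>t\<close> is the half-open interval from (i-1)/n,
    excluded, to i/n, included; since \<open>t\<close> is positive this gives
    \<open>1 \<le> i\<close>.\<close>
  define i where "i = nat \<lceil>t * real n\<rceil>"
  have i: "1 \<le> i" "i \<le> n" "(real i - 1) / real n < t" "t \<le> real i / real n"
  proof -
    have "0 < t * real n" "t * real n \<le> real n" using st n by auto
    then show "1 \<le> i" "i \<le> n" unfolding i_def by linarith+
    have "real i - 1 < t * real n" "t * real n \<le> real i" unfolding i_def using \<open>0 < t * real n\<close> by linarith+
    then show "(real i - 1) / real n < t" "t \<le> real i / real n" using n by (auto simp: field_simps)
  qed
  have le1: "\<bar>t - real k / real n\<bar> \<le> 1" if "k \<le> n" for k
  proof -
    have "0 \<le> real k / real n" "real k / real n \<le> 1" using that n by auto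
    then show ?thesis using st by linarith
  qed
  have "(\<Prod>k\<le>n. \<bar>t - real k / real n\<bar>) = (\<Prod>k\<in>{i-1,i}. \<bar>t - real k / real n\<bar>) * (\<Prod>k\<in>{..n}-{i-1,i}. \<bar>t - real k / real n\<bar>)"
    using i by (subst prod.subset_diff[of "{i-1,i}"]) (auto simp: mult.commute)
  also have "\<dots> \<le> (\<Prod>k\<in>{i-1,i}. \<bar>t - real k / real n\<bar>) * 1"
    using le1 by (intro mult_left_mono prod_le_1 prod_nonneg) auto
  also have "\<dots> = (t - (real i - 1) / real n) * (real i / real n - t)"
  proof -
    have "i - 1 \<noteq> i" using i by auto
    then show ?thesis using i by (simp add: of_nat_diff)
  qed
  finally have 1: "(\<Prod>k\<le>n. \<bar>t - real k / real n\<bar>) \<le> (t - (real i - 1) / real n) * (real i / real n - t)" .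
  \<comment> \<open>In this cell \<open>alpha\<close> is the smaller of the two factors on the left,
    and both lie in [0,1], so their product is below it.\<close>
  have 2: "(t - s) * (t - (real i - 1) / real n) \<le> alpha n i s t"
  proof -
    have "0 \<le> (real i - 1) / real n" using i n by simp
    then have b: "0 \<le> t - s" "t - s \<le> 1" "0 \<le> t - (real i - 1) / real n" "t - (real i - 1) / real n \<le> 1"
      using st i by linarith+
    have "(t - s) * (t - (real i - 1) / real n) \<le> min (t - s) (t - (real i - 1) / real n)"
      using mult_left_le[OF b(4,1)] mult_left_le_one_le[OF b(3) b(1) b(2)] by simp
    also have "\<dots> = alpha n i s t" using i st n by (simp add: alpha_eq_overlap overlap_def min_def)
    finally show ?thesis .
  qed
  have 3: "real i / real n - t \<le> 1 - real n * alpha n i s t"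
  proof -
    have "alpha n i s t \<le> t - (real i - 1) / real n"
      using i st n by (simp add: alpha_eq_overlap overlap_def min_def)
    then have "real n * alpha n i s t \<le> real n * (t - (real i - 1) / real n)"
      using n by (intro mult_left_mono) auto
    also have "\<dots> = 1 - real n * (real i / real n - t)" using n by (simp add: field_simps)
    finally have "real n * (real i / real n - t) \<le> 1 - real n * alpha n i s t" by simp
    moreover have "1 * (real i / real n - t) \<le> real n * (real i / real n - t)"
      using i n by (intro mult_right_mono) auto
    ultimately show ?thesis by simp
  qed
  have "(t - s) * (\<Prod>k\<le>n. \<bar>t - real k / real n\<bar>) \<le> ((t - s) * (t - (real i - 1) / real n)) * (real i / real n - t)"
    using 1 st by (simp add: mult_left_mono mult.assoc)
  also have "\<dots> \<le> alpha n i s t * (1 - real n * alpha n i s t)"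
    using 2 3 i alpha_bounds(1)[OF n] by (intro mult_mono) auto
  also have "\<dots> \<le> sigma_sq n s t"
    unfolding sigma_sq_eq[OF st n] using i nonneg by (intro member_le_sum) auto
  finally show ?thesis .
qed

text \<open>The Wirtinger inequality for the sequence of overlaps with [0, j/n]: its differences are
  the \<alpha>_j, and n times the sum of their squares is t - s - \<sigma>^2 by definition. Here the
  cosine constant of the theorem enters.\<close>

lemma sum_overlap_sq_le:
  assumes "0 \<le> s" "s < t" "t \<le> 1" "1 \<le> n"
  shows "2 * real n * (1 - cos (pi / (2 * real n + 1))) * (\<Sum>j=1..n. (overlap s t (real j / real n))\<^sup>2) \<le> t - s - sigma_sq n s t"
proof -
  let ?x = "\<lambda>j. overlap s t (real j / real n)"
  have "real n * (2 * (1 - cos (pi / (2 * real n + 1))) * (\<Sum>j=1..n. (?x j)\<^sup>2)) \<le> real n * (\<Sum>j=1..n. (?x j - ?x (j - 1))\<^sup>2)"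
    using assms by (intro mult_left_mono discrete_wirtinger) (auto simp: overlap_def)
  also have "(\<Sum>j=1..n. (?x j - ?x (j - 1))\<^sup>2) = (\<Sum>j=1..n. (alpha n j s t)\<^sup>2)"
    using assms by (intro sum.cong) (auto simp: alpha_eq_overlap of_nat_diff)
  finally show ?thesis by (simp add: sigma_sq_def mult_ac)
qed

section \<open>Gaussian product measures\<close>

text \<open>The image under the coordinatewise map and the measure with product density both agree
  with the product of the transformed factors on rectangles. The lemma is used with exponential
  densities for the Cameron--Martin formula and with density 1 for the invariance under
  reflections.\<close>

lemma nn_integral_PiM_transform:
  assumes I: "finite I" and prob: "\<And>i. prob_space (\<mu> i)"
    and T [measurable]: "\<And>i. T i \<in> measurable (\<mu> i) (\<mu> i)"
    and e [measurable]: "\<And>i. e i \<in> borel_measurable (\<mu> i)"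
    and eq: "\<And>i. i \<in> I \<Longrightarrow> distr (\<mu> i) (\<mu> i) (T i) = density (\<mu> i) (e i)"
    and G [measurable]: "G \<in> borel_measurable (PiM I \<mu>)"
  shows "(\<integral>\<^sup>+x. G (\<lambda>i\<in>I. T i (x i)) \<partial>PiM I \<mu>) = (\<integral>\<^sup>+x. (\<Prod>i\<in>I. e i (x i)) * G x \<partial>PiM I \<mu>)"
proof -
  interpret \<mu>: prob_space "\<mu> i" for i by (rule prob)
  interpret \<mu>: product_sigma_finite \<mu> ..
  define \<nu> where "\<nu> i = distr (\<mu> i) (\<mu> i) (T i)" for i
  interpret \<nu>: prob_space "\<nu> i" for i unfolding \<nu>_def by (rule \<mu>.prob_space_distr) simp
  interpret \<nu>: product_sigma_finite \<nu> ..
  have sets_\<nu>: "sets (\<nu> i) = sets (\<mu> i)" for i by (simp add: \<nu>_def)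
  have sets_PiM: "sets (PiM I \<nu>) = sets (PiM I \<mu>)" by (intro sets_PiM_cong) (auto simp: sets_\<nu>)
  have Tm [measurable]: "(\<lambda>x. \<lambda>i\<in>I. T i (x i)) \<in> measurable (PiM I \<mu>) (PiM I \<mu>)"
    by (intro measurable_restrict) simp
  have "distr (PiM I \<mu>) (PiM I \<mu>) (\<lambda>x. \<lambda>i\<in>I. T i (x i)) = PiM I \<nu>"
  proof (rule \<nu>.PiM_eqI[OF I])
    show "sets (distr (PiM I \<mu>) (PiM I \<mu>) (\<lambda>x. \<lambda>i\<in>I. T i (x i))) = sets (PiM I \<nu>)"
      by (simp add: sets_PiM)
    fix A assume A: "\<And>i. i \<in> I \<Longrightarrow> A i \<in> sets (\<nu> i)"
    then have A' [measurable]: "\<And>i. i \<in> I \<Longrightarrow> A i \<in> sets (\<mu> i)" by (simp add: sets_\<nu>)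
    have "emeasure (distr (PiM I \<mu>) (PiM I \<mu>) (\<lambda>x. \<lambda>i\<in>I. T i (x i))) (Pi\<^sub>E I A) =
      emeasure (PiM I \<mu>) (Pi\<^sub>E I (\<lambda>i. T i -` A i \<inter> space (\<mu> i)))"
      using I A' by (subst emeasure_distr)
        (auto intro!: arg_cong2[where f=emeasure] sets_PiM_I_finite simp: space_PiM PiE_iff)
    also have "\<dots> = (\<Prod>i\<in>I. emeasure (\<mu> i) (T i -` A i \<inter> space (\<mu> i)))"
      using I A' by (intro \<mu>.emeasure_PiM) auto
    also have "\<dots> = (\<Prod>i\<in>I. emeasure (\<nu> i) (A i))"
      using A' by (intro prod.cong) (auto simp: \<nu>_def emeasure_distr)
    finally show "emeasure (distr (PiM I \<mu>) (PiM I \<mu>) (\<lambda>x. \<lambda>i\<in>I. T i (x i))) (Pi\<^sub>E I A) = (\<Prod>i\<in>I. emeasure (\<nu> i) (A i))" .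
  qed
  moreover have "density (PiM I \<mu>) (\<lambda>x. \<Prod>i\<in>I. e i (x i)) = PiM I \<nu>"
  proof (rule \<nu>.PiM_eqI[OF I])
    show "sets (density (PiM I \<mu>) (\<lambda>x. \<Prod>i\<in>I. e i (x i))) = sets (PiM I \<nu>)" by (simp add: sets_PiM)
    fix A assume A: "\<And>i. i \<in> I \<Longrightarrow> A i \<in> sets (\<nu> i)"
    then have A' [measurable]: "\<And>i. i \<in> I \<Longrightarrow> A i \<in> sets (\<mu> i)" by (simp add: sets_\<nu>)
    have "emeasure (density (PiM I \<mu>) (\<lambda>x. \<Prod>i\<in>I. e i (x i))) (Pi\<^sub>E I A) =
      (\<integral>\<^sup>+x. (\<Prod>i\<in>I. e i (x i)) * indicator (Pi\<^sub>E I A) x \<partial>PiM I \<mu>)"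
      using I A' by (intro emeasure_density) (auto intro!: sets_PiM_I_finite)
    also have "\<dots> = (\<integral>\<^sup>+x. (\<Prod>i\<in>I. e i (x i) * indicator (A i) (x i)) \<partial>PiM I \<mu>)"
      using I by (intro nn_integral_cong)
        (auto simp: prod.distrib space_PiM PiE_iff indicator_def prod_zero_iff intro!: prod.neutral)
    also have "\<dots> = (\<Prod>i\<in>I. \<integral>\<^sup>+x. e i x * indicator (A i) x \<partial>\<mu> i)"
      using I by (intro \<mu>.product_nn_integral_prod) auto
    also have "\<dots> = (\<Prod>i\<in>I. emeasure (\<nu> i) (A i))"
      using A' by (intro prod.cong) (auto simp: \<nu>_def eq emeasure_density)
    finally show "emeasure (density (PiM I \<mu>) (\<lambda>x. \<Prod>i\<in>I. e i (x i))) (Pi\<^sub>E I A) = (\<Prod>i\<in>I. emeasure (\<nu> i) (A i))" .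
  qed
  ultimately have *: "distr (PiM I \<mu>) (PiM I \<mu>) (\<lambda>x. \<lambda>i\<in>I. T i (x i)) = density (PiM I \<mu>) (\<lambda>x. \<Prod>i\<in>I. e i (x i))"
    by simp
  have "(\<integral>\<^sup>+x. G (\<lambda>i\<in>I. T i (x i)) \<partial>PiM I \<mu>) = (\<integral>\<^sup>+x. G x \<partial>distr (PiM I \<mu>) (PiM I \<mu>) (\<lambda>x. \<lambda>i\<in>I. T i (x i)))"
    by (subst nn_integral_distr) auto
  also have "\<dots> = (\<integral>\<^sup>+x. (\<Prod>i\<in>I. e i (x i)) * G x \<partial>PiM I \<mu>)"
    unfolding * using I by (subst nn_integral_density) auto
  finally show ?thesis .
qed

section \<open>The law of one increment: translation and reflection\<close>

definition gauss :: "real \<Rightarrow> (real ^ 'd) measure" where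
  "gauss \<delta> = density lborel (\<lambda>z. ennreal (heat_kernel \<delta> z))"

lemma sets_gauss [simp, measurable_cong]: "sets (gauss \<delta>) = sets borel"
  and space_gauss [simp]: "space (gauss \<delta>) = UNIV" by (simp_all add: gauss_def)

lemma prob_space_gauss: "0 < \<delta> \<Longrightarrow> prob_space (gauss \<delta>)"
  by (rule prob_spaceI) (simp add: gauss_def emeasure_density nn_integral_heat_kernel)

lemma distr_gauss_translate:
  assumes "0 < \<delta>"
  shows "distr (gauss \<delta>) (gauss \<delta>) (\<lambda>z. z + \<delta> *\<^sub>R w) =
    density (gauss \<delta>) (\<lambda>z. ennreal (exp (w \<bullet> z - \<delta> * (norm w)\<^sup>2 / 2)))"
proof (rule measure_eqI)
  fix A assume "A \<in> sets (distr (gauss \<delta>) (gauss \<delta>) (\<lambda>z. z + \<delta> *\<^sub>R w))"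
  then have [measurable]: "A \<in> sets borel" by simp
  have "emeasure (distr (gauss \<delta>) (gauss \<delta>) (\<lambda>z. z + \<delta> *\<^sub>R w)) A = (\<integral>\<^sup>+z. indicator A (z + \<delta> *\<^sub>R w) \<partial>gauss \<delta>)"
    by (subst nn_integral_indicator[symmetric], simp, subst nn_integral_distr) auto
  also have "\<dots> = (\<integral>\<^sup>+z. ennreal (heat_kernel \<delta> ((z + \<delta> *\<^sub>R w) - \<delta> *\<^sub>R w)) * indicator A (z + \<delta> *\<^sub>R w) \<partial>lborel)"
    by (simp add: gauss_def nn_integral_density)
  also have "\<dots> = (\<integral>\<^sup>+z. ennreal (heat_kernel \<delta> (z - \<delta> *\<^sub>R w)) * indicator A z \<partial>lborel)"
    by (rule nn_integral_lborel_translate) simp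
  also have "\<dots> = emeasure (density (gauss \<delta>) (\<lambda>z. ennreal (exp (w \<bullet> z - \<delta> * (norm w)\<^sup>2 / 2)))) A"
    using assms by (simp add: emeasure_density gauss_def nn_integral_density heat_kernel_shift ennreal_mult' mult.assoc)
  finally show "emeasure (distr (gauss \<delta>) (gauss \<delta>) (\<lambda>z. z + \<delta> *\<^sub>R w)) A =
    emeasure (density (gauss \<delta>) (\<lambda>z. ennreal (exp (w \<bullet> z - \<delta> * (norm w)\<^sup>2 / 2)))) A" .
qed simp

definition reflect_coord :: "'d \<Rightarrow> real ^ 'd \<Rightarrow> real ^ 'd::finite" where
  "reflect_coord e z = (\<chi> i. if i = e then - (z $ i) else z $ i)"

lemma borel_measurable_reflect_coord [measurable]:
  fixes e :: "'d::finite"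
  shows "reflect_coord e \<in> borel_measurable borel" unfolding reflect_coord_def
proof (intro borel_measurable_continuous_onI continuous_on_vec_lambda)
  show "continuous_on UNIV (\<lambda>z::real ^ 'd. if i = e then - (z $ i) else z $ i)" for i
    by (cases "i = e") (auto intro!: continuous_intros)
qed

lemma distr_lborel_reflect_coord:
  fixes e :: "'d::finite"
  shows "distr lborel borel (reflect_coord e) = lborel"
proof -
  have *: "(\<lambda>x. 0 + (\<Sum>j\<in>Basis. ((if j = axis e 1 then -1 else 1) * (x \<bullet> j)) *\<^sub>R j)) = reflect_coord e"
  proof
    fix x :: "real ^ 'd"
    show "0 + (\<Sum>j\<in>Basis. ((if j = axis e 1 then -1 else 1) * (x \<bullet> j)) *\<^sub>R j) = reflect_coord e x"
    proof (rule euclidean_eqI)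
      fix b :: "real ^ 'd" assume b: "b \<in> Basis"
      then obtain i where i: "b = axis i 1" by (auto simp: Basis_vec_def)
      show "(0 + (\<Sum>j\<in>Basis. ((if j = axis e 1 then -1 else 1) * (x \<bullet> j)) *\<^sub>R j)) \<bullet> b = reflect_coord e x \<bullet> b"
        using b by (simp add: inner_sum_left_Basis) (auto simp: i axis_eq_axis reflect_coord_def inner_axis)
    qed
  qed
  moreover have "(\<Prod>j\<in>(Basis::(real^'d) set). \<bar>if j = axis e 1 then -1 else 1::real\<bar>) = 1"
    by (intro prod.neutral) auto
  ultimately show ?thesis
    using lborel_affine_euclidean[where c="\<lambda>j. if j = axis e (1::real) then -1 else 1" and t="0 :: real ^ 'd"]
    by (simp add: density_1)
qed

lemma norm_reflect_coord [simp]: "norm (reflect_coord e z) = norm z"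
  unfolding norm_vec_def reflect_coord_def by (intro arg_cong2[where f=L2_set]) auto

lemma distr_gauss_reflect_coord: "distr (gauss \<delta>) (gauss \<delta>) (reflect_coord e) = gauss \<delta>"
proof (rule measure_eqI)
  fix A assume "A \<in> sets (distr (gauss \<delta>) (gauss \<delta>) (reflect_coord e))"
  then have [measurable]: "A \<in> sets borel" by simp
  have "emeasure (distr (gauss \<delta>) (gauss \<delta>) (reflect_coord e)) A = (\<integral>\<^sup>+z. indicator A (reflect_coord e z) \<partial>gauss \<delta>)"
    by (subst nn_integral_indicator[symmetric], simp, subst nn_integral_distr) auto
  also have "\<dots> = (\<integral>\<^sup>+z. ennreal (heat_kernel \<delta> (reflect_coord e z)) * indicator A (reflect_coord e z) \<partial>lborel)"
    by (simp add: gauss_def nn_integral_density heat_kernel_def)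
  also have "\<dots> = (\<integral>\<^sup>+z. ennreal (heat_kernel \<delta> z) * indicator A z \<partial>distr lborel borel (reflect_coord e))"
    by (subst nn_integral_distr) auto
  also have "\<dots> = emeasure (gauss \<delta>) A"
    by (simp add: distr_lborel_reflect_coord emeasure_density gauss_def)
  finally show "emeasure (distr (gauss \<delta>) (gauss \<delta>) (reflect_coord e)) A = emeasure (gauss \<delta>) A" .
qed simp

lemma obtain_time_grid:
  assumes "finite T" "T \<subseteq> {0..1::real}" "0 \<in> T" "1 \<in> T"
  obtains \<tau> :: "nat \<Rightarrow> real" and N where "0 < N" "mono \<tau>" "range \<tau> \<subseteq> {0..1}" "\<tau> 0 = 0"
    "\<And>i. i < N \<Longrightarrow> \<tau> i < \<tau> (Suc i)" "T = \<tau> ` {..N}"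
proof
  define xs where "xs = sorted_list_of_set T"
  define N where "N = length xs - 1"
  \<comment> \<open>Freezing the sequence from \<open>N\<close> on makes it monotone with values in
    [0,1] on all naturals, as \<open>independent_increments\<close> demands; strict growth holds
    only below \<open>N\<close>.\<close>
  define \<tau> where "\<tau> i = xs ! min i N" for i
  have set: "set xs = T" and sorted: "sorted_wrt (<) xs" and dist: "distinct xs"
    using assms by (auto simp: xs_def)
  have len: "length xs = card T" by (simp add: xs_def)
  have "card {0, 1::real} \<le> card T" by (intro card_mono) (use assms in auto)
  then have len2: "length xs \<ge> 2" by (simp add: len)
  then show "0 < N" by (simp add: N_def)
  have lt: "min i N < length xs" for i using len2 by (auto simp: N_def)
  have le: "xs ! i \<le> xs ! j" if "i \<le> j" "j < length xs" for i j
    using sorted_wrt_nth_less[OF sorted, of i j] that by (cases "i = j") auto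
  show "mono \<tau>" unfolding \<tau>_def by (intro monoI le lt) auto
  show "range \<tau> \<subseteq> {0..1}" using assms(2) lt set by (auto simp: \<tau>_def subset_iff)
  show "\<tau> i < \<tau> (Suc i)" if "i < N" for i
    using that by (auto simp: \<tau>_def N_def intro!: sorted_wrt_nth_less[OF sorted])
  show T: "T = \<tau> ` {..N}"
  proof
    show "\<tau> ` {..N} \<subseteq> T" using nth_mem[OF lt] set by (auto simp only: \<tau>_def)
    show "T \<subseteq> \<tau> ` {..N}"
    proof
      fix t assume "t \<in> T"
      then obtain i where "i < length xs" "t = xs ! i" unfolding set[symmetric] by (auto simp: in_set_conv_nth)
      then show "t \<in> \<tau> ` {..N}" by (intro image_eqI[of _ _ i]) (auto simp: \<tau>_def N_def min_def)
    qed
  qed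
  obtain k where "k \<le> N" "\<tau> k = 0" using \<open>0 \<in> T\<close> T by auto
  moreover have "\<tau> 0 \<le> \<tau> k" using \<open>mono \<tau>\<close> by (auto dest: monoD)
  moreover have "0 \<le> \<tau> 0" using subsetD[OF \<open>range \<tau> \<subseteq> {0..1}\<close> rangeI[of \<tau> 0]] by auto
  ultimately show "\<tau> 0 = 0" by simp
qed

section \<open>Cameron--Martin formula and Brownian bridge\<close>

context brownian_motion begin

lemma increments_distr:
  assumes "0 < N" "mono \<tau>" "range \<tau> \<subseteq> {0..1}" "\<And>i. i < N \<Longrightarrow> \<tau> i < \<tau> (Suc i)"
    and \<delta>: "\<And>i. i < N \<Longrightarrow> \<delta> i = \<tau> (Suc i) - \<tau> i"
  shows "distr M (PiM {..<N} (\<lambda>i. gauss (\<delta> i))) (\<lambda>\<omega>. \<lambda>i\<in>{..<N}. W (\<tau> (Suc i)) \<omega> - W (\<tau> i) \<omega>) =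
    PiM {..<N} (\<lambda>i. gauss (\<delta> i))"
proof -
  have [measurable]: "W (\<tau> i) \<in> borel_measurable M" for i
    using subsetD[OF assms(3) rangeI] by (rule measurable)
  have "indep_vars (\<lambda>_. borel) (\<lambda>i \<omega>. W (\<tau> (Suc i)) \<omega> - W (\<tau> i) \<omega>) {..<N}"
    by (rule independent_increments) fact+
  then have "distr M (PiM {..<N} (\<lambda>_. borel)) (\<lambda>\<omega>. \<lambda>i\<in>{..<N}. W (\<tau> (Suc i)) \<omega> - W (\<tau> i) \<omega>) =
      PiM {..<N} (\<lambda>i. distr M borel (\<lambda>\<omega>. W (\<tau> (Suc i)) \<omega> - W (\<tau> i) \<omega>))"
    using assms(1) by (subst (asm) indep_vars_iff_distr_eq_PiM') auto
  also have "\<dots> = PiM {..<N} (\<lambda>i. gauss (\<delta> i))"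
  proof (rule PiM_cong)
    fix i assume i: "i \<in> {..<N}"
    have "distributed M lborel (\<lambda>\<omega>. W (\<tau> (Suc i)) \<omega> - W (\<tau> i) \<omega>) (\<lambda>z. ennreal (heat_kernel (\<delta> i) z))"
      using assms(4) subsetD[OF assms(3) rangeI[of \<tau> i]] subsetD[OF assms(3) rangeI[of \<tau> "Suc i"]] i
      by (subst \<delta>) (auto intro!: gaussian_increments)
    then show "distr M borel (\<lambda>\<omega>. W (\<tau> (Suc i)) \<omega> - W (\<tau> i) \<omega>) = gauss (\<delta> i)"
      unfolding gauss_def by (subst distributed_distr_eq_density[symmetric]) (auto intro: distr_cong)
  qed simp
  also have "distr M (PiM {..<N} (\<lambda>_. borel)) (\<lambda>\<omega>. \<lambda>i\<in>{..<N}. W (\<tau> (Suc i)) \<omega> - W (\<tau> i) \<omega>) =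
     distr M (PiM {..<N} (\<lambda>i. gauss (\<delta> i))) (\<lambda>\<omega>. \<lambda>i\<in>{..<N}. W (\<tau> (Suc i)) \<omega> - W (\<tau> i) \<omega>)"
    by (intro distr_cong sets_PiM_cong) auto
  finally show ?thesis .
qed

lemma W_grid_eq_sum:
  assumes "\<omega> \<in> space M" "\<tau> 0 = 0"
  shows "W (\<tau> k) \<omega> = (\<Sum>i<k. W (\<tau> (Suc i)) \<omega> - W (\<tau> i) \<omega>)"
  using sum_lessThan_telescope[of "\<lambda>i. W (\<tau> i) \<omega>" k] by (simp add: assms start)

text \<open>The path \<open>overlap s t\<close> is the Cameron--Martin direction dual to
  \<open>W t - W s\<close>, so the density depends on this increment alone. On a grid containing
  \<open>Q\<close>, the shift translates each increment inside [s,t] by its length times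
  \<open>w\<close> and leaves the others fixed; the claim is therefore a coordinatewise change of a
  product of Gaussian laws.\<close>

lemma cameron_martin:
  fixes Q :: "real set" and H :: "(real \<Rightarrow> real ^ 'd) \<Rightarrow> ennreal"
  assumes Q: "finite Q" "Q \<subseteq> {0..1}" and st: "s \<in> Q" "t \<in> Q" "s < t"
    and H [measurable]: "H \<in> borel_measurable (PiM Q (\<lambda>_. borel))"
  shows "(\<integral>\<^sup>+\<omega>. H (\<lambda>q\<in>Q. W q \<omega> + overlap s t q *\<^sub>R w) \<partial>M) =
    (\<integral>\<^sup>+\<omega>. ennreal (exp (w \<bullet> (W t \<omega> - W s \<omega>) - (t - s) * (norm w)\<^sup>2 / 2)) * H (\<lambda>q\<in>Q. W q \<omega>) \<partial>M)"
proof -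
  have "finite (insert 0 (insert 1 Q))" "insert 0 (insert 1 Q) \<subseteq> {0..1}"
    "0 \<in> insert 0 (insert 1 Q)" "1 \<in> insert 0 (insert 1 Q)" using Q by auto
  then obtain \<tau> N where N: "0 < N" and mono: "mono \<tau>" and range: "range \<tau> \<subseteq> {0..1}" and \<tau>0: "\<tau> 0 = 0"
    and strict: "\<And>i. i < N \<Longrightarrow> \<tau> i < \<tau> (Suc i)" and T: "insert 0 (insert 1 Q) = \<tau> ` {..N}"
    by (rule obtain_time_grid) blast
  have "\<exists>k\<le>N. q = \<tau> k" if "q \<in> Q" for q using that T by (metis atMost_iff imageE insertCI)
  then obtain \<kappa> where \<kappa>: "\<And>q. q \<in> Q \<Longrightarrow> \<kappa> q \<le> N" "\<And>q. q \<in> Q \<Longrightarrow> \<tau> (\<kappa> q) = q" by metis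
  \<comment> \<open>The value 1 beyond the grid is a filler:
    \<open>nn_integral_PiM_transform\<close> wants a probability measure at every index.\<close>
  define \<delta> where "\<delta> i = (if i < N then \<tau> (Suc i) - \<tau> i else 1)" for i
  have \<delta>pos: "0 < \<delta> i" for i using strict by (simp add: \<delta>_def)
  \<comment> \<open>The indices of the grid increments that add up to \<open>W t - W s\<close>; only
    these are translated.\<close>
  define J where "J = {\<kappa> s..<\<kappa> t}"
  have J: "J \<subseteq> {..<N}" using \<kappa>(1)[OF st(2)] by (auto simp: J_def)
  have le: "\<kappa> s \<le> \<kappa> t" using st \<kappa> monoD[OF mono, of "\<kappa> t" "\<kappa> s"] by (cases "\<kappa> s \<le> \<kappa> t") auto
  let ?D = "\<lambda>\<omega>. \<lambda>i\<in>{..<N}. W (\<tau> (Suc i)) \<omega> - W (\<tau> i) \<omega>"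
  let ?P = "PiM {..<N} (\<lambda>i. gauss (\<delta> i)) :: (nat \<Rightarrow> real ^ 'd) measure"
  have [measurable]: "W (\<tau> i) \<in> borel_measurable M" for i
    using subsetD[OF range rangeI] by (rule measurable)
  have D [measurable]: "?D \<in> measurable M ?P" by (intro measurable_restrict) (simp add: gauss_def)
  define T' where "T' i z = (if i \<in> J then z + \<delta> i *\<^sub>R w else z)" for i and z :: "real ^ 'd"
  define e where "e i z = (if i \<in> J then ennreal (exp (w \<bullet> z - \<delta> i * (norm w)\<^sup>2 / 2)) else 1)" for i and z :: "real ^ 'd"
  have overlap: "overlap s t (\<tau> k) = (\<Sum>i<k. if i \<in> J then \<delta> i else 0)" if "k \<le> N" for k using that
  proof (induction k)
    case 0
    then show ?case using st Q by (auto simp: overlap_def \<tau>0 min_def)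
  next
    case (Suc k)
    have "overlap s t (\<tau> (Suc k)) - overlap s t (\<tau> k) = (if k \<in> J then \<delta> k else 0)"
    proof -
      have \<tau>s: "\<tau> (\<kappa> s) = s" "\<tau> (\<kappa> t) = t" using \<kappa> st by auto
      consider "Suc k \<le> \<kappa> s" | "k \<in> J" | "\<kappa> t \<le> k" unfolding J_def atLeastLessThan_iff by linarith
      then show ?thesis
      proof cases
        case 1
        then have "\<tau> (Suc k) \<le> s" "\<tau> k \<le> s" "\<tau> (Suc k) \<le> t" "\<tau> k \<le> t" "k \<notin> J"
          using monoD[OF mono, of "Suc k" "\<kappa> s"] monoD[OF mono, of k "Suc k"] \<tau>s st by (auto simp: J_def)
        then show ?thesis by (auto simp: overlap_def min_def)
      next
        case 2
        then have "s \<le> \<tau> k" "\<tau> (Suc k) \<le> t" "\<tau> k < \<tau> (Suc k)"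
          using monoD[OF mono, of "Suc k" "\<kappa> t"] monoD[OF mono, of "\<kappa> s" k] \<tau>s st strict[of k] Suc.prems by (auto simp: J_def)
        then show ?thesis using 2 Suc.prems by (auto simp: overlap_def min_def \<delta>_def)
      next
        case 3
        then have "t \<le> \<tau> k" "\<tau> k \<le> \<tau> (Suc k)" "k \<notin> J"
          using monoD[OF mono, of "\<kappa> t" k] monoD[OF mono, of k "Suc k"] \<tau>s by (auto simp: J_def)
        then show ?thesis using st by (auto simp: overlap_def min_def)
      qed
    qed
    then show ?case using Suc by simp
  qed
  define G where "G x = H (\<lambda>q\<in>Q. \<Sum>i<\<kappa> q. x i)" for x :: "nat \<Rightarrow> real ^ 'd"
  have component [measurable]: "(\<lambda>x. x i) \<in> borel_measurable ?P" if "i < N" for i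
    using measurable_component_singleton[of i "{..<N}" "\<lambda>i. gauss (\<delta> i)"] that by (simp add: measurable_def)
  have G [measurable]: "G \<in> borel_measurable ?P" unfolding G_def
    by (intro measurable_compose[OF measurable_restrict H] borel_measurable_sum component)
       (auto dest!: \<kappa>(1))
  have W: "W q \<omega> = (\<Sum>i<\<kappa> q. ?D \<omega> i)" if "\<omega> \<in> space M" "q \<in> Q" for q \<omega>
  proof -
    have "W q \<omega> = W (\<tau> (\<kappa> q)) \<omega>" by (simp add: \<kappa> that)
    also have "\<dots> = (\<Sum>i<\<kappa> q. W (\<tau> (Suc i)) \<omega> - W (\<tau> i) \<omega>)" by (rule W_grid_eq_sum) (use that \<tau>0 in auto)
    also have "\<dots> = (\<Sum>i<\<kappa> q. ?D \<omega> i)" using \<kappa>(1)[of q] that by (intro sum.cong) auto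
    finally show ?thesis .
  qed
  have distr: "distr M ?P ?D = ?P"
    by (rule increments_distr) (use N mono range strict in \<open>auto simp: \<delta>_def\<close>)
  have "(\<integral>\<^sup>+\<omega>. H (\<lambda>q\<in>Q. W q \<omega> + overlap s t q *\<^sub>R w) \<partial>M) = (\<integral>\<^sup>+\<omega>. G (\<lambda>i\<in>{..<N}. T' i (?D \<omega> i)) \<partial>M)"
  proof (rule nn_integral_cong)
    fix \<omega> assume \<omega>: "\<omega> \<in> space M"
    have "W q \<omega> + overlap s t q *\<^sub>R w = (\<Sum>i<\<kappa> q. (\<lambda>i\<in>{..<N}. T' i (?D \<omega> i)) i)" if "q \<in> Q" for q
    proof -
      have "overlap s t q = overlap s t (\<tau> (\<kappa> q))" by (simp add: \<kappa> that)
      also have "\<dots> = (\<Sum>i<\<kappa> q. if i \<in> J then \<delta> i else 0)" by (rule overlap) (rule \<kappa>(1)[OF that])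
      finally have "W q \<omega> + overlap s t q *\<^sub>R w = (\<Sum>i<\<kappa> q. ?D \<omega> i + (if i \<in> J then \<delta> i else 0) *\<^sub>R w)"
        by (simp only: W[OF \<omega> that] sum.distrib scaleR_sum_left)
      also have "\<dots> = (\<Sum>i<\<kappa> q. (\<lambda>i\<in>{..<N}. T' i (?D \<omega> i)) i)"
        using \<kappa>(1)[OF that] by (intro sum.cong) (auto simp: T'_def)
      finally show ?thesis .
    qed
    then show "H (\<lambda>q\<in>Q. W q \<omega> + overlap s t q *\<^sub>R w) = G (\<lambda>i\<in>{..<N}. T' i (?D \<omega> i))"
      unfolding G_def by (intro arg_cong[where f=H] restrict_ext) 
  qed
  also have "\<dots> = (\<integral>\<^sup>+x. G (\<lambda>i\<in>{..<N}. T' i (x i)) \<partial>distr M ?P ?D)"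
  proof -
    have T': "(\<lambda>x. \<lambda>i\<in>{..<N}. T' i (x i)) \<in> measurable ?P ?P"
      unfolding T'_def by (intro measurable_restrict) (auto simp: gauss_def)
    show ?thesis
      by (rule nn_integral_distr[OF D, symmetric]) (use measurable_compose[OF T' G] in simp)
  qed
  also have "\<dots> = (\<integral>\<^sup>+x. (\<Prod>i<N. e i (x i)) * G x \<partial>?P)" unfolding distr
  proof (rule nn_integral_PiM_transform)
    show "distr (gauss (\<delta> i)) (gauss (\<delta> i)) (T' i) = density (gauss (\<delta> i)) (e i)" if "i \<in> {..<N}" for i
      using distr_gauss_translate[OF \<delta>pos, of i w] distr_id[of "gauss (\<delta> i) :: (real ^ 'd) measure"]
      unfolding T'_def[abs_def] e_def[abs_def] by (cases "i \<in> J") (auto simp: density_1)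
    show "T' i \<in> measurable (gauss (\<delta> i)) (gauss (\<delta> i))" for i
      unfolding T'_def[abs_def] by (cases "i \<in> J") (auto simp: gauss_def)
    show "e i \<in> borel_measurable (gauss (\<delta> i))" for i
      unfolding e_def[abs_def] by (cases "i \<in> J") (auto simp: gauss_def)
  qed (use prob_space_gauss \<delta>pos G in auto)
  also have "\<dots> = (\<integral>\<^sup>+x. (\<Prod>i<N. e i (x i)) * G x \<partial>distr M ?P ?D)" by (simp only: distr)
  also have "\<dots> = (\<integral>\<^sup>+\<omega>. (\<Prod>i<N. e i (?D \<omega> i)) * G (?D \<omega>) \<partial>M)"
  proof (rule nn_integral_distr[OF D])
    have [measurable]: "e i \<in> borel_measurable borel" for i
      unfolding e_def[abs_def] by (cases "i \<in> J") auto
    show "(\<lambda>x. (\<Prod>i<N. e i (x i)) * G x) \<in> borel_measurable (distr M ?P ?D)"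
      unfolding distr by measurable
  qed
  also have "\<dots> = (\<integral>\<^sup>+\<omega>. ennreal (exp (w \<bullet> (W t \<omega> - W s \<omega>) - (t - s) * (norm w)\<^sup>2 / 2)) * H (\<lambda>q\<in>Q. W q \<omega>) \<partial>M)"
  proof (rule nn_integral_cong, rule arg_cong2[where f="(*)"])
    fix \<omega> assume \<omega>: "\<omega> \<in> space M"
    show "G (?D \<omega>) = H (\<lambda>q\<in>Q. W q \<omega>)"
      unfolding G_def by (intro arg_cong[where f=H] restrict_ext) (simp add: W \<omega>)
    have "W t \<omega> - W s \<omega> = (\<Sum>i\<in>J. ?D \<omega> i)"
      unfolding W[OF \<omega> st(1)] W[OF \<omega> st(2)] J_def lessThan_atLeast0
      by (subst sum_diff_nat_ivl[of 0 "\<kappa> s" "\<kappa> t"]) (use le in auto)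
    moreover have "t - s = (\<Sum>i\<in>J. \<delta> i)"
    proof -
      have "(\<Sum>i\<in>J. \<delta> i) = (\<Sum>i\<in>J. \<tau> (Suc i) - \<tau> i)" using J by (intro sum.cong) (auto simp: \<delta>_def)
      also have "\<dots> = \<tau> (\<kappa> t) - \<tau> (\<kappa> s)" unfolding J_def using le by (rule sum_Suc_diff')
      finally show ?thesis using \<kappa> st by simp
    qed
    ultimately have "w \<bullet> (W t \<omega> - W s \<omega>) - (t - s) * (norm w)\<^sup>2 / 2 = (\<Sum>i\<in>J. w \<bullet> ?D \<omega> i - \<delta> i * (norm w)\<^sup>2 / 2)"
      by (simp only: inner_sum_right sum_subtractf sum_distrib_right sum_divide_distrib)
    then have "ennreal (exp (w \<bullet> (W t \<omega> - W s \<omega>) - (t - s) * (norm w)\<^sup>2 / 2)) =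
      (\<Prod>i\<in>J. ennreal (exp (w \<bullet> ?D \<omega> i - \<delta> i * (norm w)\<^sup>2 / 2)))"
      by (simp only: exp_sum finite_atLeastLessThan J_def prod_ennreal exp_ge_zero)
    also have "\<dots> = (\<Prod>i\<in>J. e i (?D \<omega> i))" by (intro prod.cong) (auto simp: e_def)
    also have "\<dots> = (\<Prod>i<N. e i (?D \<omega> i))" using J by (intro prod.mono_neutral_left) (auto simp: e_def)
    finally show "(\<Prod>i<N. e i (?D \<omega> i)) = ennreal (exp (w \<bullet> (W t \<omega> - W s \<omega>) - (t - s) * (norm w)\<^sup>2 / 2))" ..
  qed
  finally show ?thesis .
qed

text \<open>The Brownian bridge property. Multiplying the Cameron--Martin formula by the density of
  \<open>W t - W s\<close> turns its exponential factor into a translate of that density, which integrates to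
  \<open>1\<close> over all shifts.\<close>

lemma nn_integral_bridge:
  fixes Q :: "real set" and H :: "(real \<Rightarrow> real ^ 'd) \<Rightarrow> ennreal"
  assumes Q: "finite Q" "Q \<subseteq> {0..1}" and st: "s \<in> Q" "t \<in> Q" "s < t"
    and H [measurable]: "H \<in> borel_measurable (PiM Q (\<lambda>_. borel))"
  shows "(\<integral>\<^sup>+\<omega>. H (\<lambda>q\<in>Q. W q \<omega>) \<partial>M) =
    (\<integral>\<^sup>+\<omega>. \<integral>\<^sup>+y. ennreal (heat_kernel (t - s) y) *
      H (\<lambda>q\<in>Q. W q \<omega> + (overlap s t q / (t - s)) *\<^sub>R (y - (W t \<omega> - W s \<omega>))) \<partial>lborel \<partial>M)"
proof -
  let ?V = "\<lambda>\<omega>. W t \<omega> - W s \<omega>"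
  let ?S = "\<lambda>z \<omega>. \<lambda>q\<in>Q. W q \<omega> + (overlap s t q / (t - s)) *\<^sub>R z"
  have Wm [measurable]: "W q \<in> borel_measurable M" if "q \<in> Q" for q
    using that Q by (intro measurable) auto
  have [measurable]: "?V \<in> borel_measurable M" using st by measurable
  have [measurable]: "(\<lambda>x. x q) \<in> borel_measurable (PiM Q (\<lambda>_. borel))" if "q \<in> Q" for q :: real
    using that by (rule measurable_component_singleton)
  have Hm: "(\<lambda>(\<omega>, k). H (?S (f \<omega> k) \<omega>)) \<in> borel_measurable (M \<Otimes>\<^sub>M lborel)"
    if [measurable]: "(\<lambda>(\<omega>, k). f \<omega> k) \<in> borel_measurable (M \<Otimes>\<^sub>M lborel)" for f :: "_ \<Rightarrow> real ^ 'd \<Rightarrow> real ^ 'd"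
  proof -
    have "(\<lambda>x. \<lambda>q\<in>Q. W q (fst x) + (overlap s t q / (t - s)) *\<^sub>R (f (fst x) (snd x))) \<in> measurable (M \<Otimes>\<^sub>M lborel) (PiM Q (\<lambda>_. borel))"
      using that by (intro measurable_restrict) (auto simp: case_prod_beta')
    from measurable_compose[OF this H] show ?thesis by (simp add: case_prod_beta')
  qed
  let ?h = "\<lambda>\<omega> k. H (\<lambda>q\<in>Q. W q \<omega>) * ennreal (heat_kernel (t - s) (?V \<omega> - k))"
  have overlap: "overlap s t t = t - s" "overlap s t s = 0" using st by (auto simp: overlap_def)
  have "(\<integral>\<^sup>+\<omega>. H (\<lambda>q\<in>Q. W q \<omega>) \<partial>M) =
    (\<integral>\<^sup>+\<omega>. \<integral>\<^sup>+k. ?h \<omega> k \<partial>lborel \<partial>M)"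
    using st by (simp add: nn_integral_cmult nn_integral_lborel_reflect[of "\<lambda>z. ennreal (heat_kernel (t - s) z)"] nn_integral_heat_kernel)
  also have "\<dots> = (\<integral>\<^sup>+k. \<integral>\<^sup>+\<omega>. ?h \<omega> k \<partial>M \<partial>lborel)"
  proof -
    interpret pair_sigma_finite M "lborel :: (real ^ 'd) measure" ..
    have "(\<lambda>(\<omega>, k::real ^ 'd). H (\<lambda>q\<in>Q. W q \<omega>)) \<in> borel_measurable (M \<Otimes>\<^sub>M lborel)"
      using Hm[of "\<lambda>_ _. 0"] by simp
    then have "(\<lambda>(\<omega>, k::real ^ 'd). ?h \<omega> k) \<in> borel_measurable (M \<Otimes>\<^sub>M lborel)"
      unfolding case_prod_beta' by measurable
    then show ?thesis by (rule Fubini'[symmetric])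
  qed
  also have "\<dots> = (\<integral>\<^sup>+k. \<integral>\<^sup>+\<omega>. ennreal (heat_kernel (t - s) (?V \<omega> + k)) *
      H (?S k \<omega>) \<partial>M \<partial>lborel)"
  proof (rule nn_integral_cong)
    fix k :: "real ^ 'd"
    define w where "w = k /\<^sub>R (t - s)"
    have k: "k = (t - s) *\<^sub>R w" using st by (simp add: w_def)
    \<comment> \<open>Since \<open>s\<close> and \<open>t\<close> lie in \<open>Q\<close>, the
      density of the increment can be made part of the functional. On the unshifted side it merges
      with the exponential into the density at \<open>?V \<omega> - k\<close>; on the shifted side
      it becomes the density at \<open>?V \<omega> + k\<close>.\<close>
    let ?H = "\<lambda>x. ennreal (heat_kernel (t - s) (x t - x s)) * H x"
    have "(\<integral>\<^sup>+\<omega>. ?H (\<lambda>q\<in>Q. W q \<omega> + overlap s t q *\<^sub>R w) \<partial>M) =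
      (\<integral>\<^sup>+\<omega>. ennreal (exp (w \<bullet> ?V \<omega> - (t - s) * (norm w)\<^sup>2 / 2)) * ?H (\<lambda>q\<in>Q. W q \<omega>) \<partial>M)"
      by (rule cameron_martin[OF Q st]) (use st in measurable)
    also have "(\<lambda>\<omega>. ?H (\<lambda>q\<in>Q. W q \<omega> + overlap s t q *\<^sub>R w)) = (\<lambda>\<omega>. ennreal (heat_kernel (t - s) (?V \<omega> + k)) *
      H (?S k \<omega>))"
    proof -
      have "W t \<omega> + overlap s t t *\<^sub>R w - (W s \<omega> + overlap s t s *\<^sub>R w) = ?V \<omega> + k" for \<omega>
        by (simp add: overlap k)
      moreover have "overlap s t q *\<^sub>R w = (overlap s t q / (t - s)) *\<^sub>R k" for q
        using st by (simp add: w_def divide_inverse)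
      ultimately show ?thesis using st by (simp only: restrict_apply if_True)
    qed
    also have "(\<lambda>\<omega>. ennreal (exp (w \<bullet> ?V \<omega> - (t - s) * (norm w)\<^sup>2 / 2)) * ?H (\<lambda>q\<in>Q. W q \<omega>)) =
       (\<lambda>\<omega>. ?h \<omega> k)" using st by (simp add: k heat_kernel_shift ennreal_mult' mult_ac)
    finally show "(\<integral>\<^sup>+\<omega>. ?h \<omega> k \<partial>M) =
      (\<integral>\<^sup>+\<omega>. ennreal (heat_kernel (t - s) (?V \<omega> + k)) * H (?S k \<omega>) \<partial>M)" ..
  qed
  also have "\<dots> = (\<integral>\<^sup>+\<omega>. \<integral>\<^sup>+k. ennreal (heat_kernel (t - s) (?V \<omega> + k)) *
      H (?S k \<omega>) \<partial>lborel \<partial>M)"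
  proof -
    interpret pair_sigma_finite M "lborel :: (real ^ 'd) measure" ..
    have "(\<lambda>(\<omega>, k). H (?S k \<omega>)) \<in> borel_measurable (M \<Otimes>\<^sub>M lborel)" by (rule Hm) simp
    then have "(\<lambda>(\<omega>, k). ennreal (heat_kernel (t - s) (?V \<omega> + k)) *
      H (?S k \<omega>)) \<in> borel_measurable (M \<Otimes>\<^sub>M lborel)" unfolding case_prod_beta' by measurable
    then show ?thesis by (rule Fubini')
  qed
  also have "\<dots> = (\<integral>\<^sup>+\<omega>. \<integral>\<^sup>+y. ennreal (heat_kernel (t - s) y) *
      H (?S (y - ?V \<omega>) \<omega>) \<partial>lborel \<partial>M)"
  proof (rule nn_integral_cong)
    fix \<omega> assume \<omega>: "\<omega> \<in> space M"
    let ?g = "\<lambda>y. ennreal (heat_kernel (t - s) y) * H (?S (y - ?V \<omega>) \<omega>)"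
    have "(\<lambda>y. \<lambda>q\<in>Q. W q \<omega> + (overlap s t q / (t - s)) *\<^sub>R (y - ?V \<omega>)) \<in> measurable borel (PiM Q (\<lambda>_. borel))"
      by (intro measurable_restrict) simp
    from measurable_compose[OF this H] have "?g \<in> borel_measurable borel" by simp
    from nn_integral_lborel_translate[OF this, of "?V \<omega>"]
    show "(\<integral>\<^sup>+k. ennreal (heat_kernel (t - s) (?V \<omega> + k)) * H (?S k \<omega>) \<partial>lborel) =
      (\<integral>\<^sup>+y. ?g y \<partial>lborel)" by (simp add: add.commute)
  qed
  finally show ?thesis .
qed

end

section \<open>Orthogonality of the Wiener chaoses\<close>

lemma square_integrable_mult:
  assumes "square_integrable M X" "square_integrable M Y"
  shows "integrable M (\<lambda>x. X x * Y x)"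
proof (rule Bochner_Integration.integrable_bound)
  show "integrable M (\<lambda>x. (X x)\<^sup>2 + (Y x)\<^sup>2)" using assms by (auto simp: square_integrable_def)
  show "(\<lambda>x. X x * Y x) \<in> borel_measurable M" using assms by (auto simp: square_integrable_def)
  have "\<bar>a * b\<bar> \<le> a\<^sup>2 + b\<^sup>2" for a b :: real
  proof -
    have "2 * \<bar>a\<bar> * \<bar>b\<bar> \<le> a\<^sup>2 + b\<^sup>2" using sum_squares_bound[of "\<bar>a\<bar>" "\<bar>b\<bar>"] by simp
    moreover have "0 \<le> \<bar>a\<bar> * \<bar>b\<bar>" by simp
    ultimately show ?thesis unfolding abs_mult by linarith
  qed
  then show "AE x in M. norm (X x * Y x) \<le> norm ((X x)\<^sup>2 + (Y x)\<^sup>2)" by simp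
qed

lemma square_integrable_add:
  assumes "square_integrable M X" "square_integrable M Y"
  shows "square_integrable M (\<lambda>x. X x + Y x)"
proof -
  have "(\<lambda>x. (X x + Y x)\<^sup>2) = (\<lambda>x. (X x)\<^sup>2 + (Y x)\<^sup>2 + 2 * (X x * Y x))"
    by (simp add: power2_sum mult.assoc)
  then show ?thesis
    using assms square_integrable_mult[OF assms] by (auto simp: square_integrable_def)
qed

lemma square_integrable_cmult:
  "square_integrable M X \<Longrightarrow> square_integrable M (\<lambda>x. c * X x)"
  by (auto simp: square_integrable_def power_mult_distrib)

lemma square_integrable_diff:
  assumes "square_integrable M X" "square_integrable M Y"
  shows "square_integrable M (\<lambda>x. X x - Y x)"
  using square_integrable_add[OF assms(1) square_integrable_cmult[OF assms(2), of "-1"]] by simp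

lemma square_integrable_zero: "square_integrable M (\<lambda>_. 0)"
  by (simp add: square_integrable_def)

lemma cauchy_schwarz_integral:
  assumes X: "square_integrable M X" and Y: "square_integrable M Y"
  shows "\<bar>\<integral>x. X x * Y x \<partial>M\<bar> \<le> sqrt (\<integral>x. (X x)\<^sup>2 \<partial>M) * sqrt (\<integral>x. (Y x)\<^sup>2 \<partial>M)"
proof -
  have [measurable]: "X \<in> borel_measurable M" "Y \<in> borel_measurable M"
    using assms by (auto simp: square_integrable_def)
  note int = square_integrable_mult[OF X Y]
  let ?I = "\<integral>x. \<bar>X x * Y x\<bar> \<partial>M"
  have "ennreal (?I\<^sup>2) = (\<integral>\<^sup>+x. ennreal \<bar>X x\<bar> * ennreal \<bar>Y x\<bar> \<partial>M)\<^sup>2"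
    using nn_integral_eq_integral[OF integrable_abs[OF int]]
    by (simp add: abs_mult flip: ennreal_mult ennreal_power)
  also have "\<dots> \<le> (\<integral>\<^sup>+x. (ennreal \<bar>X x\<bar>)\<^sup>2 \<partial>M) * (\<integral>\<^sup>+x. (ennreal \<bar>Y x\<bar>)\<^sup>2 \<partial>M)"
    by (rule Cauchy_Schwarz_nn_integral) measurable
  also have "\<dots> = ennreal ((\<integral>x. (X x)\<^sup>2 \<partial>M) * (\<integral>x. (Y x)\<^sup>2 \<partial>M))"
    using X Y by (simp add: square_integrable_def nn_integral_eq_integral ennreal_power ennreal_mult)
  finally have "?I\<^sup>2 \<le> (\<integral>x. (X x)\<^sup>2 \<partial>M) * (\<integral>x. (Y x)\<^sup>2 \<partial>M)" by (subst (asm) ennreal_le_iff) auto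
  then have "?I \<le> sqrt (\<integral>x. (X x)\<^sup>2 \<partial>M) * sqrt (\<integral>x. (Y x)\<^sup>2 \<partial>M)"
    by (simp flip: real_sqrt_mult add: real_le_rsqrt)
  moreover have "\<bar>\<integral>x. X x * Y x \<partial>M\<bar> \<le> ?I" by (rule integral_abs_bound)
  ultimately show ?thesis by linarith
qed

lemma L2_tendsto_inner:
  assumes X: "L2_tendsto M Xs X" and Y: "L2_tendsto M Ys Y"
  shows "(\<lambda>m. \<integral>x. Xs m x * Ys m x \<partial>M) \<longlonglongrightarrow> (\<integral>x. X x * Y x \<partial>M)"
proof -
  have sq: "square_integrable M (Xs m)" "square_integrable M X" "square_integrable M (Ys m)" "square_integrable M Y" for m
    using assms by (auto simp: L2_tendsto_def)
  note dX = square_integrable_diff[OF sq(1,2)] and dY = square_integrable_diff[OF sq(3,4)]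
  let ?a = "\<lambda>m. sqrt (\<integral>x. (Xs m x - X x)\<^sup>2 \<partial>M)" and ?b = "\<lambda>m. sqrt (\<integral>x. (Ys m x - Y x)\<^sup>2 \<partial>M)"
  let ?A = "sqrt (\<integral>x. (X x)\<^sup>2 \<partial>M)" and ?B = "sqrt (\<integral>x. (Y x)\<^sup>2 \<partial>M)"
  have a: "?a \<longlonglongrightarrow> 0" and b: "?b \<longlonglongrightarrow> 0"
    using assms tendsto_real_sqrt[of _ 0] by (auto simp: L2_tendsto_def)
  have "(\<lambda>m. ?a m * ?b m + ?a m * ?B + ?A * ?b m) \<longlonglongrightarrow> 0 * 0 + 0 * ?B + ?A * 0"
    by (intro tendsto_intros a b)
  then have lim: "(\<lambda>m. ?a m * ?b m + ?a m * ?B + ?A * ?b m) \<longlonglongrightarrow> 0" by simp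
  have "norm ((\<integral>x. Xs m x * Ys m x \<partial>M) - (\<integral>x. X x * Y x \<partial>M)) \<le> ?a m * ?b m + ?a m * ?B + ?A * ?b m" for m
  proof -
    note ints = square_integrable_mult[OF dX[of m] dY[of m]] square_integrable_mult[OF dX[of m] sq(4)]
      square_integrable_mult[OF sq(2) dY[of m]] square_integrable_mult[OF sq(1)[of m] sq(3)[of m]]
      square_integrable_mult[OF sq(2,4)]
    have "(\<integral>x. Xs m x * Ys m x \<partial>M) - (\<integral>x. X x * Y x \<partial>M) =
      (\<integral>x. ((Xs m x - X x) * (Ys m x - Y x) + (Xs m x - X x) * Y x) + X x * (Ys m x - Y x) \<partial>M)"
      using ints by (subst Bochner_Integration.integral_diff[symmetric]) (auto simp: algebra_simps)
    also have "\<dots> = (\<integral>x. (Xs m x - X x) * (Ys m x - Y x) \<partial>M) + (\<integral>x. (Xs m x - X x) * Y x \<partial>M) + (\<integral>x. X x * (Ys m x - Y x) \<partial>M)"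
      by (simp only: Bochner_Integration.integral_add Bochner_Integration.integrable_add ints)
    finally show ?thesis
      using cauchy_schwarz_integral[OF dX[of m] dY[of m]] cauchy_schwarz_integral[OF dX[of m] sq(4)]
        cauchy_schwarz_integral[OF sq(2) dY[of m]] by simp
  qed
  then have "(\<lambda>m. (\<integral>x. Xs m x * Ys m x \<partial>M) - (\<integral>x. X x * Y x \<partial>M)) \<longlonglongrightarrow> 0"
    by (intro Lim_null_comparison[OF _ lim]) auto
  then show ?thesis by (simp add: LIM_zero_iff)
qed

text \<open>The factor of largest modulus dominates the product. Integrability of products of
  increments thus follows from moments of single increments, with no use of independence; the even
  exponent makes the right-hand side free of absolute values.\<close>

lemma abs_prod_le_sum_even_powers:
  fixes x :: "'i \<Rightarrow> real"
  assumes "finite I"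
  shows "\<bar>\<Prod>i\<in>I. x i\<bar> \<le> 1 + (\<Sum>i\<in>I. x i ^ (2 * card I))"
proof (cases "\<forall>i\<in>I. \<bar>x i\<bar> \<le> 1")
  case True
  then have "\<bar>\<Prod>i\<in>I. x i\<bar> \<le> 1" unfolding abs_prod by (intro prod_le_1) auto
  moreover have "0 \<le> (\<Sum>i\<in>I. x i ^ (2 * card I))" by (intro sum_nonneg) (simp add: power_mult)
  ultimately show ?thesis by simp
next
  case False
  then have "I \<noteq> {}" by auto
  then have "Max ((\<lambda>i. \<bar>x i\<bar>) ` I) \<in> (\<lambda>i. \<bar>x i\<bar>) ` I" using assms by (intro Max_in) auto
  then obtain j where j: "j \<in> I" "Max ((\<lambda>i. \<bar>x i\<bar>) ` I) = \<bar>x j\<bar>" by auto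
  have max: "\<bar>x i\<bar> \<le> \<bar>x j\<bar>" if "i \<in> I" for i
    using that assms unfolding j(2)[symmetric] by (intro Max_ge) auto
  have j1: "1 \<le> \<bar>x j\<bar>" using False max by force
  have "\<bar>\<Prod>i\<in>I. x i\<bar> \<le> (\<Prod>i\<in>I. \<bar>x j\<bar>)" unfolding abs_prod by (intro prod_mono) (auto simp: max)
  also have "\<dots> \<le> \<bar>x j\<bar> ^ (2 * card I)" using j1 by (simp add: power_increasing)
  also have "\<dots> = x j ^ (2 * card I)" by (simp add: power_mult)
  also have "\<dots> \<le> (\<Sum>i\<in>I. x i ^ (2 * card I))"
    using assms j by (intro member_le_sum) (auto simp: power_mult)
  finally show ?thesis by simp
qed

section \<open>Products of increments over boxes and their orthogonality\<close>

context brownian_motion begin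

lemma integrable_increment_even_power:
  assumes "0 \<le> a" "a \<le> b" "b \<le> 1"
  shows "integrable M (\<lambda>\<omega>. ((W b \<omega> - W a \<omega>) $ e) ^ (2 * m))"
proof (cases "a = b")
  case False
  let ?f = "\<lambda>z::real^'d. z $ e"
  have [measurable]: "W a \<in> borel_measurable M" "W b \<in> borel_measurable M"
    using assms by (auto intro: measurable)
  have comp [measurable]: "?f \<in> borel_measurable borel"
    by (intro borel_measurable_continuous_onI continuous_intros)
  have dist: "distributed M lborel (\<lambda>\<omega>. W b \<omega> - W a \<omega>) (\<lambda>z. ennreal (heat_kernel (b - a) z))"
    using assms False by (intro gaussian_increments) auto
  have "(\<integral>\<^sup>+\<omega>. ennreal (((W b \<omega> - W a \<omega>) $ e) ^ (2 * m)) \<partial>M) =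
    (\<integral>\<^sup>+z. ennreal (heat_kernel (b - a) z) * ennreal ((z $ e) ^ (2 * m)) \<partial>lborel)"
    by (rule distributed_nn_integral[OF dist, symmetric]) measurable
  also have "\<dots> = (\<integral>\<^sup>+z. ennreal (heat_kernel (b - a) (z::real^'d) * (z \<bullet> axis e 1) ^ (2 * m)) \<partial>lborel)"
    by (simp add: inner_axis ennreal_mult' power_mult)
  also have "\<dots> = (\<integral>\<^sup>+x. ennreal (normal_density 0 (sqrt (b - a)) x * x ^ (2 * m)) \<partial>lborel)"
    using assms False by (intro nn_integral_heat_kernel_coordinate_power) (auto simp: axis_in_Basis_iff)
  also have "\<dots> < \<infinity>" using integrable_normal_moment[of "sqrt (b - a)" 0 "2 * m"] assms False
    by (subst nn_integral_eq_integral) (auto simp: power_mult)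
  finally show ?thesis by (intro integrableI_nonneg) (auto simp: power_mult)
qed (simp add: zero_power)

lemma square_integrable_box:
  fixes k :: nat
  assumes "\<And>i. i < k \<Longrightarrow> 0 \<le> a i \<and> a i \<le> b i \<and> b i \<le> 1"
  shows "square_integrable M (\<lambda>\<omega>. \<Prod>i<k. (W (b i) \<omega> - W (a i) \<omega>) $ e i)"
proof -
  let ?z = "\<lambda>\<omega> i. (W (b i) \<omega> - W (a i) \<omega>) $ e i"
  have comp [measurable]: "(\<lambda>z. z $ i) \<in> borel_measurable borel" for i :: 'd
    by (intro borel_measurable_continuous_onI continuous_intros)
  have [measurable]: "(\<lambda>\<omega>. (W (b i) \<omega> - W (a i) \<omega>) $ e i) \<in> borel_measurable M" if "i < k" for i
  proof -
    have [measurable]: "W (a i) \<in> borel_measurable M" "W (b i) \<in> borel_measurable M"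
      using assms[OF that] by (auto intro: measurable)
    show ?thesis by measurable
  qed
  have "integrable M (\<lambda>\<omega>. (\<Prod>i<k. ?z \<omega> i)\<^sup>2)"
  proof (rule Bochner_Integration.integrable_bound)
    show "integrable M (\<lambda>\<omega>. 1 + (\<Sum>i<k. (?z \<omega> i) ^ (2 * (2 * k))))"
      using assms by (intro Bochner_Integration.integrable_add integrable_const
          Bochner_Integration.integrable_sum integrable_increment_even_power) auto
    show "AE \<omega> in M. norm ((\<Prod>i<k. ?z \<omega> i)\<^sup>2) \<le> norm (1 + (\<Sum>i<k. (?z \<omega> i) ^ (2 * (2 * k))))"
    proof (rule AE_I2)
      fix \<omega>
      let ?x = "\<lambda>i. (?z \<omega> i)\<^sup>2"
      have "\<bar>\<Prod>i<k. ?x i\<bar> \<le> 1 + (\<Sum>i<k. ?x i ^ (2 * k))"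
        using abs_prod_le_sum_even_powers[of "{..<k}" ?x] by simp
      then show "norm ((\<Prod>i<k. ?z \<omega> i)\<^sup>2) \<le> norm (1 + (\<Sum>i<k. (?z \<omega> i) ^ (2 * (2 * k))))"
        by (simp add: prod_power_distrib power_mult)
    qed
  qed measurable
  moreover have "(\<lambda>\<omega>. \<Prod>i<k. ?z \<omega> i) \<in> borel_measurable M" by measurable
  ultimately show ?thesis unfolding square_integrable_def by blast
qed

lemma elementary_ito_square_integrable:
  "elementary_ito W k f X \<Longrightarrow> square_integrable M X"
proof (induction rule: elementary_ito.induct)
  case (add_box f X a b e c)
  show ?case
    by (intro square_integrable_add square_integrable_cmult add_box.IH square_integrable_box add_box.hyps)
qed (rule square_integrable_zero)

text \<open>The product Gaussian law is invariant under the sign change of component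
  \<open>e\<close> of increment \<open>c\<close>, so the integral equals its own negative. No
  integrability of \<open>g\<close> is involved.\<close>

lemma integral_increments_odd:
  assumes "0 < N" "mono \<tau>" "range \<tau> \<subseteq> {0..1}" "\<And>i. i < N \<Longrightarrow> \<tau> i < \<tau> (Suc i)"
    and c: "c < N" and g [measurable]: "g \<in> borel_measurable (PiM {..<N} (\<lambda>_. borel :: (real ^ 'd) measure))"
    and odd: "\<And>x. g (\<lambda>i\<in>{..<N}. if i = c then reflect_coord e (x i) else x i) = - g x"
  shows "(\<integral>\<omega>. g (\<lambda>i\<in>{..<N}. W (\<tau> (Suc i)) \<omega> - W (\<tau> i) \<omega>) \<partial>M) = (0::real)"
proof -
  define \<delta> where "\<delta> i = (if i < N then \<tau> (Suc i) - \<tau> i else 1)" for i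
  have \<delta>pos: "0 < \<delta> i" for i using assms(4) by (simp add: \<delta>_def)
  let ?D = "\<lambda>\<omega>. \<lambda>i\<in>{..<N}. W (\<tau> (Suc i)) \<omega> - W (\<tau> i) \<omega>"
  let ?P = "PiM {..<N} (\<lambda>i. gauss (\<delta> i)) :: (nat \<Rightarrow> real ^ 'd) measure"
  let ?\<Phi> = "\<lambda>x. \<lambda>i\<in>{..<N}. if i = c then reflect_coord e (x i) else x i"
  have [measurable]: "W (\<tau> i) \<in> borel_measurable M" for i
    using subsetD[OF assms(3) rangeI] by (rule measurable)
  have sets_P: "sets ?P = sets (PiM {..<N} (\<lambda>_. borel :: (real ^ 'd) measure))"
    by (intro sets_PiM_cong) auto
  have D: "?D \<in> measurable M ?P" by (intro measurable_restrict) (simp add: gauss_def)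
  have gP [measurable]: "g \<in> borel_measurable ?P"
    using g by (simp cong: measurable_cong_sets add: sets_P)
  have Tm: "(\<lambda>z. if i = c then reflect_coord e z else z) \<in> measurable (gauss (\<delta> i)) (gauss (\<delta> i))" for i
    by (cases "i = c") (auto simp: gauss_def)
  have \<Phi> [measurable]: "?\<Phi> \<in> measurable ?P ?P"
  proof (rule measurable_restrict)
    fix i assume i: "i \<in> {..<N}"
    show "(\<lambda>x. if i = c then reflect_coord e (x i) else x i) \<in> measurable ?P (gauss (\<delta> i))"
      using measurable_compose[OF measurable_component_singleton[OF i, of "\<lambda>i. gauss (\<delta> i)"] Tm[of i]] .
  qed
  have distr: "distr M ?P ?D = ?P" by (rule increments_distr) (use assms in \<open>auto simp: \<delta>_def\<close>)
  have inv: "distr ?P ?P ?\<Phi> = ?P"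
  proof (rule measure_eqI)
    fix A assume "A \<in> sets (distr ?P ?P ?\<Phi>)"
    then have A [measurable]: "A \<in> sets ?P" by simp
    have "emeasure (distr ?P ?P ?\<Phi>) A = (\<integral>\<^sup>+x. indicator A (?\<Phi> x) \<partial>?P)"
      by (subst nn_integral_indicator[symmetric], simp, subst nn_integral_distr) auto
    also have "\<dots> = (\<integral>\<^sup>+x. (\<Prod>i<N. 1) * indicator A x \<partial>?P)"
    proof (rule nn_integral_PiM_transform)
      show "distr (gauss (\<delta> i)) (gauss (\<delta> i)) (\<lambda>z. if i = c then reflect_coord e z else z) =
        density (gauss (\<delta> i)) (\<lambda>_. 1)" for i
        using distr_gauss_reflect_coord[of "\<delta> i" e] distr_id[of "gauss (\<delta> i) :: (real ^ 'd) measure"]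
        by (cases "i = c") (auto simp: density_1)
    qed (use prob_space_gauss \<delta>pos Tm in auto)
    also have "\<dots> = emeasure ?P A" by simp
    finally show "emeasure (distr ?P ?P ?\<Phi>) A = emeasure ?P A" .
  qed simp
  have "(\<integral>x. g x \<partial>?P) = (\<integral>x. g x \<partial>distr ?P ?P ?\<Phi>)" by (simp only: inv)
  also have "\<dots> = (\<integral>x. g (?\<Phi> x) \<partial>?P)" by (rule integral_distr) measurable
  also have "\<dots> = - (\<integral>x. g x \<partial>?P)" unfolding odd by simp
  finally have "(\<integral>x. g x \<partial>?P) = 0" by simp
  moreover have "(\<integral>x. g x \<partial>?P) = (\<integral>\<omega>. g (?D \<omega>) \<partial>M)"
    by (subst (1) distr[symmetric], rule integral_distr[OF D]) measurable
  ultimately show ?thesis by simp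
qed

end

context brownian_motion begin

text \<open>On a common time grid both products expand into monomials in the components of grid
  increments. Disjointness of the sides makes the pairs (cell, component) within each product
  distinct, so the two monomials correspond to sets of \<open>k\<close> and \<open>l\<close> pairs.
  As the cardinalities differ, some pair lies in exactly one of the sets; reflecting that component
  of that increment changes the sign of the integrand.\<close>

lemma integral_box_mult_box:
  assumes kl: "k \<noteq> (l::nat)"
    and ab: "\<And>i. i < k \<Longrightarrow> 0 \<le> a i \<and> a i \<le> b i \<and> b i \<le> 1"
    and disj: "\<And>i j. i < k \<Longrightarrow> j < k \<Longrightarrow> i \<noteq> j \<Longrightarrow> ({a i<..b i} \<times> {e i}) \<inter> ({a j<..b j} \<times> {e j}) = {}"
    and ab': "\<And>i. i < l \<Longrightarrow> 0 \<le> a' i \<and> a' i \<le> b' i \<and> b' i \<le> 1"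
    and disj': "\<And>i j. i < l \<Longrightarrow> j < l \<Longrightarrow> i \<noteq> j \<Longrightarrow> ({a' i<..b' i} \<times> {e' i}) \<inter> ({a' j<..b' j} \<times> {e' j}) = {}"
  shows "(\<integral>\<omega>. (\<Prod>i<k. (W (b i) \<omega> - W (a i) \<omega>) $ e i) * (\<Prod>i<l. (W (b' i) \<omega> - W (a' i) \<omega>) $ e' i) \<partial>M) = 0"
proof -
  define T where "T = insert 0 (insert 1 (a ` {..<k} \<union> b ` {..<k} \<union> a' ` {..<l} \<union> b' ` {..<l}))"
  have "a i \<in> {0..1}" "b i \<in> {0..1}" if "i < k" for i using ab[OF that] by auto
  moreover have "a' i \<in> {0..1}" "b' i \<in> {0..1}" if "i < l" for i using ab'[OF that] by auto
  ultimately have "T \<subseteq> {0..1}" unfolding T_def by (intro insert_subsetI Un_least image_subsetI) auto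
  then have "finite T" "T \<subseteq> {0..1}" "0 \<in> T" "1 \<in> T" by (auto simp: T_def)
  then obtain \<tau> N where N: "0 < N" and mono: "mono \<tau>" and range: "range \<tau> \<subseteq> {0..1}" and \<tau>0: "\<tau> 0 = 0"
    and strict: "\<And>i. i < N \<Longrightarrow> \<tau> i < \<tau> (Suc i)" and T: "T = \<tau> ` {..N}"
    by (rule obtain_time_grid) blast
  have "\<exists>k\<le>N. q = \<tau> k" if "q \<in> T" for q using that T by (metis atMost_iff imageE)
  then obtain \<kappa> where \<kappa>: "\<And>q. q \<in> T \<Longrightarrow> \<kappa> q \<le> N" "\<And>q. q \<in> T \<Longrightarrow> \<tau> (\<kappa> q) = q" by metis
  have Wm [measurable]: "W (\<tau> i) \<in> borel_measurable M" for i
    using subsetD[OF range rangeI] by (rule measurable)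
  let ?D = "\<lambda>\<omega> i. W (\<tau> (Suc i)) \<omega> - W (\<tau> i) \<omega>"
  have comp [measurable]: "(\<lambda>z. z $ i) \<in> borel_measurable borel" for i :: 'd
    by (intro borel_measurable_continuous_onI continuous_intros)
  have expand: "(\<Prod>i<m. (W (y i) \<omega> - W (x i) \<omega>) $ z i) =
      (\<Sum>\<gamma>\<in>PiE {..<m} (\<lambda>i. {\<kappa> (x i)..<\<kappa> (y i)}). \<Prod>i<m. ?D \<omega> (\<gamma> i) $ z i)"
    if xy: "\<And>i. i < m \<Longrightarrow> x i \<in> T \<and> y i \<in> T \<and> x i \<le> y i" for m :: nat and x y z \<omega>
  proof -
    have "(W (y i) \<omega> - W (x i) \<omega>) $ z i = (\<Sum>c\<in>{\<kappa> (x i)..<\<kappa> (y i)}. ?D \<omega> c $ z i)" if "i < m" for i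
    proof -
      note i = xy[OF that]
      show ?thesis
      proof (cases "\<kappa> (x i) \<le> \<kappa> (y i)")
        case True
        then have "(\<Sum>c\<in>{\<kappa> (x i)..<\<kappa> (y i)}. ?D \<omega> c) = W (\<tau> (\<kappa> (y i))) \<omega> - W (\<tau> (\<kappa> (x i))) \<omega>"
          by (rule sum_Suc_diff')
        then have "(\<Sum>c\<in>{\<kappa> (x i)..<\<kappa> (y i)}. ?D \<omega> c) $ z i = (W (\<tau> (\<kappa> (y i))) \<omega> - W (\<tau> (\<kappa> (x i))) \<omega>) $ z i"
          by (rule arg_cong)
        then show ?thesis using i by (simp only: sum_component \<kappa>)
      next
        case False
        then have "y i \<le> x i" using i \<kappa> monoD[OF mono, of "\<kappa> (y i)" "\<kappa> (x i)"] by auto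
        then have "y i = x i" using i by simp
        then show ?thesis by simp
      qed
    qed
    then have "(\<Prod>i<m. (W (y i) \<omega> - W (x i) \<omega>) $ z i) = (\<Prod>i<m. \<Sum>c\<in>{\<kappa> (x i)..<\<kappa> (y i)}. ?D \<omega> c $ z i)"
      by (intro prod.cong refl) simp
    also have "\<dots> = (\<Sum>\<gamma>\<in>PiE {..<m} (\<lambda>i. {\<kappa> (x i)..<\<kappa> (y i)}). \<Prod>i<m. ?D \<omega> (\<gamma> i) $ z i)"
      by (rule prod_sum_PiE) auto
    finally show ?thesis .
  qed
  have inj: "inj_on (\<lambda>i. (\<gamma> i, e i)) {..<k}" and le: "\<And>i. i < k \<Longrightarrow> \<gamma> i < N"
    if ab: "\<And>i. i < k \<Longrightarrow> a i \<in> T \<and> b i \<in> T"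
      and disj: "\<And>i j. i < k \<Longrightarrow> j < k \<Longrightarrow> i \<noteq> j \<Longrightarrow> ({a i<..b i} \<times> {e i}) \<inter> ({a j<..b j} \<times> {e j}) = {}"
      and \<gamma>: "\<gamma> \<in> PiE {..<k} (\<lambda>i. {\<kappa> (a i)..<\<kappa> (b i)})"
    for k :: nat and a b and e :: "nat \<Rightarrow> 'd" and \<gamma>
  proof -
    show le: "\<gamma> i < N" if "i < k" for i
      using PiE_mem[OF \<gamma>, of i] that \<kappa>(1)[of "b i"] ab[OF that] by auto
    \<comment> \<open>The right endpoint of a chosen cell lies in its half-open side. Two factors
      with the same cell and component would therefore produce a common point of two disjoint
      sides.\<close>
    have mem: "\<tau> (Suc (\<gamma> i)) \<in> {a i<..b i}" if "i < k" for i
    proof -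
      have "\<kappa> (a i) \<le> \<gamma> i" "Suc (\<gamma> i) \<le> \<kappa> (b i)" using PiE_mem[OF \<gamma>, of i] that by auto
      then have "\<tau> (\<kappa> (a i)) \<le> \<tau> (\<gamma> i)" "\<tau> (Suc (\<gamma> i)) \<le> \<tau> (\<kappa> (b i))" by (simp_all add: monoD[OF mono])
      then show ?thesis using strict[OF le[OF that]] \<kappa>(2) ab[OF that] by auto
    qed
    show "inj_on (\<lambda>i. (\<gamma> i, e i)) {..<k}"
    proof (rule inj_onI, rule ccontr)
      fix i j assume "i \<in> {..<k}" "j \<in> {..<k}" "(\<gamma> i, e i) = (\<gamma> j, e j)" "i \<noteq> j"
      moreover from this have "(\<tau> (Suc (\<gamma> i)), e i) \<in> ({a i<..b i} \<times> {e i}) \<inter> ({a j<..b j} \<times> {e j})"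
        using mem[of i] mem[of j] by (auto simp del: greaterThanAtMost_iff)
      ultimately show False using disj[of i j] by blast
    qed
  qed
  have T1: "a i \<in> T \<and> b i \<in> T \<and> a i \<le> b i" if "i < k" for i using that ab by (auto simp: T_def)
  have T2: "a' i \<in> T \<and> b' i \<in> T \<and> a' i \<le> b' i" if "i < l" for i using that ab' by (auto simp: T_def)
  let ?A = "PiE {..<k} (\<lambda>i. {\<kappa> (a i)..<\<kappa> (b i)})" and ?B = "PiE {..<l} (\<lambda>i. {\<kappa> (a' i)..<\<kappa> (b' i)})"
  have sq: "square_integrable M (\<lambda>\<omega>. \<Prod>i<k. ?D \<omega> (\<gamma> i) $ e i)" for k :: nat and \<gamma> e
  proof (rule square_integrable_box)
    fix i
    show "0 \<le> \<tau> (\<gamma> i) \<and> \<tau> (\<gamma> i) \<le> \<tau> (Suc (\<gamma> i)) \<and> \<tau> (Suc (\<gamma> i)) \<le> 1"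
      using subsetD[OF range rangeI[of \<tau> "\<gamma> i"]] subsetD[OF range rangeI[of \<tau> "Suc (\<gamma> i)"]] monoD[OF mono, of "\<gamma> i" "Suc (\<gamma> i)"]
      by auto
  qed
  have monomial: "(\<integral>\<omega>. (\<Prod>i<k. ?D \<omega> (\<gamma> i) $ e i) * (\<Prod>i<l. ?D \<omega> (\<gamma>' i) $ e' i) \<partial>M) = 0"
    if \<gamma>: "\<gamma> \<in> ?A" and \<gamma>': "\<gamma>' \<in> ?B" for \<gamma> \<gamma>'
  proof -
    have inj1: "inj_on (\<lambda>i. (\<gamma> i, e i)) {..<k}" and le1: "\<And>i. i < k \<Longrightarrow> \<gamma> i < N"
      using inj[of k a b e \<gamma>] le[of k a b e \<gamma>] T1 disj \<gamma> by auto
    have inj2: "inj_on (\<lambda>i. (\<gamma>' i, e' i)) {..<l}" and le2: "\<And>i. i < l \<Longrightarrow> \<gamma>' i < N"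
      using inj[of l a' b' e' \<gamma>'] le[of l a' b' e' \<gamma>'] T2 disj' \<gamma>' by auto
    define S where "S = (\<lambda>i. (\<gamma> i, e i)) ` {..<k}"
    define S' where "S' = (\<lambda>i. (\<gamma>' i, e' i)) ` {..<l}"
    have "card S = k" "card S' = l" using card_image[OF inj1] card_image[OF inj2] by (auto simp: S_def S'_def)
    then have "S \<noteq> S'" using kl by auto
    then obtain c d where cd: "((c, d) \<in> S) \<noteq> ((c, d) \<in> S')" by (metis set_eqI surj_pair)
    have cN: "c < N" using cd le1 le2 by (auto simp: S_def S'_def)
    have prod1: "(\<Prod>i<k. x (\<gamma> i) $ e i) = (\<Prod>(c, e)\<in>S. x c $ e)" for x :: "nat \<Rightarrow> real ^ 'd"
      unfolding S_def by (subst prod.reindex[OF inj1]) simp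
    have prod2: "(\<Prod>i<l. x (\<gamma>' i) $ e' i) = (\<Prod>(c, e)\<in>S'. x c $ e)" for x :: "nat \<Rightarrow> real ^ 'd"
      unfolding S'_def by (subst prod.reindex[OF inj2]) simp
    let ?\<Phi> = "\<lambda>x. \<lambda>i\<in>{..<N}. if i = c then reflect_coord d (x i) else x i"
    have flip: "(\<Prod>(c, e)\<in>R. ?\<Phi> x c $ e) = (if (c, d) \<in> R then -1 else 1) * (\<Prod>(c, e)\<in>R. x c $ e)"
      if R: "finite R" "\<And>c e. (c, e) \<in> R \<Longrightarrow> c < N" for R :: "(nat \<times> 'd) set" and x
    proof -
      have "(\<Prod>(c, e)\<in>R. ?\<Phi> x c $ e) = (\<Prod>r\<in>R. (if r = (c, d) then -1 else 1) * (x (fst r) $ snd r))"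
      proof (rule prod.cong[OF refl])
        fix r assume "r \<in> R"
        then have "fst r < N" using R(2)[of "fst r" "snd r"] by simp
        then show "(case r of (c, e) \<Rightarrow> ?\<Phi> x c $ e) = (if r = (c, d) then -1 else 1) * (x (fst r) $ snd r)"
          by (cases r) (auto simp: reflect_coord_def)
      qed
      also have "\<dots> = (if (c, d) \<in> R then -1 else 1) * (\<Prod>(c, e)\<in>R. x c $ e)"
        using R by (simp add: prod.distrib prod.delta case_prod_beta')
      finally show ?thesis .
    qed
    define g where "g x = (\<Prod>(c, e)\<in>S. x c $ e) * (\<Prod>(c, e)\<in>S'. x c $ e)" for x :: "nat \<Rightarrow> real ^ 'd"
    have SN: "finite S" "finite S'" "\<And>c e. (c, e) \<in> S \<Longrightarrow> c < N" "\<And>c e. (c, e) \<in> S' \<Longrightarrow> c < N"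
      using le1 le2 by (auto simp: S_def S'_def)
    have "(\<integral>\<omega>. g (\<lambda>i\<in>{..<N}. ?D \<omega> i) \<partial>M) = 0"
    proof (rule integral_increments_odd[OF N mono range strict cN])
      show "g (?\<Phi> x) = - g x" for x
      proof -
        have "g (?\<Phi> x) = ((if (c, d) \<in> S then -1 else 1) * (\<Prod>(c, e)\<in>S. x c $ e)) *
            ((if (c, d) \<in> S' then -1 else 1) * (\<Prod>(c, e)\<in>S'. x c $ e))"
          unfolding g_def by (rule arg_cong2[where f="(*)", OF flip[OF SN(1,3)] flip[OF SN(2,4)]])
        then show ?thesis using cd by (auto simp: g_def)
      qed
      have m: "(\<lambda>x. x (fst r) $ snd r) \<in> borel_measurable (PiM {..<N} (\<lambda>_. borel :: (real ^ 'd) measure))"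
        if "r \<in> S \<union> S'" for r
        by (intro measurable_compose[OF _ comp] measurable_component_singleton)
           (use that SN(3,4)[of "fst r" "snd r"] in auto)
      show "g \<in> borel_measurable (PiM {..<N} (\<lambda>_. borel))" unfolding g_def[abs_def] case_prod_beta'
        by (intro borel_measurable_times borel_measurable_prod m) auto
    qed
    also have "(\<lambda>\<omega>. g (\<lambda>i\<in>{..<N}. ?D \<omega> i)) = (\<lambda>\<omega>. (\<Prod>i<k. ?D \<omega> (\<gamma> i) $ e i) * (\<Prod>i<l. ?D \<omega> (\<gamma>' i) $ e' i))"
      unfolding g_def prod1[symmetric] prod2[symmetric] using le1 le2
      by (intro ext arg_cong2[where f="(*)"] prod.cong) auto
    finally show ?thesis .
  qed
  have "(\<integral>\<omega>. (\<Prod>i<k. (W (b i) \<omega> - W (a i) \<omega>) $ e i) * (\<Prod>i<l. (W (b' i) \<omega> - W (a' i) \<omega>) $ e' i) \<partial>M) =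
    (\<integral>\<omega>. (\<Sum>\<gamma>\<in>?A. \<Sum>\<gamma>'\<in>?B. (\<Prod>i<k. ?D \<omega> (\<gamma> i) $ e i) * (\<Prod>i<l. ?D \<omega> (\<gamma>' i) $ e' i)) \<partial>M)"
  proof (rule Bochner_Integration.integral_cong[OF refl])
    fix \<omega>
    have "(\<Prod>i<k. (W (b i) \<omega> - W (a i) \<omega>) $ e i) = (\<Sum>\<gamma>\<in>?A. \<Prod>i<k. ?D \<omega> (\<gamma> i) $ e i)"
      by (rule expand) (rule T1)
    moreover have "(\<Prod>i<l. (W (b' i) \<omega> - W (a' i) \<omega>) $ e' i) = (\<Sum>\<gamma>'\<in>?B. \<Prod>i<l. ?D \<omega> (\<gamma>' i) $ e' i)"
      by (rule expand) (rule T2)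
    ultimately show "(\<Prod>i<k. (W (b i) \<omega> - W (a i) \<omega>) $ e i) * (\<Prod>i<l. (W (b' i) \<omega> - W (a' i) \<omega>) $ e' i) =
      (\<Sum>\<gamma>\<in>?A. \<Sum>\<gamma>'\<in>?B. (\<Prod>i<k. ?D \<omega> (\<gamma> i) $ e i) * (\<Prod>i<l. ?D \<omega> (\<gamma>' i) $ e' i))"
      by (simp only: sum_product)
  qed
  also have "\<dots> = (\<Sum>\<gamma>\<in>?A. \<Sum>\<gamma>'\<in>?B. \<integral>\<omega>. (\<Prod>i<k. ?D \<omega> (\<gamma> i) $ e i) * (\<Prod>i<l. ?D \<omega> (\<gamma>' i) $ e' i) \<partial>M)"
    by (subst Bochner_Integration.integral_sum, intro Bochner_Integration.integrable_sum square_integrable_mult sq,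
        subst Bochner_Integration.integral_sum, intro square_integrable_mult sq, rule refl)
  also have "\<dots> = 0" by (intro sum.neutral ballI monomial)
  finally show ?thesis .
qed

lemma elementary_ito_orthogonal:
  assumes X: "elementary_ito W k f X" and Y: "elementary_ito W l g Y" and kl: "k \<noteq> l"
  shows "(\<integral>\<omega>. X \<omega> * Y \<omega> \<partial>M) = 0" using X
proof (induction rule: elementary_ito.induct)
  case (add_box f X a b e c)
  let ?B = "\<lambda>\<omega>. \<Prod>i<k. (W (b i) \<omega> - W (a i) \<omega>) $ e i"
  have sqB: "square_integrable M ?B" by (rule square_integrable_box) (rule add_box.hyps)
  have BY: "(\<integral>\<omega>. ?B \<omega> * Y \<omega> \<partial>M) = 0" using Y
  proof (induction rule: elementary_ito.induct)
    case (add_box f' X' a' b' e' c')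
    let ?B' = "\<lambda>\<omega>. \<Prod>i<l. (W (b' i) \<omega> - W (a' i) \<omega>) $ e' i"
    have sqB': "square_integrable M ?B'" by (rule square_integrable_box) (rule add_box.hyps)
    have "(\<integral>\<omega>. ?B \<omega> * (X' \<omega> + c' * ?B' \<omega>) \<partial>M) = (\<integral>\<omega>. ?B \<omega> * X' \<omega> + c' * (?B \<omega> * ?B' \<omega>) \<partial>M)"
      by (simp add: algebra_simps)
    also have "\<dots> = (\<integral>\<omega>. ?B \<omega> * X' \<omega> \<partial>M) + c' * (\<integral>\<omega>. ?B \<omega> * ?B' \<omega> \<partial>M)"
      using square_integrable_mult[OF sqB elementary_ito_square_integrable[OF add_box.hyps(1)]] square_integrable_mult[OF sqB sqB']
      by (subst Bochner_Integration.integral_add) auto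
    also have "\<dots> = 0" using integral_box_mult_box[OF kl \<open>\<And>i. i < k \<Longrightarrow> 0 \<le> a i \<and> a i \<le> b i \<and> b i \<le> 1\<close>
         \<open>\<And>i j. i < k \<Longrightarrow> j < k \<Longrightarrow> i \<noteq> j \<Longrightarrow> {a i<..b i} \<times> {e i} \<inter> {a j<..b j} \<times> {e j} = {}\<close> add_box.hyps(2,3)] add_box.IH
      by simp
    finally show ?case .
  qed simp
  have "(\<integral>\<omega>. (X \<omega> + c * ?B \<omega>) * Y \<omega> \<partial>M) = (\<integral>\<omega>. X \<omega> * Y \<omega> + c * (?B \<omega> * Y \<omega>) \<partial>M)"
    by (simp add: algebra_simps)
  also have "\<dots> = (\<integral>\<omega>. X \<omega> * Y \<omega> \<partial>M) + c * (\<integral>\<omega>. ?B \<omega> * Y \<omega> \<partial>M)"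
    using square_integrable_mult[OF elementary_ito_square_integrable[OF add_box.hyps(1)] elementary_ito_square_integrable[OF Y]]
      square_integrable_mult[OF sqB elementary_ito_square_integrable[OF Y]]
    by (subst Bochner_Integration.integral_add) auto
  finally show ?case using add_box.IH BY by simp
qed simp

lemma wiener_chaos_square_integrable: "X \<in> wiener_chaos M W k \<Longrightarrow> square_integrable M X"
  by (auto simp: wiener_chaos_def is_multiple_ito_def L2_tendsto_def)

lemma wiener_chaos_orthogonal:
  assumes "X \<in> wiener_chaos M W k" "Y \<in> wiener_chaos M W l" "k \<noteq> l"
  shows "(\<integral>\<omega>. X \<omega> * Y \<omega> \<partial>M) = 0"
proof -
  obtain fs Xs where X: "\<And>m. elementary_ito W k (fs m) (Xs m)" "L2_tendsto M Xs X"
    using assms(1) by (auto simp: wiener_chaos_def is_multiple_ito_def)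
  obtain gs Ys where Y: "\<And>m. elementary_ito W l (gs m) (Ys m)" "L2_tendsto M Ys Y"
    using assms(2) by (auto simp: wiener_chaos_def is_multiple_ito_def)
  have "(\<lambda>m. \<integral>\<omega>. Xs m \<omega> * Ys m \<omega> \<partial>M) \<longlonglongrightarrow> (\<integral>\<omega>. X \<omega> * Y \<omega> \<partial>M)" by (rule L2_tendsto_inner) fact+
  then show ?thesis
    using elementary_ito_orthogonal[OF X(1) Y(1) assms(3)] LIMSEQ_unique[OF _ tendsto_const] by simp
qed

text \<open>By orthogonality the partial sums of the expansions pair diagonally, and convergence in
  L2 passes this to the limit. It is what makes the pairing with the approximations of \<rho>
  computable as an expectation.\<close>

lemma dual_pairing_expansions:
  assumes \<eta>: "ito_wiener_expansion M W \<eta> F" and \<zeta>: "ito_wiener_expansion M W \<zeta> R"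
  shows "dual_pairing M F R = (\<integral>\<omega>. \<eta> \<omega> * \<zeta> \<omega> \<partial>M)"
proof -
  have F: "F k \<in> wiener_chaos M W k" and R: "R k \<in> wiener_chaos M W k" for k
    using assms by (auto simp: ito_wiener_expansion_def)
  note sqF = wiener_chaos_square_integrable[OF F] and sqR = wiener_chaos_square_integrable[OF R]
  have "(\<integral>\<omega>. (\<Sum>k\<le>m. F k \<omega>) * (\<Sum>k\<le>m. R k \<omega>) \<partial>M) = (\<Sum>k\<le>m. \<integral>\<omega>. F k \<omega> * R k \<omega> \<partial>M)" for m
  proof -
    have "(\<integral>\<omega>. (\<Sum>k\<le>m. F k \<omega>) * (\<Sum>k\<le>m. R k \<omega>) \<partial>M) = (\<Sum>k\<le>m. \<Sum>l\<le>m. \<integral>\<omega>. F k \<omega> * R l \<omega> \<partial>M)"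
      by (simp only: sum_product, subst Bochner_Integration.integral_sum,
          intro Bochner_Integration.integrable_sum square_integrable_mult sqF sqR,
          subst Bochner_Integration.integral_sum, intro square_integrable_mult sqF sqR, rule refl)
    also have "\<dots> = (\<Sum>k\<le>m. \<Sum>l\<le>m. if l = k then \<integral>\<omega>. F k \<omega> * R k \<omega> \<partial>M else 0)"
      using wiener_chaos_orthogonal[OF F R] by (intro sum.cong refl) auto
    also have "\<dots> = (\<Sum>k\<le>m. \<integral>\<omega>. F k \<omega> * R k \<omega> \<partial>M)" by (intro sum.cong refl) (simp add: sum.delta)
    finally show ?thesis .
  qed
  moreover have "(\<lambda>m. \<integral>\<omega>. (\<Sum>k\<le>m. F k \<omega>) * (\<Sum>k\<le>m. R k \<omega>) \<partial>M) \<longlonglongrightarrow> (\<integral>\<omega>. \<eta> \<omega> * \<zeta> \<omega> \<partial>M)"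
    using assms by (intro L2_tendsto_inner) (auto simp: ito_wiener_expansion_def)
  ultimately have "(\<lambda>k. \<integral>\<omega>. F k \<omega> * R k \<omega> \<partial>M) sums (\<integral>\<omega>. \<eta> \<omega> * \<zeta> \<omega> \<partial>M)" by (simp add: sums_def_le)
  then show ?thesis by (simp add: dual_pairing_def sums_iff)
qed

text \<open>Duality of the spaces with indices -\<gamma> and \<gamma>. A weighted Young inequality
  with a free parameter \<open>c\<close> takes the place of Cauchy--Schwarz for the weighted series:
  the error is at most \<open>c\<close> times a fixed finite sum coming from \<open>F\<close>, plus
  the squared Sobolev distance divided by \<open>c\<close>.\<close>

lemma dual_pairing_tendsto:
  assumes F: "F \<in> sobolev M W (- \<gamma>)" and Rs: "\<And>m. Rs m \<in> sobolev M W \<gamma>" and R: "R \<in> sobolev M W \<gamma>"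
    and lim: "(\<lambda>m::nat. sobolev_sq_norm M \<gamma> (\<lambda>k \<omega>. Rs m k \<omega> - R k \<omega>)) \<longlonglongrightarrow> 0"
  shows "(\<lambda>m. dual_pairing M F (Rs m)) \<longlonglongrightarrow> dual_pairing M F R"
proof -
  define A where "A k = real (k + 1) powr (- \<gamma>) * (\<integral>\<omega>. (F k \<omega>)\<^sup>2 \<partial>M)" for k
  have sqF: "square_integrable M (F k)" and sqR: "square_integrable M (R k)" and sqRs: "square_integrable M (Rs m k)" for m k
    using F R Rs[of m] unfolding sobolev_def mem_Collect_eq
    by (blast intro: wiener_chaos_square_integrable)+
  have sumA: "summable A" using F by (simp add: sobolev_def A_def[abs_def])
  have A0: "0 \<le> suminf A" by (intro suminf_nonneg sumA) (simp add: A_def)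
  let ?J = "\<lambda>m k. \<integral>\<omega>. (Rs m k \<omega> - R k \<omega>)\<^sup>2 \<partial>M"
  have ineq: "\<bar>\<integral>\<omega>. F k \<omega> * G \<omega> \<partial>M\<bar> \<le> c * A k + (real (k + 1) powr \<gamma> * (\<integral>\<omega>. (G \<omega>)\<^sup>2 \<partial>M)) / c"
    if c: "0 < c" and G: "square_integrable M G" for c k G
  proof -
    define w where "w = real (k + 1) powr \<gamma>"
    have w: "w > 0" "real (k + 1) powr (- \<gamma>) = 1 / w" by (auto simp: w_def powr_minus_divide)
    have pt: "\<bar>f * g\<bar> \<le> c / w * f\<^sup>2 + w / c * g\<^sup>2" for f g
    proof -
      have "0 \<le> (c * \<bar>f\<bar> - w * \<bar>g\<bar>)\<^sup>2 / (c * w)" using c w by simp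
      also have "\<dots> = c / w * f\<^sup>2 + w / c * g\<^sup>2 - 2 * \<bar>f * g\<bar>"
        using c w by (simp add: field_simps power2_eq_square abs_mult)
      finally show ?thesis by simp
    qed
    have "\<bar>\<integral>\<omega>. F k \<omega> * G \<omega> \<partial>M\<bar> \<le> (\<integral>\<omega>. \<bar>F k \<omega> * G \<omega>\<bar> \<partial>M)" by (rule integral_abs_bound)
    also have "\<dots> \<le> (\<integral>\<omega>. c / w * (F k \<omega>)\<^sup>2 + w / c * (G \<omega>)\<^sup>2 \<partial>M)"
      using square_integrable_mult[OF sqF[of k] G] sqF[of k] G pt
      by (intro integral_mono integrable_abs) (auto simp: square_integrable_def)
    also have "\<dots> = c / w * (\<integral>\<omega>. (F k \<omega>)\<^sup>2 \<partial>M) + w / c * (\<integral>\<omega>. (G \<omega>)\<^sup>2 \<partial>M)"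
      using sqF[of k] G by (subst Bochner_Integration.integral_add) (auto simp: square_integrable_def)
    finally show ?thesis unfolding A_def w(2) w_def[symmetric] by (simp add: mult.commute)
  qed
  have summ: "summable (\<lambda>k. \<integral>\<omega>. F k \<omega> * G k \<omega> \<partial>M)"
    if "\<And>k. square_integrable M (G k)" "summable (\<lambda>k. real (k + 1) powr \<gamma> * (\<integral>\<omega>. (G k \<omega>)\<^sup>2 \<partial>M))" for G
  proof (rule summable_comparison_test)
    show "\<exists>N. \<forall>k\<ge>N. norm (\<integral>\<omega>. F k \<omega> * G k \<omega> \<partial>M) \<le> 1 * A k + real (k + 1) powr \<gamma> * (\<integral>\<omega>. (G k \<omega>)\<^sup>2 \<partial>M) / 1"
      by (intro exI[of _ 0] allI impI) (subst real_norm_def, rule ineq[OF zero_less_one that(1)])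
    show "summable (\<lambda>k. 1 * A k + real (k + 1) powr \<gamma> * (\<integral>\<omega>. (G k \<omega>)\<^sup>2 \<partial>M) / 1)"
      using summable_add[OF sumA that(2)] by simp
  qed
  have summ_diff: "summable (\<lambda>k. real (k + 1) powr \<gamma> * ?J m k)" for m
  proof (rule summable_comparison_test)
    let ?b = "\<lambda>k. 2 * (real (k + 1) powr \<gamma> * (\<integral>\<omega>. (Rs m k \<omega>)\<^sup>2 \<partial>M)) + 2 * (real (k + 1) powr \<gamma> * (\<integral>\<omega>. (R k \<omega>)\<^sup>2 \<partial>M))"
    show "summable ?b"
      using Rs[of m] R by (intro summable_add summable_mult) (auto simp: sobolev_def)
    have "real (k + 1) powr \<gamma> * ?J m k \<le> ?b k" for k
    proof -
      have "?J m k \<le> (\<integral>\<omega>. 2 * (Rs m k \<omega>)\<^sup>2 + 2 * (R k \<omega>)\<^sup>2 \<partial>M)"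
      proof (rule integral_mono)
        show "integrable M (\<lambda>\<omega>. (Rs m k \<omega> - R k \<omega>)\<^sup>2)"
          using square_integrable_diff[OF sqRs sqR] by (simp add: square_integrable_def)
        show "(Rs m k \<omega> - R k \<omega>)\<^sup>2 \<le> 2 * (Rs m k \<omega>)\<^sup>2 + 2 * (R k \<omega>)\<^sup>2" for \<omega>
          using zero_le_power2[of "Rs m k \<omega> + R k \<omega>"] unfolding power2_sum power2_diff by linarith
      qed (use sqRs[of m k] sqR[of k] in \<open>auto simp: square_integrable_def\<close>)
      also have "\<dots> = 2 * (\<integral>\<omega>. (Rs m k \<omega>)\<^sup>2 \<partial>M) + 2 * (\<integral>\<omega>. (R k \<omega>)\<^sup>2 \<partial>M)"
        using sqRs[of m k] sqR[of k] by (subst Bochner_Integration.integral_add) (auto simp: square_integrable_def)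
      finally have "real (k + 1) powr \<gamma> * ?J m k \<le>
          real (k + 1) powr \<gamma> * (2 * (\<integral>\<omega>. (Rs m k \<omega>)\<^sup>2 \<partial>M) + 2 * (\<integral>\<omega>. (R k \<omega>)\<^sup>2 \<partial>M))"
        by (intro mult_left_mono) auto
      then show ?thesis by (simp only: distrib_left mult.left_commute)
    qed
    then show "\<exists>N. \<forall>k\<ge>N. norm (real (k + 1) powr \<gamma> * ?J m k) \<le> ?b k" by auto
  qed
  define B where "B m = sobolev_sq_norm M \<gamma> (\<lambda>k \<omega>. Rs m k \<omega> - R k \<omega>)" for m
  have bound: "\<bar>dual_pairing M F (Rs m) - dual_pairing M F R\<bar> \<le> c * suminf A + B m / c" if c: "0 < c" for c m
  proof -
    have s1: "summable (\<lambda>k. \<integral>\<omega>. F k \<omega> * Rs m k \<omega> \<partial>M)"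
      using Rs[of m] sqRs by (intro summ) (auto simp: sobolev_def)
    have s2: "summable (\<lambda>k. \<integral>\<omega>. F k \<omega> * R k \<omega> \<partial>M)"
      using R sqR by (intro summ) (auto simp: sobolev_def)
    have s3: "summable (\<lambda>k. c * A k + real (k + 1) powr \<gamma> * ?J m k / c)"
      by (intro summable_add summable_mult summable_divide sumA summ_diff)
    have "dual_pairing M F (Rs m) - dual_pairing M F R = (\<Sum>k. (\<integral>\<omega>. F k \<omega> * Rs m k \<omega> \<partial>M) - (\<integral>\<omega>. F k \<omega> * R k \<omega> \<partial>M))"
      unfolding dual_pairing_def using s1 s2 by (rule suminf_diff)
    also have "(\<lambda>k. (\<integral>\<omega>. F k \<omega> * Rs m k \<omega> \<partial>M) - (\<integral>\<omega>. F k \<omega> * R k \<omega> \<partial>M)) = (\<lambda>k. \<integral>\<omega>. F k \<omega> * (Rs m k \<omega> - R k \<omega>) \<partial>M)"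
      by (simp only: right_diff_distrib Bochner_Integration.integral_diff
          square_integrable_mult[OF sqF sqRs] square_integrable_mult[OF sqF sqR])
    finally have "\<bar>dual_pairing M F (Rs m) - dual_pairing M F R\<bar> = norm (\<Sum>k. \<integral>\<omega>. F k \<omega> * (Rs m k \<omega> - R k \<omega>) \<partial>M)"
      by simp
    also have "\<dots> \<le> (\<Sum>k. c * A k + real (k + 1) powr \<gamma> * ?J m k / c)"
      using ineq[OF c square_integrable_diff[OF sqRs sqR]] by (intro norm_suminf_le s3) auto
    also have "\<dots> = c * suminf A + B m / c" unfolding B_def sobolev_sq_norm_def
      by (intro sums_unique[symmetric] sums_add sums_mult sums_divide summable_sums sumA summ_diff)
    finally show ?thesis .
  qed
  show ?thesis
  proof (rule LIMSEQ_I)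
    fix r :: real assume r: "0 < r"
    \<comment> \<open>First \<open>c\<close> is made small enough that the contribution of
      \<open>F\<close> stays below r/2 for every \<open>m\<close>; the added 1 avoids division by
      zero. Then \<open>m\<close> is taken large for this fixed \<open>c\<close>.\<close>
    define c where "c = r / (2 * (suminf A + 1))"
    have c: "0 < c" using r A0 by (simp add: c_def)
    have cA: "c * suminf A \<le> r / 2" using r A0 by (simp add: c_def field_simps)
    have "eventually (\<lambda>m. B m < c * (r / 2)) sequentially"
      using lim c r unfolding B_def[symmetric] by (intro order_tendstoD(2)[where y=0]) auto
    then obtain no where no: "\<And>m. m \<ge> no \<Longrightarrow> B m < c * (r / 2)" by (auto simp: eventually_sequentially)
    have "norm (dual_pairing M F (Rs m) - dual_pairing M F R) < r" if "m \<ge> no" for m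
    proof -
      have "B m / c < r / 2" using no[OF that] c by (simp add: field_simps)
      then show ?thesis using bound[OF c, of m] cA unfolding real_norm_def by linarith
    qed
    then show "\<exists>no. \<forall>m\<ge>no. norm (dual_pairing M F (Rs m) - dual_pairing M F R) < r" by blast
  qed
qed

end

section \<open>Identification of \<open>\<theta>\<close>\<close>

lemma integrable_heat_kernel:
  assumes "0 < \<epsilon>"
  shows "integrable lborel (heat_kernel \<epsilon> :: 'v::euclidean_space \<Rightarrow> real)"
    and "(\<integral>z. heat_kernel \<epsilon> (z::'v) \<partial>lborel) = 1"
proof -
  have "has_bochner_integral lborel (heat_kernel \<epsilon> :: 'v \<Rightarrow> real) 1"
    using nn_integral_heat_kernel[OF assms, where 'v='v] by (intro has_bochner_integral_nn_integral) auto
  then show "integrable lborel (heat_kernel \<epsilon> :: 'v \<Rightarrow> real)" "(\<integral>z. heat_kernel \<epsilon> (z::'v) \<partial>lborel) = 1"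
    by (auto simp: has_bochner_integral_iff)
qed

lemma integrable_heat_kernel_norm_sq:
  assumes "0 < \<epsilon>"
  shows "integrable lborel (\<lambda>z::'v::euclidean_space. heat_kernel \<epsilon> z * (norm z)\<^sup>2)"
    and "(\<integral>z. heat_kernel \<epsilon> (z::'v) * (norm z)\<^sup>2 \<partial>lborel) = real DIM('v) * \<epsilon>"
proof -
  have "has_bochner_integral lborel (\<lambda>z::'v. heat_kernel \<epsilon> z * (norm z)\<^sup>2) (real DIM('v) * \<epsilon>)"
    using nn_integral_heat_kernel_norm_sq[OF assms, where 'v='v] assms
    by (intro has_bochner_integral_nn_integral) auto
  then show "integrable lborel (\<lambda>z::'v. heat_kernel \<epsilon> z * (norm z)\<^sup>2)"
    "(\<integral>z. heat_kernel \<epsilon> (z::'v) * (norm z)\<^sup>2 \<partial>lborel) = real DIM('v) * \<epsilon>"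
    by (auto simp: has_bochner_integral_iff)
qed

lemma integral_lborel_translate:
  fixes g :: "'v::euclidean_space \<Rightarrow> real"
  assumes [measurable]: "g \<in> borel_measurable borel"
  shows "(\<integral>y. g (y - u) \<partial>lborel) = (\<integral>y. g y \<partial>lborel)"
    and "integrable lborel (\<lambda>y. g (y - u)) \<longleftrightarrow> integrable lborel g"
proof -
  have *: "distr lborel borel (\<lambda>y. y - u) = lborel"
    using lborel_distr_plus[of "- u"] by (simp add: add.commute cong: distr_cong)
  show "(\<integral>y. g (y - u) \<partial>lborel) = (\<integral>y. g y \<partial>lborel)"
    by (subst (2) *[symmetric], subst integral_distr) auto
  show "integrable lborel (\<lambda>y. g (y - u)) \<longleftrightarrow> integrable lborel g"
    by (subst (2) *[symmetric], subst integrable_distr_eq) auto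
qed

text \<open>The mass of the heat kernel outside a ball is controlled by its second moment.\<close>

lemma heat_kernel_approximate_identity:
  fixes h :: "'v::euclidean_space \<Rightarrow> real" and \<epsilon> :: "nat \<Rightarrow> real"
  assumes [measurable]: "h \<in> borel_measurable borel" and bound: "\<And>y. \<bar>h y\<bar> \<le> C"
    and cont: "isCont h u" and pos: "\<And>m. 0 < \<epsilon> m" and lim: "\<epsilon> \<longlonglongrightarrow> 0"
  shows "(\<lambda>m. \<integral>y. heat_kernel (\<epsilon> m) (y - u) * h y \<partial>lborel) \<longlonglongrightarrow> h u"
proof (rule LIMSEQ_I)
  fix r :: real assume r: "0 < r"
  have C: "0 \<le> C" using bound[of u] abs_ge_zero[of "h u"] by linarith
  obtain \<delta> where \<delta>: "0 < \<delta>" "\<And>y. norm (y - u) < \<delta> \<Longrightarrow> \<bar>h y - h u\<bar> < r / 2"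
    using cont[unfolded continuous_at_eps_delta, rule_format, of "r / 2"] r by (auto simp: dist_norm)
  define L where "L = 2 * C / \<delta>\<^sup>2"
  have L: "0 \<le> L" using C by (simp add: L_def)
  have pt: "\<bar>h y - h u\<bar> \<le> r / 2 + L * (norm (y - u))\<^sup>2" for y
  proof (cases "norm (y - u) < \<delta>")
    case True
    then show ?thesis using \<delta>(2)[of y] L by (smt (verit) mult_nonneg_nonneg zero_le_power2)
  next
    case False
    then have "1 \<le> (norm (y - u))\<^sup>2 / \<delta>\<^sup>2" using \<delta> by (simp add: power_mono)
    from mult_left_mono[OF this, of "2 * C"] have "2 * C \<le> L * (norm (y - u))\<^sup>2" using C by (simp add: L_def)
    moreover have "\<bar>h y - h u\<bar> \<le> 2 * C" using bound[of y] bound[of u] by linarith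
    ultimately show ?thesis using r by linarith
  qed
  have "(\<lambda>m. L * (real DIM('v) * \<epsilon> m)) \<longlonglongrightarrow> L * (real DIM('v) * 0)" by (intro tendsto_intros lim)
  then have "eventually (\<lambda>m. L * (real DIM('v) * \<epsilon> m) < r / 2) sequentially"
    using r by (intro order_tendstoD(2)) auto
  then obtain no where no: "\<And>m. m \<ge> no \<Longrightarrow> L * (real DIM('v) * \<epsilon> m) < r / 2" by (auto simp: eventually_sequentially)
  have "norm ((\<integral>y. heat_kernel (\<epsilon> m) (y - u) * h y \<partial>lborel) - h u) < r" if "m \<ge> no" for m
  proof -
    let ?p = "\<lambda>y. heat_kernel (\<epsilon> m) (y - u)"
    note p = integrable_heat_kernel[OF pos[of m], where 'v='v] integrable_heat_kernel_norm_sq[OF pos[of m], where 'v='v]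
    have int1: "integrable lborel (\<lambda>y. ?p y)" "(\<integral>y. ?p y \<partial>lborel) = 1"
      using p integral_lborel_translate[of "heat_kernel (\<epsilon> m) :: 'v \<Rightarrow> real" u] by auto
    have int2: "integrable lborel (\<lambda>y. ?p y * (norm (y - u))\<^sup>2)"
      "(\<integral>y. ?p y * (norm (y - u))\<^sup>2 \<partial>lborel) = real DIM('v) * \<epsilon> m"
      using p integral_lborel_translate[of "\<lambda>z::'v. heat_kernel (\<epsilon> m) z * (norm z)\<^sup>2" u] by auto
    have int3: "integrable lborel (\<lambda>y. ?p y * h y)"
    proof (rule Bochner_Integration.integrable_bound)
      show "integrable lborel (\<lambda>y. C * ?p y)" using int1 by simp
      show "AE y in lborel. norm (?p y * h y) \<le> norm (C * ?p y)"
        using bound C by (intro AE_I2) (simp add: abs_mult mult.commute mult_right_mono)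
    qed measurable
    have "(\<integral>y. ?p y * h y \<partial>lborel) - h u =
      (\<integral>y. ?p y * h y \<partial>lborel) - (\<integral>y. ?p y * h u \<partial>lborel)" using int1 by simp
    also have "\<dots> = (\<integral>y. ?p y * h y - ?p y * h u \<partial>lborel)"
      using int1 int3 by (intro Bochner_Integration.integral_diff[symmetric]) auto
    finally have "norm ((\<integral>y. ?p y * h y \<partial>lborel) - h u) \<le>
      (\<integral>y. norm (?p y * h y - ?p y * h u) \<partial>lborel)" by (simp only: integral_norm_bound)
    also have "\<dots> \<le> (\<integral>y. r / 2 * ?p y + L * (?p y * (norm (y - u))\<^sup>2) \<partial>lborel)"
    proof (rule integral_mono)
      show "integrable lborel (\<lambda>y. norm (?p y * h y - ?p y * h u))"
        using int1 int3 by (intro integrable_norm Bochner_Integration.integrable_diff) auto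
      show "integrable lborel (\<lambda>y. r / 2 * ?p y + L * (?p y * (norm (y - u))\<^sup>2))"
        using int1 int2 by auto
      fix y :: 'v
      have "norm (?p y * h y - ?p y * h u) = ?p y * \<bar>h y - h u\<bar>"
        by (simp add: abs_mult flip: right_diff_distrib)
      also have "\<dots> \<le> ?p y * (r / 2 + L * (norm (y - u))\<^sup>2)" by (intro mult_left_mono pt) simp
      finally show "norm (?p y * h y - ?p y * h u) \<le>
        r / 2 * ?p y + L * (?p y * (norm (y - u))\<^sup>2)" by (simp add: algebra_simps)
    qed
    also have "\<dots> = r / 2 + L * (real DIM('v) * \<epsilon> m)"
      using int1 int2 by (subst Bochner_Integration.integral_add) auto
    also have "\<dots> < r" using no[OF that] by linarith
    finally show ?thesis .
  qed
  then show "\<exists>no. \<forall>m\<ge>no. norm ((\<integral>y. heat_kernel (\<epsilon> m) (y - u) * h y \<partial>lborel) - h u) < r" by blast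
qed

section \<open>Grid times and the bridge decomposition of the grid values\<close>

lemma borel_measurable_vec_lambda [measurable (raw)]:
  fixes f :: "'n::finite \<Rightarrow> 'a \<Rightarrow> 'b::euclidean_space"
  assumes "\<And>j. f j \<in> borel_measurable M"
  shows "(\<lambda>x. \<chi> j. f j x) \<in> borel_measurable M"
proof (subst borel_measurable_euclidean_space, intro ballI)
  fix b :: "'b ^ 'n" assume "b \<in> Basis"
  then obtain j c where "b = axis j c" by (auto simp: Basis_vec_def)
  moreover have "(\<lambda>x. f j x \<bullet> c) \<in> borel_measurable M" using assms by simp
  ultimately show "(\<lambda>x. (\<chi> j. f j x) \<bullet> b) \<in> borel_measurable M" by (simp add: inner_axis)
qed

lemma bij_betw_column_number: "bij_betw (column_number :: 'n::{finite,linorder} \<Rightarrow> nat) UNIV {1..CARD('n)}"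
proof -
  have "strict_mono (column_number :: 'n \<Rightarrow> nat)"
  proof (rule strict_monoI)
    fix i j :: 'n assume ij: "i < j"
    then have "{k. k \<le> i} \<subseteq> {k. k \<le> j}" "j \<in> {k. k \<le> j} - {k. k \<le> i}" by auto
    then have "{k. k \<le> i} \<subset> {k. k \<le> j}" by blast
    then show "column_number i < column_number j"
      unfolding column_number_def by (intro psubset_card_mono) auto
  qed
  then have inj: "inj (column_number :: 'n \<Rightarrow> nat)" by (rule strict_mono_imp_inj_on)
  have "range (column_number :: 'n \<Rightarrow> nat) \<subseteq> {1..CARD('n)}"
  proof (intro image_subsetI)
    fix j :: 'n
    have "card {i. i \<le> j} \<le> CARD('n)" by (intro card_mono) auto
    moreover have "0 < card {i. i \<le> j}" by (auto simp: card_gt_0_iff)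
    ultimately show "column_number j \<in> {1..CARD('n)}" by (simp add: column_number_def)
  qed
  moreover have "card (range (column_number :: 'n \<Rightarrow> nat)) = card {1..CARD('n)}"
    using inj by (simp add: card_image)
  ultimately have "range (column_number :: 'n \<Rightarrow> nat) = {1..CARD('n)}" by (intro card_subset_eq) auto
  with inj show ?thesis by (simp add: bij_betw_def)
qed

lemma column_number_bounds: "column_number (j::'n::{finite,linorder}) \<in> {1..CARD('n)}"
  using bij_betw_column_number by (auto simp: bij_betw_def)

definition grid_time :: "'n::{finite,linorder} \<Rightarrow> real" where
  "grid_time j = real (column_number j) / real CARD('n)"

lemma grid_time_bounds: "0 \<le> grid_time j" "grid_time j \<le> 1"
  using column_number_bounds[of j] by (auto simp: grid_time_def)

lemma grid_values_eq: "grid_values W \<omega> = (\<chi> j. W (grid_time j) \<omega>)"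
  by (simp add: grid_values_def grid_time_def)

text \<open>The regression coefficients of the grid values on the increment \<open>W t - W s\<close>.\<close>

definition bridge_shift :: "real \<Rightarrow> real \<Rightarrow> real ^ 'd \<Rightarrow> (real ^ 'd) ^ 'n::{finite,linorder}" where
  "bridge_shift s t z = (\<chi> j. (overlap s t (grid_time j) / (t - s)) *\<^sub>R z)"

lemma continuous_bridge_shift [continuous_intros]:
  "continuous F g \<Longrightarrow> continuous F (\<lambda>x. bridge_shift s t (g x))"
  unfolding bridge_shift_def continuous_def by (rule vec_tendstoI) (simp add: tendsto_scaleR)

lemma borel_measurable_bridge_shift [measurable (raw)]:
  assumes [measurable]: "f \<in> borel_measurable M" "g \<in> borel_measurable M" "h \<in> borel_measurable M"
  shows "(\<lambda>x. bridge_shift (f x) (g x) (h x)) \<in> borel_measurable M"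
  unfolding bridge_shift_def by measurable

text \<open>The shift is the vector of regression coefficients tensored with \<open>z\<close>, so
  its squared norm is a sum of squared overlaps over (t-s)^2 times |z|^2, and
  \<open>sum_overlap_sq_le\<close> applies.\<close>

lemma norm_bridge_shift_sq_le:
  fixes z :: "real ^ 'd"
  assumes st: "0 \<le> s" "s < t" "t \<le> 1" and n: "n = CARD('n::{finite,linorder})"
  shows "2 * real n * (1 - cos (pi / (2 * real n + 1))) * (norm (bridge_shift s t z :: (real ^ 'd) ^ 'n::{finite,linorder}))\<^sup>2 \<le>
    (t - s - sigma_sq n s t) / (t - s)\<^sup>2 * (norm z)\<^sup>2"
proof -
  have "(norm (bridge_shift s t z :: (real ^ 'd) ^ 'n::{finite,linorder}))\<^sup>2 = (\<Sum>j\<in>(UNIV::'n::{finite,linorder} set). (overlap s t (grid_time j) / (t - s))\<^sup>2 * (norm z)\<^sup>2)"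
    unfolding norm_vec_def[of "bridge_shift s t z"] L2_set_def
    by (subst real_sqrt_pow2) (auto simp: bridge_shift_def sum_nonneg power_mult_distrib power_divide)
  also have "\<dots> = (\<Sum>j\<in>(UNIV::'n::{finite,linorder} set). (overlap s t (grid_time j))\<^sup>2) / (t - s)\<^sup>2 * (norm z)\<^sup>2"
    by (simp add: sum_distrib_right sum_divide_distrib power_divide)
  also have "(\<Sum>j\<in>(UNIV::'n::{finite,linorder} set). (overlap s t (grid_time j))\<^sup>2) = (\<Sum>k=1..n. (overlap s t (real k / real n))\<^sup>2)"
    unfolding grid_time_def n by (rule sum.reindex_bij_betw[OF bij_betw_column_number])
  finally have "2 * real n * (1 - cos (pi / (2 * real n + 1))) * (norm (bridge_shift s t z :: (real ^ 'd) ^ 'n::{finite,linorder}))\<^sup>2 =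
    (2 * real n * (1 - cos (pi / (2 * real n + 1))) * (\<Sum>k=1..n. (overlap s t (real k / real n))\<^sup>2)) / (t - s)\<^sup>2 * (norm z)\<^sup>2"
    by simp
  also have "\<dots> \<le> (t - s - sigma_sq n s t) / (t - s)\<^sup>2 * (norm z)\<^sup>2"
    using st by (intro mult_right_mono divide_right_mono sum_overlap_sq_le) (auto simp: n Suc_le_eq)
  finally show ?thesis .
qed

context brownian_motion begin

lemma measurable_grid_time [measurable]: "W (grid_time j) \<in> borel_measurable M"
  using grid_time_bounds by (intro measurable) auto

lemma borel_measurable_grid_values [measurable]: "grid_values W \<in> borel_measurable M"
  unfolding grid_values_eq[abs_def] by measurable

lemma nn_integral_grid_bridge:
  fixes G :: "(real ^ 'd) ^ 'n::{finite,linorder} \<Rightarrow> real ^ 'd \<Rightarrow> ennreal"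
  assumes st: "0 \<le> s" "s < t" "t \<le> 1"
    and G: "(\<lambda>(x, v). G x v) \<in> borel_measurable (borel \<Otimes>\<^sub>M borel)"
  shows "(\<integral>\<^sup>+\<omega>. G (grid_values W \<omega>) (W t \<omega> - W s \<omega>) \<partial>M) =
    (\<integral>\<^sup>+\<omega>. \<integral>\<^sup>+y. ennreal (heat_kernel (t - s) y) *
      G (grid_values W \<omega> + bridge_shift s t (y - (W t \<omega> - W s \<omega>))) y \<partial>lborel \<partial>M)"
proof -
  define Q where "Q = insert s (insert t (range (grid_time :: 'n::{finite,linorder} \<Rightarrow> real)))"
  have Q: "finite Q" "Q \<subseteq> {0..1}" "s \<in> Q" "t \<in> Q" "\<And>j::'n::{finite,linorder}. grid_time j \<in> Q"
    using st grid_time_bounds by (auto simp: Q_def)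
  define H where "H x = G (\<chi> j. x (grid_time j)) (x t - x s)" for x :: "real \<Rightarrow> real ^ 'd"
  have [measurable]: "(\<lambda>x. x q) \<in> borel_measurable (PiM Q (\<lambda>_. borel))" if "q \<in> Q" for q :: real
    using that by (rule measurable_component_singleton)
  have H: "H \<in> borel_measurable (PiM Q (\<lambda>_. borel))"
  proof -
    have "(\<lambda>x. (\<chi> j::'n::{finite,linorder}. x (grid_time j), x t - x s :: real ^ 'd)) \<in> measurable (PiM Q (\<lambda>_. borel)) (borel \<Otimes>\<^sub>M borel)"
      using Q by measurable
    from measurable_compose[OF this G] show ?thesis by (simp add: H_def[abs_def])
  qed
  \<comment> \<open>These two values say that the modified path has increment exactly
    \<open>y\<close> over [s,t], which is why the second argument of \<open>G\<close> turns into
    \<open>y\<close>.\<close>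
  have ov: "overlap s t t = t - s" "overlap s t s = 0" using st by (auto simp: overlap_def)
  have "(\<integral>\<^sup>+\<omega>. H (\<lambda>q\<in>Q. W q \<omega>) \<partial>M) = (\<integral>\<^sup>+\<omega>. \<integral>\<^sup>+y. ennreal (heat_kernel (t - s) y) *
      H (\<lambda>q\<in>Q. W q \<omega> + (overlap s t q / (t - s)) *\<^sub>R (y - (W t \<omega> - W s \<omega>))) \<partial>lborel \<partial>M)"
    by (rule nn_integral_bridge) (use Q st H in auto)
  also have "(\<lambda>\<omega>. H (\<lambda>q\<in>Q. W q \<omega>)) = (\<lambda>\<omega>. G (grid_values W \<omega>) (W t \<omega> - W s \<omega>))"
    using Q by (simp add: H_def grid_values_eq)
  also have "(\<lambda>\<omega> y. H (\<lambda>q\<in>Q. W q \<omega> + (overlap s t q / (t - s)) *\<^sub>R (y - (W t \<omega> - W s \<omega>)))) =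
    (\<lambda>\<omega> y. G (grid_values W \<omega> + bridge_shift s t (y - (W t \<omega> - W s \<omega>))) y)"
  proof (intro ext)
    fix \<omega> y
    have "W t \<omega> + (overlap s t t / (t - s)) *\<^sub>R (y - (W t \<omega> - W s \<omega>)) - (W s \<omega> + (overlap s t s / (t - s)) *\<^sub>R (y - (W t \<omega> - W s \<omega>))) = y"
      using st by (simp add: ov)
    moreover have "(\<chi> j. W (grid_time j) \<omega> + (overlap s t (grid_time j) / (t - s)) *\<^sub>R (y - (W t \<omega> - W s \<omega>))) =
      (grid_values W \<omega> + bridge_shift s t (y - (W t \<omega> - W s \<omega>)) :: (real ^ 'd) ^ 'n::{finite,linorder})"
      by (simp add: grid_values_eq bridge_shift_def vec_eq_iff)
    ultimately show "H (\<lambda>q\<in>Q. W q \<omega> + (overlap s t q / (t - s)) *\<^sub>R (y - (W t \<omega> - W s \<omega>))) =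
       G (grid_values W \<omega> + bridge_shift s t (y - (W t \<omega> - W s \<omega>))) y"
      using Q by (simp only: H_def restrict_apply if_True)
  qed
  finally show ?thesis .
qed

text \<open>Joint measurability comes from path continuity: the clamped time is rounded down to a
  multiple of 1/(m+1), which takes countably many values, and then \<open>m\<close> tends to
  infinity. Clamping is needed because nothing is known about \<open>W\<close> outside
  [0,1].\<close>

lemma borel_measurable_clamped_path:
  "(\<lambda>(t, \<omega>). W (max 0 (min 1 t)) \<omega>) \<in> borel_measurable (borel \<Otimes>\<^sub>M M)"
proof (rule borel_measurable_LIMSEQ_metric)
  define r where "r m t = real (nat \<lfloor>real (Suc m) * max 0 (min 1 t)\<rfloor>) / real (Suc m)" for m and t :: real
  have r: "0 \<le> r m t" "r m t \<le> 1" "\<bar>r m t - max 0 (min 1 t)\<bar> \<le> 1 / real (Suc m)" for m t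
  proof -
    define c where "c = max 0 (min 1 t)"
    have c: "0 \<le> c" "c \<le> 1" by (auto simp: c_def)
    have a: "0 \<le> real (Suc m) * c" "real (Suc m) * c \<le> real (Suc m)" using c by (auto intro: mult_left_le)
    have eq: "real (nat \<lfloor>real (Suc m) * c\<rfloor>) = of_int \<lfloor>real (Suc m) * c\<rfloor>" using a by simp
    show "0 \<le> r m t" by (simp add: r_def)
    have "of_int \<lfloor>real (Suc m) * c\<rfloor> \<le> real (Suc m)" using a by linarith
    then show "r m t \<le> 1" unfolding r_def c_def[symmetric] eq by (simp add: divide_le_eq)
    have "\<bar>real_of_int \<lfloor>real (Suc m) * c\<rfloor> - real (Suc m) * c\<bar> \<le> 1" by linarith
    moreover have "r m t - c = (real_of_int \<lfloor>real (Suc m) * c\<rfloor> - real (Suc m) * c) / real (Suc m)"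
      unfolding r_def c_def[symmetric] eq by (simp add: field_simps)
    ultimately show "\<bar>r m t - max 0 (min 1 t)\<bar> \<le> 1 / real (Suc m)"
      unfolding c_def[symmetric] by (simp add: abs_divide divide_right_mono)
  qed
  show "(\<lambda>(t, \<omega>). W (r m t) \<omega>) \<in> borel_measurable (borel \<Otimes>\<^sub>M M)" for m
  proof -
    have m: "(\<lambda>x. W (max 0 (min 1 (real k / real (Suc m)))) (snd x)) \<in> borel_measurable (borel \<Otimes>\<^sub>M M)" for k :: nat
      by (rule measurable_compose[OF measurable_snd measurable]) auto
    have g: "(\<lambda>x. nat \<lfloor>real (Suc m) * max 0 (min 1 (fst x))\<rfloor>) \<in> measurable (borel \<Otimes>\<^sub>M M) (count_space UNIV)"
      by measurable
    have "r m t = max 0 (min 1 (real (nat \<lfloor>real (Suc m) * max 0 (min 1 t)\<rfloor>) / real (Suc m)))" for t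
      using r(1,2)[of m t] unfolding r_def by (simp only: max_def min_def) auto
    then show ?thesis using measurable_compose_countable[OF m g] by (simp only: case_prod_beta')
  qed
  show "(\<lambda>m. case x of (t, \<omega>) \<Rightarrow> W (r m t) \<omega>) \<longlonglongrightarrow> (case x of (t, \<omega>) \<Rightarrow> W (max 0 (min 1 t)) \<omega>)"
    if x_in: "x \<in> space (borel \<Otimes>\<^sub>M M)" for x
  proof -
    obtain t \<omega> where x: "x = (t, \<omega>)" "\<omega> \<in> space M" using x_in by (auto simp: space_pair_measure)
    have "(\<lambda>m. r m t - max 0 (min 1 t)) \<longlonglongrightarrow> 0"
      using r(3) by (intro Lim_null_comparison[OF _ LIMSEQ_Suc[OF lim_1_over_n]]) auto
    then have "(\<lambda>m. r m t) \<longlonglongrightarrow> max 0 (min 1 t)" by (rule LIM_zero_cancel)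
    from continuous_on_tendsto_compose[OF continuous_paths[OF x(2)] this]
    show ?thesis using r(1,2)[of _ t] by (simp add: x)
  qed
qed

end

section \<open>The time simplex\<close>

lemma Delta2_eq: "Delta2 = {p. 0 \<le> fst p \<and> fst p < snd p \<and> snd p \<le> 1}"
  by (auto simp: Delta2_def)

lemma sets_Delta2 [measurable]: "Delta2 \<in> sets borel" "Delta2 \<in> sets (borel \<Otimes>\<^sub>M borel)"
proof -
  have "Delta2 = {p \<in> space (borel \<Otimes>\<^sub>M borel). 0 \<le> fst p \<and> fst p < snd p \<and> snd p \<le> 1}"
    by (auto simp: Delta2_eq space_pair_measure)
  also have "\<dots> \<in> sets (borel \<Otimes>\<^sub>M borel)" by measurable
  finally show "Delta2 \<in> sets (borel \<Otimes>\<^sub>M borel)" .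
  then show "Delta2 \<in> sets borel" by (simp only: borel_prod)
qed

lemma nn_integral_lborel_pair_swap:
  fixes f :: "real \<times> real \<Rightarrow> ennreal"
  assumes [measurable]: "f \<in> borel_measurable borel"
  shows "(\<integral>\<^sup>+p. f p \<partial>lborel) = (\<integral>\<^sup>+t. \<integral>\<^sup>+s. f (s, t) \<partial>lborel \<partial>lborel)"
proof -
  have "f \<in> borel_measurable (lborel \<Otimes>\<^sub>M lborel)" using assms by (simp add: lborel_prod)
  then have "(\<integral>\<^sup>+t. \<integral>\<^sup>+s. f (s, t) \<partial>lborel \<partial>lborel) = integral\<^sup>N (lborel \<Otimes>\<^sub>M lborel) f"
    by (rule lborel_pair.nn_integral_snd)
  then show ?thesis by (simp only: lborel_prod)
qed

text \<open>This area is the origin of the factor 2 in \<open>2 * mass u\<close>: the uniform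
  probability density on the simplex is 2.\<close>

lemma emeasure_Delta2: "emeasure lborel Delta2 = ennreal (1 / 2)"
proof -
  have "emeasure lborel Delta2 = (\<integral>\<^sup>+p. indicator Delta2 p \<partial>lborel)" by simp
  also have "\<dots> = (\<integral>\<^sup>+t. \<integral>\<^sup>+s. indicator Delta2 (s, t) \<partial>lborel \<partial>lborel)"
    by (rule nn_integral_lborel_pair_swap) simp
  also have "\<dots> = (\<integral>\<^sup>+t. ennreal t * indicator {0..1} t \<partial>lborel)"
  proof (rule nn_integral_cong)
    fix t :: real
    have "(\<integral>\<^sup>+s. indicator Delta2 (s, t) \<partial>lborel) = (\<integral>\<^sup>+s. indicator {0..1} t * indicator {0..<t} s \<partial>lborel)"
      by (intro nn_integral_cong) (auto simp: Delta2_def indicator_def)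
    also have "\<dots> = ennreal t * indicator {0..1} t"
      by (subst nn_integral_cmult) (auto simp: indicator_def)
    finally show "(\<integral>\<^sup>+s. indicator Delta2 (s, t) \<partial>lborel) = ennreal t * indicator {0..1} t" .
  qed
  also have "\<dots> = ennreal (1\<^sup>2 / 2 - 0\<^sup>2 / 2)"
    by (rule nn_integral_FTC_Icc) (auto intro!: derivative_eq_intros)
  finally show ?thesis by simp
qed

lemma measure_Delta2: "measure lborel Delta2 = 1 / 2"
  unfolding measure_def emeasure_Delta2 by (rule enn2real_ennreal) simp

lemma emeasure_Delta2_finite [simp]: "emeasure lborel Delta2 < top"
  unfolding emeasure_Delta2 by (rule ennreal_less_top)

lemma integrable_Delta2_bounded:
  fixes f :: "real \<times> real \<Rightarrow> real"
  assumes [measurable]: "f \<in> borel_measurable borel"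
    and bound: "\<And>p. p \<in> Delta2 \<Longrightarrow> \<bar>f p\<bar> \<le> C"
  shows "integrable lborel (\<lambda>p. indicator Delta2 p * f p)"
proof (rule Bochner_Integration.integrable_bound)
  show "integrable lborel (\<lambda>p. C * indicator Delta2 p)"
    by (intro integrable_mult_right) (simp add: integrable_indicator_iff)
  show "AE p in lborel. norm (indicator Delta2 p * f p) \<le> norm (C * indicator Delta2 p)"
    using bound by (intro AE_I2) (force simp: indicator_def)
qed measurable

section \<open>Bridge means and the limit of the smoothed pairings\<close>

context brownian_motion begin

lemma measurable_path [measurable (raw)]: "0 \<le> t \<Longrightarrow> t \<le> 1 \<Longrightarrow> W t \<in> borel_measurable M"
  by (rule measurable) auto

text \<open>An extension of the increment to all pairs of times, so that measurability can be stated
  on the whole product space; on \<open>Delta2\<close> it is the true increment.\<close>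

definition clamped_increment :: "real \<times> real \<Rightarrow> 'a \<Rightarrow> real ^ 'd" where
  "clamped_increment p \<omega> = W (max 0 (min 1 (snd p))) \<omega> - W (max 0 (min 1 (fst p))) \<omega>"

lemma clamped_increment_eq: "p \<in> Delta2 \<Longrightarrow> clamped_increment p \<omega> = W (snd p) \<omega> - W (fst p) \<omega>"
  by (auto simp: clamped_increment_def Delta2_def max_def min_def)

lemma borel_measurable_clamped_increment [measurable]:
  "(\<lambda>x. clamped_increment (fst x) (snd x)) \<in> borel_measurable (lborel \<Otimes>\<^sub>M M)"
proof -
  have [measurable]: "fst \<in> borel_measurable (lborel :: (real \<times> real) measure)" "snd \<in> borel_measurable (lborel :: (real \<times> real) measure)"
    by (simp_all flip: borel_prod)
  have 1: "(\<lambda>x. W (max 0 (min 1 (g (fst x)))) (snd x)) \<in> borel_measurable (lborel \<Otimes>\<^sub>M M)"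
    if [measurable]: "g \<in> borel_measurable lborel" for g :: "real \<times> real \<Rightarrow> real"
  proof -
    have "(\<lambda>x. (g (fst x), snd x)) \<in> measurable (lborel \<Otimes>\<^sub>M M) (borel \<Otimes>\<^sub>M M)" by measurable
    from measurable_compose[OF this borel_measurable_clamped_path] show ?thesis by simp
  qed
  show ?thesis unfolding clamped_increment_def by (intro borel_measurable_diff 1) auto
qed

text \<open>The version of the conditional expectation of f(W(1/n), ..., W(1)) given
  \<open>W t - W s = y\<close> that is supplied by the bridge decomposition. Its explicit form is
  defined for every \<open>y\<close> and, for the test functions used here, continuous in
  \<open>y\<close>, so it may be evaluated at \<open>u\<close>.\<close>

definition bridge_mean :: "((real ^ 'd) ^ 'n::{finite,linorder} \<Rightarrow> real) \<Rightarrow> real \<Rightarrow> real \<Rightarrow> real ^ 'd \<Rightarrow> real" where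
  "bridge_mean f s t y = (\<integral>\<omega>. f (grid_values W \<omega> + bridge_shift s t (y - (W t \<omega> - W s \<omega>))) \<partial>M)"

context
  fixes f :: "(real ^ 'd) ^ 'n::{finite,linorder} \<Rightarrow> real"
  assumes f: "f \<in> Cb_infinity" and f01: "\<And>x. 0 \<le> f x \<and> f x \<le> 1"
begin

lemma measurable_test_function [measurable]: "f \<in> borel_measurable borel"
  by (rule borel_measurable_Cb_infinity[OF f])

lemma bridge_mean_bounds:
  assumes st: "0 \<le> s" "s < t" "t \<le> 1"
   
  shows "0 \<le> bridge_mean f s t y" "bridge_mean f s t y \<le> 1"
    and "(\<integral>\<^sup>+\<omega>. ennreal (f (grid_values W \<omega> + bridge_shift s t (y - (W t \<omega> - W s \<omega>)))) \<partial>M) = ennreal (bridge_mean f s t y)"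
proof -
  let ?X = "\<lambda>\<omega> y. grid_values W \<omega> + bridge_shift s t (y - (W t \<omega> - W s \<omega>)) :: (real ^ 'd) ^ 'n::{finite,linorder}"
  have [measurable]: "W s \<in> borel_measurable M" "W t \<in> borel_measurable M" using st by auto
  have int: "integrable M (\<lambda>\<omega>. f (?X \<omega> y))"
    by (rule integrable_const_bound[where B=1]) (use f01 in auto)
  show "0 \<le> bridge_mean f s t y" unfolding bridge_mean_def using f01 by simp
  have "bridge_mean f s t y \<le> (\<integral>\<omega>. 1 \<partial>M)"
    unfolding bridge_mean_def using f01 int by (intro integral_mono) auto
  then show "bridge_mean f s t y \<le> 1" by (simp add: prob_space)
  show "(\<integral>\<^sup>+\<omega>. ennreal (f (?X \<omega> y)) \<partial>M) = ennreal (bridge_mean f s t y)"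
    unfolding bridge_mean_def using f01 by (intro nn_integral_eq_integral int) auto
qed

lemma isCont_bridge_mean:
  assumes st: "0 \<le> s" "s < t" "t \<le> 1"
   
  shows "isCont (bridge_mean f s t) y" unfolding continuous_at_sequentially o_def
proof (intro allI impI)
  let ?X = "\<lambda>\<omega> y. grid_values W \<omega> + bridge_shift s t (y - (W t \<omega> - W s \<omega>)) :: (real ^ 'd) ^ 'n::{finite,linorder}"
  fix z assume z: "z \<longlonglongrightarrow> y"
  have [measurable]: "W s \<in> borel_measurable M" "W t \<in> borel_measurable M" using st by auto
  show "(\<lambda>m. bridge_mean f s t (z m)) \<longlonglongrightarrow> bridge_mean f s t y" unfolding bridge_mean_def
  proof (rule integral_dominated_convergence[where w="\<lambda>_. 1"])
    show "AE \<omega> in M. (\<lambda>m. f (?X \<omega> (z m))) \<longlonglongrightarrow>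
        f (?X \<omega> y)"
    proof (rule AE_I2)
      fix \<omega>
      have "isCont (?X \<omega>) y" by (intro continuous_intros)
      from isCont_tendsto_compose[OF this z]
      have "(\<lambda>m. ?X \<omega> (z m)) \<longlonglongrightarrow>
        (?X \<omega> y)" .
      moreover have "isCont f x" for x
        using continuous_on_Cb_infinity[OF f] by (simp add: continuous_on_eq_continuous_at)
      ultimately show "(\<lambda>m. f (?X \<omega> (z m))) \<longlonglongrightarrow>
        f (?X \<omega> y)" by (rule isCont_tendsto_compose[rotated])
    qed
  qed (use f01 in auto)
qed

lemma borel_measurable_bridge_mean:
  assumes "0 \<le> s" "s < t" "t \<le> 1"
  shows "bridge_mean f s t \<in> borel_measurable borel"
  by (intro borel_measurable_continuous_onI continuous_at_imp_continuous_on ballI isCont_bridge_mean assms)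

text \<open>In the bridge formula the increment becomes the integration variable \<open>y\<close>,
  so the smoothing kernel no longer depends on the path; the remaining expectation over paths is the
  bridge mean.\<close>

lemma integral_grid_increment:
  assumes st: "0 \<le> s" "s < t" "t \<le> 1" and \<epsilon>: "0 < \<epsilon>"
   
  shows "(\<integral>\<omega>. f (grid_values W \<omega>) * heat_kernel \<epsilon> (W t \<omega> - W s \<omega> - u) \<partial>M) =
    (\<integral>y. heat_kernel \<epsilon> (y - u) * (heat_kernel (t - s) y * bridge_mean f s t y) \<partial>lborel)"
proof -
  have [measurable]: "W s \<in> borel_measurable M" "W t \<in> borel_measurable M" using st by auto
  have [measurable]: "bridge_mean f s t \<in> borel_measurable borel" by (rule borel_measurable_bridge_mean) fact+
  let ?X = "\<lambda>\<omega> y. grid_values W \<omega> + bridge_shift s t (y - (W t \<omega> - W s \<omega>)) :: (real ^ 'd) ^ 'n::{finite,linorder}"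
  have "(\<integral>\<^sup>+\<omega>. ennreal (f (grid_values W \<omega>) * heat_kernel \<epsilon> (W t \<omega> - W s \<omega> - u)) \<partial>M) =
    (\<integral>\<^sup>+\<omega>. \<integral>\<^sup>+y. ennreal (heat_kernel (t - s) y) * ennreal (f (?X \<omega> y) * heat_kernel \<epsilon> (y - u)) \<partial>lborel \<partial>M)"
    by (rule nn_integral_grid_bridge[OF st, of "\<lambda>x v. ennreal (f x * heat_kernel \<epsilon> (v - u))"]) measurable
  also have "\<dots> = (\<integral>\<^sup>+y. \<integral>\<^sup>+\<omega>. ennreal (heat_kernel (t - s) y) * ennreal (f (?X \<omega> y) * heat_kernel \<epsilon> (y - u)) \<partial>M \<partial>lborel)"
  proof -
    interpret pair_sigma_finite M "lborel :: (real ^ 'd) measure" ..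
    show ?thesis by (rule Fubini'[symmetric]) measurable
  qed
  also have "\<dots> = (\<integral>\<^sup>+y. ennreal (heat_kernel \<epsilon> (y - u) * (heat_kernel (t - s) y * bridge_mean f s t y)) \<partial>lborel)"
  proof (rule nn_integral_cong)
    fix y
    have "(\<integral>\<^sup>+\<omega>. ennreal (heat_kernel (t - s) y) * ennreal (f (?X \<omega> y) * heat_kernel \<epsilon> (y - u)) \<partial>M) =
      (\<integral>\<^sup>+\<omega>. ennreal (heat_kernel (t - s) y * heat_kernel \<epsilon> (y - u)) * ennreal (f (?X \<omega> y)) \<partial>M)"
      using f01 by (intro nn_integral_cong) (simp add: mult_ac flip: ennreal_mult)
    also have "\<dots> = ennreal (heat_kernel (t - s) y * heat_kernel \<epsilon> (y - u)) * ennreal (bridge_mean f s t y)"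
      by (subst nn_integral_cmult) (auto simp: bridge_mean_bounds[OF st])
    finally show "(\<integral>\<^sup>+\<omega>. ennreal (heat_kernel (t - s) y) * ennreal (f (?X \<omega> y) * heat_kernel \<epsilon> (y - u)) \<partial>M) =
      ennreal (heat_kernel \<epsilon> (y - u) * (heat_kernel (t - s) y * bridge_mean f s t y))"
      using bridge_mean_bounds[OF st] by (simp add: mult_ac flip: ennreal_mult)
  qed
  finally have *: "(\<integral>\<^sup>+\<omega>. ennreal (f (grid_values W \<omega>) * heat_kernel \<epsilon> (W t \<omega> - W s \<omega> - u)) \<partial>M) =
    (\<integral>\<^sup>+y. ennreal (heat_kernel \<epsilon> (y - u) * (heat_kernel (t - s) y * bridge_mean f s t y)) \<partial>lborel)" .
  show ?thesis using f01 bridge_mean_bounds[OF st]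
    by (subst (1 2) integral_eq_nn_integral) (auto simp: *)
qed

lemma integral_grid_increment_tendsto:
  assumes st: "0 \<le> s" "s < t" "t \<le> 1" and pos: "\<And>m. 0 < \<epsilon> m" and lim: "\<epsilon> \<longlonglongrightarrow> 0"
   
  shows "(\<lambda>m. \<integral>\<omega>. f (grid_values W \<omega>) * heat_kernel (\<epsilon> m) (W t \<omega> - W s \<omega> - u) \<partial>M) \<longlonglongrightarrow>
    heat_kernel (t - s) u * bridge_mean f s t u" unfolding integral_grid_increment[OF st pos]
proof (rule heat_kernel_approximate_identity[OF _ _ _ pos lim])
  have [measurable]: "bridge_mean f s t \<in> borel_measurable borel" by (rule borel_measurable_bridge_mean) fact+
  show "(\<lambda>y. heat_kernel (t - s) y * bridge_mean f s t y) \<in> borel_measurable borel" by measurable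
  show "\<bar>heat_kernel (t - s) y * bridge_mean f s t y\<bar> \<le> (2 * pi * (t - s)) powr (- real DIM(real ^ 'd) / 2) * 1" for y
    unfolding abs_mult using st bridge_mean_bounds[OF st, of y]
    by (intro mult_mono) (simp_all only: abs_of_nonneg heat_kernel_nonneg heat_kernel_le diff_gt_0_iff_gt powr_ge_zero)
  show "isCont (\<lambda>y. heat_kernel (t - s) y * bridge_mean f s t y) u"
    unfolding heat_kernel_def using st by (intro continuous_intros isCont_bridge_mean) auto
qed

text \<open>Because the vectors \<open>y\<close> and \<open>y - u\<close> differ by
  \<open>u\<close>, one of them has norm at least |u|/2, so one of the two heat kernels is at most
  \<open>K\<close> while the other integrates to 1. The bound is uniform in \<epsilon> and in (s,t),
  even as \<open>s\<close> approaches \<open>t\<close>, and serves as the dominating function on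
  \<open>Delta2\<close>.\<close>

lemma integral_grid_increment_bound:
  assumes st: "0 \<le> s" "s < t" "t \<le> 1" and \<epsilon>: "0 < \<epsilon>"
   
    and K: "\<And>\<epsilon> z. 0 < \<epsilon> \<Longrightarrow> norm u / 2 \<le> norm z \<Longrightarrow> heat_kernel \<epsilon> (z :: real ^ 'd) \<le> K" and "u \<noteq> 0"
  shows "\<bar>\<integral>\<omega>. f (grid_values W \<omega>) * heat_kernel \<epsilon> (W t \<omega> - W s \<omega> - u) \<partial>M\<bar> \<le> 2 * K"
proof -
  have K0: "0 \<le> K" using K[of 1 u] heat_kernel_nonneg[of 1 u] by (simp del: heat_kernel_nonneg)
  note p = integrable_heat_kernel[where 'v="real ^ 'd"]
  have int: "integrable lborel (\<lambda>y. heat_kernel \<epsilon> (y - u))" "(\<integral>y. heat_kernel \<epsilon> (y - u) \<partial>lborel) = 1"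
      using p[OF \<epsilon>] integral_lborel_translate[of "heat_kernel \<epsilon> :: real ^ 'd \<Rightarrow> real" u] by auto
  have int2: "integrable lborel (heat_kernel (t - s) :: real ^ 'd \<Rightarrow> real)" "(\<integral>y. heat_kernel (t - s) (y :: real ^ 'd) \<partial>lborel) = 1"
    using p[of "t - s"] st by auto
  have nonneg: "0 \<le> (\<integral>\<omega>. f (grid_values W \<omega>) * heat_kernel \<epsilon> (W t \<omega> - W s \<omega> - u) \<partial>M)"
    using f01 by (intro integral_nonneg_AE) auto
  have "(\<integral>\<omega>. f (grid_values W \<omega>) * heat_kernel \<epsilon> (W t \<omega> - W s \<omega> - u) \<partial>M) \<le>
      (\<integral>y. K * heat_kernel \<epsilon> (y - u) + K * heat_kernel (t - s) y \<partial>lborel)"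
    unfolding integral_grid_increment[OF st \<epsilon>]
  proof (rule integral_mono_AE')
    show "integrable lborel (\<lambda>y. K * heat_kernel \<epsilon> (y - u) + K * heat_kernel (t - s) y)"
      using int int2 by auto
    show "AE y in lborel. heat_kernel \<epsilon> (y - u) * (heat_kernel (t - s) y * bridge_mean f s t y) \<le>
        K * heat_kernel \<epsilon> (y - u) + K * heat_kernel (t - s) y"
    proof (rule AE_I2)
      fix y :: "real ^ 'd"
      have "heat_kernel \<epsilon> (y - u) * (heat_kernel (t - s) y * bridge_mean f s t y) \<le> heat_kernel \<epsilon> (y - u) * heat_kernel (t - s) y"
        using bridge_mean_bounds[OF st, of y] by (intro mult_left_mono mult_left_le) auto
      also have "\<dots> \<le> K * heat_kernel \<epsilon> (y - u) + K * heat_kernel (t - s) y"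
      proof (cases "norm u / 2 \<le> norm y")
        case True
        then have "heat_kernel \<epsilon> (y - u) * heat_kernel (t - s) y \<le> heat_kernel \<epsilon> (y - u) * K"
          using st by (intro mult_left_mono K) auto
        then show ?thesis using K0 by (simp add: mult.commute add_increasing2)
      next
        case False
        have "norm u \<le> norm (y - u) + norm y" using norm_triangle_ineq4[of y "y - u"] by (simp add: add.commute)
        then have "norm u / 2 \<le> norm (y - u)" using False by simp
        then have "heat_kernel \<epsilon> (y - u) * heat_kernel (t - s) y \<le> K * heat_kernel (t - s) y"
          using \<epsilon> by (intro mult_right_mono K) auto
        then show ?thesis using K0 by (simp add: add_increasing)
      qed
      finally show "heat_kernel \<epsilon> (y - u) * (heat_kernel (t - s) y * bridge_mean f s t y) \<le>
        K * heat_kernel \<epsilon> (y - u) + K * heat_kernel (t - s) y" .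
    qed
  qed (use bridge_mean_bounds[OF st] K0 in auto)
  also have "\<dots> = 2 * K" using int int2 by (subst Bochner_Integration.integral_add) auto
  finally show ?thesis using nonneg by simp
qed

lemma integral_rho2_approx:
  assumes \<epsilon>: "0 < \<epsilon>"
  shows "(\<integral>\<omega>. f (grid_values W \<omega>) * rho2_approx W u \<epsilon> \<omega> \<partial>M) =
    (\<integral>p. indicator Delta2 p * (\<integral>\<omega>. f (grid_values W \<omega>) * heat_kernel \<epsilon> (clamped_increment p \<omega> - u) \<partial>M) \<partial>lborel)"
proof -
  have D: "emeasure (lborel \<Otimes>\<^sub>M M) (Delta2 \<times> space M) = emeasure lborel Delta2"
    using emeasure_pair_measure_Times[of Delta2 lborel "space M"] by (simp add: emeasure_space_1)
  interpret pair_sigma_finite "lborel :: (real \<times> real) measure" M ..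
  let ?g = "\<lambda>(p, \<omega>). indicator Delta2 p * (f (grid_values W \<omega>) * heat_kernel \<epsilon> (clamped_increment p \<omega> - u)) :: real"
  define C where "C = (2 * pi * \<epsilon>) powr (- real DIM(real ^ 'd) / 2)"
  have int: "integrable (lborel \<Otimes>\<^sub>M M) ?g"
  proof (rule Bochner_Integration.integrable_bound)
    have "integrable (lborel \<Otimes>\<^sub>M M) (indicator (Delta2 \<times> space M) :: _ \<Rightarrow> real)"
      by (simp add: integrable_indicator_iff D)
    then show "integrable (lborel \<Otimes>\<^sub>M M) (\<lambda>x. C * indicator (Delta2 \<times> space M) x)" by simp
    show "?g \<in> borel_measurable (lborel \<Otimes>\<^sub>M M)" unfolding case_prod_beta' by measurable
    show "AE x in lborel \<Otimes>\<^sub>M M. norm (?g x) \<le> norm (C * indicator (Delta2 \<times> space M) x)"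
    proof (rule AE_I2)
      fix x :: "(real \<times> real) \<times> 'a" assume "x \<in> space (lborel \<Otimes>\<^sub>M M)"
      then obtain p \<omega> where x: "x = (p, \<omega>)" "\<omega> \<in> space M" by (auto simp: space_pair_measure)
      have "f (grid_values W \<omega>) * heat_kernel \<epsilon> (clamped_increment p \<omega> - u) \<le> 1 * C"
        using f01 heat_kernel_le[OF \<epsilon>, of "clamped_increment p \<omega> - u"] unfolding C_def by (intro mult_mono) auto
      then show "norm (?g x) \<le> norm (C * indicator (Delta2 \<times> space M) x)"
        using f01 x by (auto simp: C_def indicator_def abs_mult)
    qed
  qed
  have "(\<integral>\<omega>. f (grid_values W \<omega>) * rho2_approx W u \<epsilon> \<omega> \<partial>M) = (\<integral>\<omega>. \<integral>p. ?g (p, \<omega>) \<partial>lborel \<partial>M)"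
  proof (rule Bochner_Integration.integral_cong[OF refl])
    fix \<omega>
    have "f (grid_values W \<omega>) * rho2_approx W u \<epsilon> \<omega> =
      (\<integral>p. f (grid_values W \<omega>) * (indicator Delta2 p *\<^sub>R (case p of (s, t) \<Rightarrow> heat_kernel \<epsilon> (W t \<omega> - W s \<omega> - u))) \<partial>lborel)"
      unfolding rho2_approx_def set_lebesgue_integral_def by simp
    also have "\<dots> = (\<integral>p. ?g (p, \<omega>) \<partial>lborel)"
      by (intro Bochner_Integration.integral_cong[OF refl]) (auto simp: indicator_def clamped_increment_eq split: prod.splits)
    finally show "f (grid_values W \<omega>) * rho2_approx W u \<epsilon> \<omega> = (\<integral>p. ?g (p, \<omega>) \<partial>lborel)" .
  qed
  also have "\<dots> = (\<integral>p. \<integral>\<omega>. ?g (p, \<omega>) \<partial>M \<partial>lborel)" using int by (intro Fubini_integral) simp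
  finally show ?thesis by simp
qed

text \<open>The pairings with the smoothed \<rho> converge in two ways: to the pairing with \<rho>,
  by Sobolev duality, and to the integral of bridge means, by dominated convergence on
  \<open>Delta2\<close>. Uniqueness of limits gives the mixture formula.\<close>

lemma theta_integral:
  assumes d: "CARD('d) \<ge> 4" and u: "u \<noteq> 0" and rho: "is_rho2 M W u \<rho>" and theta: "is_theta M W \<rho> \<theta>"
   
  shows "(\<integral>x. f x \<partial>\<theta>) = (\<integral>p. indicator Delta2 p * (heat_kernel (snd p - fst p) u * bridge_mean f (fst p) (snd p) u) \<partial>lborel)"
proof -
  let ?A = "\<lambda>\<epsilon> p. \<integral>\<omega>. f (grid_values W \<omega>) * heat_kernel \<epsilon> (clamped_increment p \<omega> - u) \<partial>M"
  \<comment> \<open>Any index below the critical one with a positive negative would do: convergence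
    of the approximations holds at \<gamma>, and \<open>is_theta\<close> places the expansion of the
    test function in the dual space of index -\<gamma>.\<close>
  define \<gamma> where "\<gamma> = (4 - real CARD('d)) / 2 - 1"
  have \<gamma>: "\<gamma> < (4 - real CARD('d)) / 2" "0 < - \<gamma>" using d by (auto simp: \<gamma>_def)
  define \<epsilon> where "\<epsilon> m = 1 / real (Suc m)" for m
  have pos: "0 < \<epsilon> m" for m by (simp add: \<epsilon>_def)
  have \<epsilon>: "\<epsilon> \<longlonglongrightarrow> 0" unfolding \<epsilon>_def by (rule LIMSEQ_Suc[OF lim_1_over_n])
  obtain \<rho>s where \<rho>s: "\<And>\<epsilon>. 0 < \<epsilon> \<Longrightarrow> ito_wiener_expansion M W (rho2_approx W u \<epsilon>) (\<rho>s \<epsilon>)"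
    and sob: "\<And>\<epsilon>. 0 < \<epsilon> \<Longrightarrow> \<rho>s \<epsilon> \<in> sobolev M W \<gamma>" "\<rho> \<in> sobolev M W \<gamma>"
    and lim: "((\<lambda>\<epsilon>. sobolev_sq_norm M \<gamma> (\<lambda>k \<omega>. \<rho>s \<epsilon> k \<omega> - \<rho> k \<omega>)) \<longlongrightarrow> 0) (at_right 0)"
    using rho \<gamma> unfolding is_rho2_def by blast
  obtain F where F: "ito_wiener_expansion M W (\<lambda>\<omega>. f (grid_values W \<omega>)) F" "F \<in> sobolev M W (- \<gamma>)"
    and \<theta>: "(\<integral>x. f x \<partial>\<theta>) = dual_pairing M F \<rho>" using theta f \<gamma> unfolding is_theta_def by blast
  have "filterlim \<epsilon> (at_right 0) sequentially" using \<epsilon> pos by (intro filterlim_at_withinI) auto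
  then have "(\<lambda>m. dual_pairing M F (\<rho>s (\<epsilon> m))) \<longlonglongrightarrow> dual_pairing M F \<rho>"
    using pos by (intro dual_pairing_tendsto[OF F(2) sob(1,2)] filterlim_compose[OF lim]) auto
  moreover have "dual_pairing M F (\<rho>s (\<epsilon> m)) =
    (\<integral>p. indicator Delta2 p * ?A (\<epsilon> m) p \<partial>lborel)" for m
    using dual_pairing_expansions[OF F(1) \<rho>s[OF pos]] integral_rho2_approx[OF pos] by simp
  moreover have "(\<lambda>m. \<integral>p. indicator Delta2 p * ?A (\<epsilon> m) p \<partial>lborel) \<longlonglongrightarrow>
    (\<integral>p. indicator Delta2 p * (heat_kernel (snd p - fst p) u * bridge_mean f (fst p) (snd p) u) \<partial>lborel)"
  proof -
    have "0 < norm u / 2" using u by simp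
    then obtain K where K: "\<And>\<epsilon> z. 0 < \<epsilon> \<Longrightarrow> norm u / 2 \<le> norm z \<Longrightarrow> heat_kernel \<epsilon> (z :: real ^ 'd) \<le> K"
      by (rule heat_kernel_bound_away_from_0) blast
    have eq: "?A \<epsilon> p =
      (\<integral>\<omega>. f (grid_values W \<omega>) * heat_kernel \<epsilon> (W (snd p) \<omega> - W (fst p) \<omega> - u) \<partial>M)" if "p \<in> Delta2" for p \<epsilon>
      using that by (simp add: clamped_increment_eq)
    have st: "0 \<le> fst p" "fst p < snd p" "snd p \<le> 1" if "p \<in> Delta2" for p using that by (auto simp: Delta2_def)
    have meas [measurable]: "(\<lambda>p. \<integral>\<omega>. f (grid_values W \<omega>) * heat_kernel \<epsilon> (clamped_increment p \<omega> - u) \<partial>M) \<in> borel_measurable lborel" for \<epsilon>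
      by (intro borel_measurable_lebesgue_integral) (simp only: case_prod_beta', measurable)
    have lim: "(\<lambda>m. indicator Delta2 p * ?A (\<epsilon> m) p) \<longlonglongrightarrow>
        indicator Delta2 p * (heat_kernel (snd p - fst p) u * bridge_mean f (fst p) (snd p) u)" for p
      using integral_grid_increment_tendsto[OF st pos \<epsilon>] eq
      by (cases "p \<in> Delta2") (simp_all add: indicator_def)
    show ?thesis
    proof (rule integral_dominated_convergence[where w="\<lambda>p. indicator Delta2 p * (2 * K)"])
      show "(\<lambda>p. indicator Delta2 p * ?A (\<epsilon> m) p) \<in> borel_measurable lborel" for m by measurable
      \<comment> \<open>Measurability in (s,t) of the bridge mean is obtained here from the limit
        itself, as a pointwise limit of measurable functions.\<close>
      show "(\<lambda>p. indicator Delta2 p * (heat_kernel (snd p - fst p) u * bridge_mean f (fst p) (snd p) u)) \<in> borel_measurable lborel"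
        by (rule borel_measurable_LIMSEQ_real[OF lim]) measurable
      show "integrable lborel (\<lambda>p. indicator Delta2 p * (2 * K))" by (rule integrable_Delta2_bounded) auto
      show "AE p in lborel. norm (indicator Delta2 p * ?A (\<epsilon> m) p) \<le>
        indicator Delta2 p * (2 * K)" for m using integral_grid_increment_bound[OF st pos K u] eq
        by (intro AE_I2) (auto simp: indicator_def)
    qed (use lim in auto)
  qed
  ultimately show ?thesis using LIMSEQ_unique \<theta> by auto
qed

end

end

section \<open>Integrability of the logarithm\<close>

text \<open>The integral of the inverse square root over [0,1]; only its finiteness enters, never
  its value.\<close>

definition inv_sqrt_mass :: ennreal where
  "inv_sqrt_mass = (\<integral>\<^sup>+x. indicator {0..1} x * ennreal (x powr (-1/2)) \<partial>lborel)"

lemma inv_sqrt_mass_finite: "inv_sqrt_mass < \<infinity>"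
proof -
  have "(\<lambda>x::real. x powr (-1/2)) absolutely_integrable_on {0..1}"
    by (intro nonnegative_absolutely_integrable_1 integrable_on_powr_from_0) auto
  then have "integrable (completion lborel) (\<lambda>x::real. indicator {0..1} x * x powr (-1/2))"
    by (simp add: set_integrable_def)
  then have "integrable lborel (\<lambda>x::real. indicator {0..1} x * x powr (-1/2))"
    by (subst (asm) integrable_completion) auto
  then have "(\<integral>\<^sup>+x. ennreal (indicator {0..1} x * x powr (-1/2)) \<partial>lborel) < \<infinity>"
    by (subst nn_integral_eq_integral) auto
  also have "(\<integral>\<^sup>+x. ennreal (indicator {0..1} x * x powr (-1/2)) \<partial>lborel) = inv_sqrt_mass"
    unfolding inv_sqrt_mass_def by (intro nn_integral_cong) (auto simp: indicator_def)
  finally show ?thesis .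
qed

lemma nn_integral_inv_sqrt_dist_le:
  assumes c: "0 \<le> c" "c \<le> 1"
  shows "(\<integral>\<^sup>+x. indicator {0..1} x * ennreal (\<bar>x - c\<bar> powr (-1/2)) \<partial>lborel) \<le> 2 * inv_sqrt_mass"
proof -
  let ?h = "\<lambda>x::real. indicator {0..1} x * ennreal (x powr (-1/2))"
  have "(\<integral>\<^sup>+x. indicator {0..1} x * ennreal (\<bar>x - c\<bar> powr (-1/2)) \<partial>lborel) \<le> (\<integral>\<^sup>+x. ?h (x + - c) + ?h (c - x) \<partial>lborel)"
  proof (rule nn_integral_mono)
    fix x :: real
    show "indicator {0..1} x * ennreal (\<bar>x - c\<bar> powr (-1/2)) \<le> ?h (x + - c) + ?h (c - x)"
      using c by (cases "x < c") (auto simp: indicator_def abs_if)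
  qed
  also have "\<dots> = (\<integral>\<^sup>+x. ?h (x + - c) \<partial>lborel) + (\<integral>\<^sup>+x. ?h (c - x) \<partial>lborel)"
    by (rule nn_integral_add) auto
  also have "\<dots> = 2 * inv_sqrt_mass" unfolding inv_sqrt_mass_def
    by (subst nn_integral_lborel_translate[of ?h "- c"], simp, subst nn_integral_lborel_reflect[of ?h c], simp, simp add: mult_2)
  finally show ?thesis .
qed

text \<open>Trades the logarithmic singularity for a power that is still integrable at 0.\<close>

lemma minus_ln_le_inv_sqrt:
  assumes "0 < (x::real)" shows "- ln x \<le> 2 * x powr (-1/2)"
proof -
  have "- ln x = 2 * ln (x powr (-1/2))" using assms by (simp add: ln_powr)
  also have "\<dots> \<le> 2 * x powr (-1/2)" using ln_le_minus_one[of "x powr (-1/2)"] assms by simp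
  finally show ?thesis .
qed

lemma AE_snd_neq: "AE p in (lborel :: (real \<times> real) measure). snd p \<noteq> c"
proof -
  have [measurable]: "{p. snd p = c} \<in> sets (borel :: (real \<times> real) measure)"
    by (intro borel_closed closed_Collect_eq continuous_intros)
  have "emeasure lborel {p::real \<times> real. snd p = c} = (\<integral>\<^sup>+p. indicator {p. snd p = c} p \<partial>(lborel :: (real \<times> real) measure))"
    by simp
  also have "\<dots> = (\<integral>\<^sup>+t. \<integral>\<^sup>+s. indicator {p. snd p = c} (s::real, t) \<partial>lborel \<partial>lborel)"
    by (rule nn_integral_lborel_pair_swap) simp
  also have "\<dots> = (\<integral>\<^sup>+t. top * indicator {c} t \<partial>lborel)"
    by (intro nn_integral_cong) (auto simp: indicator_def)
  also have "\<dots> = 0" by (subst nn_integral_cmult) (auto simp: nn_integral_indicator_singleton')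
  finally show ?thesis by (intro AE_I[of _ _ "{p. snd p = c}"]) auto
qed

text \<open>\<open>sigma_sq\<close> is built from measures of intersections, whose measurability in
  (s,t) is not visible. This expression consists of minima only and coincides with it for
  \<open>s < t\<close>.\<close>

definition sigma_sq_overlap :: "nat \<Rightarrow> real \<Rightarrow> real \<Rightarrow> real" where
  "sigma_sq_overlap n s t = t - s - real n * (\<Sum>j=1..n. (overlap s t (real j / real n) - overlap s t ((real j - 1) / real n))\<^sup>2)"

lemma sigma_sq_eq_overlap: "s < t \<Longrightarrow> 1 \<le> n \<Longrightarrow> sigma_sq n s t = sigma_sq_overlap n s t"
  by (simp add: sigma_sq_def sigma_sq_overlap_def alpha_eq_overlap)

lemma borel_measurable_fst_snd_real [measurable]:
  "fst \<in> borel_measurable (borel :: (real \<times> real) measure)" "snd \<in> borel_measurable (borel :: (real \<times> real) measure)"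
  by (simp_all flip: borel_prod)

lemma borel_measurable_sigma_sq_overlap [measurable]:
  "(\<lambda>p. sigma_sq_overlap n (fst p) (snd p)) \<in> borel_measurable borel"
  unfolding sigma_sq_overlap_def by measurable

lemma sigma_sq_pos_and_ln_bound:
  assumes p: "p \<in> Delta2" and n: "1 \<le> n" and ngrid: "\<And>k. k \<le> n \<Longrightarrow> snd p \<noteq> real k / real n"
  shows "0 < sigma_sq n (fst p) (snd p)"
    and "\<bar>ln (sigma_sq n (fst p) (snd p))\<bar> \<le>
      2 * ((snd p - fst p) powr (-1/2) + (\<Sum>k\<le>n. \<bar>snd p - real k / real n\<bar> powr (-1/2)))"
proof -
  let ?g = "\<lambda>(p :: real \<times> real) k. \<bar>snd p - real k / real n\<bar>"
  have st: "0 \<le> fst p" "fst p < snd p" "snd p \<le> 1" using p by (auto simp: Delta2_def)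
  have pos: "0 < ?g p k" if "k \<le> n" for k using ngrid[OF that] by simp
  then have prod: "0 < (\<Prod>k\<le>n. ?g p k)" by (intro prod_pos) auto
  then have pp: "0 < (snd p - fst p) * (\<Prod>k\<le>n. ?g p k)" using st by simp
  note ge = sigma_sq_ge[OF st n]
  show sp: "0 < sigma_sq n (fst p) (snd p)" using pp ge by linarith
  have "- ln (sigma_sq n (fst p) (snd p)) \<le> - ln ((snd p - fst p) * (\<Prod>k\<le>n. ?g p k))"
    using pp ge sp by (simp add: ln_le_cancel_iff)
  also have "\<dots> = - ln (snd p - fst p) + (\<Sum>k\<le>n. - ln (?g p k))"
  proof -
    have "ln (\<Prod>k\<le>n. ?g p k) = (\<Sum>k\<le>n. ln (?g p k))" by (rule ln_prod) (use pos in auto)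
    moreover have "ln ((snd p - fst p) * (\<Prod>k\<le>n. ?g p k)) =
        ln (snd p - fst p) + ln (\<Prod>k\<le>n. ?g p k)" using st prod by (intro ln_mult_pos) auto
    ultimately show ?thesis by (simp only: sum_negf minus_add_distrib)
  qed
  also have "\<dots> \<le> 2 * (snd p - fst p) powr (-1/2) + (\<Sum>k\<le>n. 2 * ?g p k powr (-1/2))"
    using st pos by (intro add_mono sum_mono minus_ln_le_inv_sqrt) auto
  finally have 1: "- ln (sigma_sq n (fst p) (snd p)) \<le>
      2 * ((snd p - fst p) powr (-1/2) + (\<Sum>k\<le>n. ?g p k powr (-1/2)))"
    by (simp add: sum_distrib_left distrib_left)
  have "sigma_sq n (fst p) (snd p) \<le> 1" using sigma_sq_le[OF n, of "fst p" "snd p"] st by linarith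
  then have "ln (sigma_sq n (fst p) (snd p)) \<le> 0" using sp by simp
  then show "\<bar>ln (sigma_sq n (fst p) (snd p))\<bar> \<le>
      2 * ((snd p - fst p) powr (-1/2) + (\<Sum>k\<le>n. ?g p k powr (-1/2)))" using 1 by simp
qed

text \<open>On these lines the lower bound of \<open>sigma_sq_ge\<close> degenerates to 0; they form
  a null set.\<close>

lemma AE_snd_not_grid: "AE p in (lborel :: (real \<times> real) measure). \<forall>k\<le>n. snd p \<noteq> real k / real n"
proof -
  have "AE p in (lborel :: (real \<times> real) measure). \<forall>k\<in>{..n}. snd p \<noteq> real k / real n"
    by (intro AE_finite_allI AE_snd_neq) auto
  then show ?thesis by (rule eventually_mono) simp
qed

lemma heat_kernel_bounded:
  assumes "u \<noteq> (0::'v::euclidean_space)"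
  obtains K where "0 < K" "\<And>\<epsilon>. 0 < \<epsilon> \<Longrightarrow> heat_kernel \<epsilon> u \<le> K"
proof -
  have "0 < norm u" using assms by simp
  then obtain K where "0 < K" "\<And>\<epsilon> z. 0 < \<epsilon> \<Longrightarrow> norm u \<le> norm z \<Longrightarrow> heat_kernel \<epsilon> (z::'v) \<le> K"
    by (rule heat_kernel_bound_away_from_0) blast
  then show ?thesis using that by blast
qed

lemma integrable_heat_kernel_Delta2:
  assumes "u \<noteq> (0::'v::euclidean_space)"
  shows "integrable lborel (\<lambda>p. indicator Delta2 p * heat_kernel (snd p - fst p) u)"
proof -
  obtain K where "0 < K" "\<And>\<epsilon>. 0 < \<epsilon> \<Longrightarrow> heat_kernel \<epsilon> u \<le> K"
    using heat_kernel_bounded[OF assms] by metis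
  then show ?thesis by (intro integrable_Delta2_bounded[where C=K]) (auto simp: Delta2_def)
qed

lemma mass_eq: "mass u = (\<integral>p. indicator Delta2 p * heat_kernel (snd p - fst p) u \<partial>lborel)"
  by (simp add: mass_def set_lebesgue_integral_def case_prod_beta')

lemma mass_pos:
  assumes "u \<noteq> 0" shows "0 < mass u"
proof -
  note int = integrable_heat_kernel_Delta2[OF assms]
  have "mass u \<noteq> 0"
  proof
    assume "mass u = 0"
    then have "AE p in lborel. indicator Delta2 p * heat_kernel (snd p - fst p) u = 0"
      unfolding mass_eq by (subst (asm) integral_nonneg_eq_0_iff_AE[OF int]) auto
    then have "AE p in lborel. p \<notin> Delta2"
    proof eventually_elim
      case (elim p)
      show ?case
      proof
        assume "p \<in> Delta2"
        then show False using elim heat_kernel_pos[of "snd p - fst p" u] by (auto simp: Delta2_def)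
      qed
    qed
    then have "emeasure lborel Delta2 = 0" using AE_iff_measurable[of Delta2 lborel "\<lambda>p. p \<notin> Delta2"] by simp
    then show False by (simp add: emeasure_Delta2)
  qed
  moreover have "0 \<le> mass u" unfolding mass_eq by simp
  ultimately show ?thesis by simp
qed

text \<open>The heat kernel at the nonzero \<open>u\<close> is bounded in time, so only the
  logarithm matters. It is dominated by inverse square roots of t-s and of the distances of
  \<open>t\<close> from the grid points, which are integrable in \<open>s\<close> and in
  \<open>t\<close> respectively.\<close>

lemma integrable_ln_sigma_sq:
  assumes u: "u \<noteq> (0::'v::euclidean_space)" and n: "1 \<le> n"
  shows "integrable lborel (\<lambda>p. indicator Delta2 p * (ln (sigma_sq n (fst p) (snd p)) * heat_kernel (snd p - fst p) u))"
proof (rule integrableI_bounded)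
  let ?g = "\<lambda>(p :: real \<times> real) k. \<bar>snd p - real k / real n\<bar>"
  let ?f = "\<lambda>p. indicator Delta2 p * (ln (sigma_sq n (fst p) (snd p)) * heat_kernel (snd p - fst p) u)"
  have eq: "?f = (\<lambda>p. indicator Delta2 p * (ln (sigma_sq_overlap n (fst p) (snd p)) * heat_kernel (snd p - fst p) u))"
    using n by (intro ext) (auto simp: indicator_def Delta2_eq sigma_sq_eq_overlap)
  show "?f \<in> borel_measurable lborel" unfolding eq by measurable
  obtain K where K: "0 < K" "\<And>\<epsilon>. 0 < \<epsilon> \<Longrightarrow> heat_kernel \<epsilon> u \<le> K"
    using heat_kernel_bounded[OF u] by metis
  let ?a = "\<lambda>c x. indicator {0..1} x * ennreal (\<bar>x - c\<bar> powr (-1/2)) :: ennreal"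
  \<comment> \<open>The majorant lives on the full unit square instead of the simplex, so that in
    the iterated integral the inner integration over \<open>s\<close> separates from the grid terms
    in \<open>t\<close>.\<close>
  let ?B = "\<lambda>s t. ennreal (2 * K) * (indicator {0..1} t * ?a t s + indicator {0..1} s * (\<Sum>k\<le>n. ?a (real k / real n) t))"
  have "(\<integral>\<^sup>+p. ennreal (norm (?f p)) \<partial>lborel) \<le> (\<integral>\<^sup>+p. ?B (fst p) (snd p) \<partial>lborel)"
  proof (rule nn_integral_mono_AE)
    show "AE p in lborel. ennreal (norm (?f p)) \<le> ?B (fst p) (snd p)" using AE_snd_not_grid[of n]
    proof eventually_elim
      case (elim p)
      show ?case
      proof (cases "p \<in> Delta2")
        case True
        then have st: "0 \<le> fst p" "fst p < snd p" "snd p \<le> 1" by (auto simp: Delta2_def)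
        let ?S = "(snd p - fst p) powr (-1/2) + (\<Sum>k\<le>n. ?g p k powr (-1/2))"
        have "norm (?f p) = \<bar>ln (sigma_sq n (fst p) (snd p))\<bar> * heat_kernel (snd p - fst p) u"
          using True by (simp add: abs_mult)
        also have "\<dots> \<le> 2 * ?S * K" using sigma_sq_pos_and_ln_bound(2)[OF True n] elim st
          by (intro mult_mono K) auto
        finally have "ennreal (norm (?f p)) \<le> ennreal (2 * K * ?S)" by (intro ennreal_leI) (simp add: mult_ac)
        also have "\<dots> = ennreal (2 * K) * (ennreal ((snd p - fst p) powr (-1/2)) + (\<Sum>k\<le>n. ennreal (?g p k powr (-1/2))))"
          using K by (subst ennreal_mult) (auto simp: sum_nonneg)
        also have "\<dots> = ?B (fst p) (snd p)" using st by (simp add: abs_minus_commute)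
        finally show ?thesis .
      qed simp
    qed
  qed
  also have "\<dots> = (\<integral>\<^sup>+t. \<integral>\<^sup>+s. ?B s t \<partial>lborel \<partial>lborel)" by (subst nn_integral_lborel_pair_swap) auto
  also have "\<dots> \<le> (\<integral>\<^sup>+t. ennreal (2 * K) * (indicator {0..1} t * (2 * inv_sqrt_mass) + (\<Sum>k\<le>n. ?a (real k / real n) t)) \<partial>lborel)"
  proof (rule nn_integral_mono)
    fix t :: real
    have "(\<integral>\<^sup>+s. ?B s t \<partial>lborel) = ennreal (2 * K) * (indicator {0..1} t * (\<integral>\<^sup>+s. ?a t s \<partial>lborel) + (\<Sum>k\<le>n. ?a (real k / real n) t) * (\<integral>\<^sup>+s. indicator {0..1} s \<partial>(lborel::real measure)))"
      by (subst nn_integral_cmult, simp, subst nn_integral_add, simp, simp, subst nn_integral_cmult, simp, subst nn_integral_multc) auto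
    also have "\<dots> \<le> ennreal (2 * K) * (indicator {0..1} t * (2 * inv_sqrt_mass) + (\<Sum>k\<le>n. ?a (real k / real n) t))"
    proof -
      have "indicator {0..1} t * (\<integral>\<^sup>+s. ?a t s \<partial>lborel) \<le> indicator {0..1} t * (2 * inv_sqrt_mass)"
        using nn_integral_inv_sqrt_dist_le[of t] by (cases "t \<in> {0..1}") auto
      then show ?thesis by (intro mult_left_mono[of _ _ "ennreal (2 * K)"] add_mono) simp_all
    qed
    finally show "(\<integral>\<^sup>+s. ?B s t \<partial>lborel) \<le> ennreal (2 * K) * (indicator {0..1} t * (2 * inv_sqrt_mass) + (\<Sum>k\<le>n. ?a (real k / real n) t))" .
  qed
  also have "\<dots> = ennreal (2 * K) * (2 * inv_sqrt_mass + (\<Sum>k\<le>n. \<integral>\<^sup>+t. ?a (real k / real n) t \<partial>lborel))"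
    by (subst nn_integral_cmult, simp, subst nn_integral_add, simp, simp, subst nn_integral_multc, simp, subst nn_integral_sum) auto
  also have "\<dots> \<le> ennreal (2 * K) * (2 * inv_sqrt_mass + (\<Sum>k\<le>n. 2 * inv_sqrt_mass))"
    using n by (intro mult_left_mono add_mono sum_mono nn_integral_inv_sqrt_dist_le) auto
  also have "\<dots> < \<infinity>" using inv_sqrt_mass_finite by (simp add: ennreal_mult_less_top of_nat_less_top)
  finally show "(\<integral>\<^sup>+p. ennreal (norm (?f p)) \<partial>lborel) < \<infinity>" .
qed

text \<open>The left-hand side is \<kappa> times the bound on the cost at fixed (s,t), weighted by
  the unnormalised density \<open>h\<close>. The right-hand side is shaped for integration:
  \<open>h\<close> and \<open>ln \<sigma> * h\<close> give the mass and the integral of the theorem,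
  and everything else is constant.\<close>

lemma transport_cost_pointwise:
  fixes u :: "real ^ 'd"
  assumes m: "0 < m" and p: "p \<in> Delta2" and n: "1 \<le> n" and sp: "0 < sigma_sq n (fst p) (snd p)"
  defines "h \<equiv> heat_kernel (snd p - fst p) u" and "\<delta> \<equiv> snd p - fst p" and "\<sigma> \<equiv> sigma_sq n (fst p) (snd p)"
    and "d \<equiv> real CARD('d)"
  shows "h * ((\<delta> - \<sigma>) / \<delta>\<^sup>2 * ((norm u)\<^sup>2 + d * \<delta>)) \<le>
    2 * (2 * m - h * (1 + ln (2 * m) + d / 2 * ln (2 * pi))) - d * (ln \<sigma> * h)"
proof -
  have \<delta>: "0 < \<delta>" using p by (auto simp: Delta2_def \<delta>_def)
  have h: "0 < h" unfolding h_def using \<delta> by (intro heat_kernel_pos) (simp add: \<delta>_def)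
  have \<sigma>: "0 < \<sigma>" "\<sigma> \<le> \<delta>" using sp sigma_sq_le[OF n] by (auto simp: \<sigma>_def \<delta>_def)
  have lnh: "ln h = - d / 2 * (ln (2 * pi) + ln \<delta>) - (norm u)\<^sup>2 / (2 * \<delta>)"
  proof -
    have "ln h = ln ((2 * pi * \<delta>) powr (- d / 2)) + ln (exp (- (norm u)\<^sup>2 / (2 * \<delta>)))"
      unfolding h_def heat_kernel_def \<delta>_def[symmetric] d_def using \<delta> by (subst ln_mult_pos) auto
    also have "\<dots> = - d / 2 * ln (2 * pi * \<delta>) - (norm u)\<^sup>2 / (2 * \<delta>)" using \<delta> by (simp add: ln_powr)
    also have "ln (2 * pi * \<delta>) = ln (2 * pi) + ln \<delta>" using \<delta> by (intro ln_mult_pos) auto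
    finally show ?thesis .
  qed
  have "(\<delta> - \<sigma>) / \<delta>\<^sup>2 * ((norm u)\<^sup>2 + d * \<delta>) = (1 - \<sigma> / \<delta>) * ((norm u)\<^sup>2 / \<delta>) + d * (1 - \<sigma> / \<delta>)"
    using \<delta> by (simp add: field_simps power2_eq_square)
  \<comment> \<open>Here \<open>\<sigma>\<close> stands for the variance \<sigma>^2. The factor
    \<open>1 - \<sigma> / \<delta>\<close> is bounded by 1 next to |u|^2, but by the logarithm next
    to \<open>d\<close>.\<close>
  also have "\<dots> \<le> (norm u)\<^sup>2 / \<delta> + d * (- ln (\<sigma> / \<delta>))"
  proof (intro add_mono mult_left_mono)
    show "(1 - \<sigma> / \<delta>) * ((norm u)\<^sup>2 / \<delta>) \<le> (norm u)\<^sup>2 / \<delta>"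
      using \<delta> \<sigma> by (intro mult_left_le_one_le) auto
    show "1 - \<sigma> / \<delta> \<le> - ln (\<sigma> / \<delta>)" using ln_le_minus_one[of "\<sigma> / \<delta>"] \<delta> \<sigma> by simp
  qed (simp add: d_def)
  \<comment> \<open>The terms singular in \<delta>, namely |u|^2/\<delta> and d ln \<delta>, are
    recombined into the logarithm of the heat kernel.\<close>
  also have "\<dots> = - 2 * ln h - d * ln (2 * pi) - d * ln \<sigma>"
  proof -
    have lnq: "ln (\<sigma> / \<delta>) = ln \<sigma> - ln \<delta>" using \<delta> \<sigma> by (intro ln_divide_pos) auto
    show ?thesis using \<delta> unfolding lnh lnq by (simp add: field_simps)
  qed
  finally have "h * ((\<delta> - \<sigma>) / \<delta>\<^sup>2 * ((norm u)\<^sup>2 + d * \<delta>)) \<le> h * (- 2 * ln h - d * ln (2 * pi) - d * ln \<sigma>)"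
    using h by (intro mult_left_mono) auto
  \<comment> \<open>Pointwise Gibbs inequality against the constant 2m, which is m times the uniform
    density; after integration over the simplex the terms \<open>2 * m\<close> and
    \<open>- h\<close> cancel.\<close>
  moreover have "h * (- ln h) \<le> 2 * m - h - h * ln (2 * m)"
  proof -
    have "ln (2 * m / h) \<le> 2 * m / h - 1" using h m by (intro ln_le_minus_one) auto
    then have "h * (ln (2 * m) - ln h) \<le> h * (2 * m / h - 1)"
      using h m ln_divide_pos[of "2 * m" h] by (intro mult_left_mono) auto
    also have "\<dots> = 2 * m - h" using h by (simp add: field_simps)
    finally show ?thesis by (simp add: algebra_simps)
  qed
  ultimately show ?thesis by (simp add: algebra_simps)
qed

section \<open>The coupling\<close>

context brownian_motion begin

text \<open>The mixing law of (s,t): since the heat kernel at \<open>u\<close> is the density of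
  \<open>W t - W s\<close> there, the weights are those of the total mass of \<theta>.\<close>

definition time_law :: "real ^ 'd \<Rightarrow> (real \<times> real) measure" where
  "time_law u = density lborel (\<lambda>p. ennreal (indicator Delta2 p * heat_kernel (snd p - fst p) u / mass u))"

lemma sets_time_law [simp, measurable_cong]: "sets (time_law u) = sets borel"
  and space_time_law [simp]: "space (time_law u) = UNIV" by (simp_all add: time_law_def)

lemma nn_integral_time_law:
  assumes "g \<in> borel_measurable borel"
  shows "(\<integral>\<^sup>+p. g p \<partial>time_law u) =
    (\<integral>\<^sup>+p. ennreal (indicator Delta2 p * heat_kernel (snd p - fst p) u / mass u) * g p \<partial>lborel)"
  unfolding time_law_def using assms by (subst nn_integral_density) auto

lemma prob_space_time_law:
  assumes "u \<noteq> 0" shows "prob_space (time_law u)"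
proof (rule prob_spaceI)
  have "emeasure (time_law u) (space (time_law u)) =
    (\<integral>\<^sup>+p. ennreal (indicator Delta2 p * heat_kernel (snd p - fst p) u / mass u) \<partial>lborel)"
    unfolding time_law_def by (subst emeasure_density) auto
  also have "\<dots> = ennreal (\<integral>p. indicator Delta2 p * heat_kernel (snd p - fst p) u / mass u \<partial>lborel)"
    using integrable_heat_kernel_Delta2[OF assms] mass_pos[OF assms]
    by (intro nn_integral_eq_integral integrable_divide) auto
  also have "\<dots> = 1" using mass_pos[OF assms] by (simp flip: mass_eq)
  finally show "emeasure (time_law u) (space (time_law u)) = 1" .
qed

text \<open>Given \<open>p = (s, t)\<close>, the grid values of the Brownian path conditioned on \<open>W t - W s = u\<close>.\<close>

definition bridged_grid :: "real ^ 'd \<Rightarrow> (real \<times> real) \<times> 'a \<Rightarrow> (real ^ 'd) ^ 'n::{finite,linorder}" where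
  "bridged_grid u x = grid_values W (snd x) +
     bridge_shift (fst (fst x)) (snd (fst x)) (u - clamped_increment (fst x) (snd x))"

lemma borel_measurable_clamped_increment_time_law [measurable]:
  "(\<lambda>x. clamped_increment (fst x) (snd x)) \<in> borel_measurable (time_law u \<Otimes>\<^sub>M M)"
proof -
  have "sets (time_law u \<Otimes>\<^sub>M M) = sets (lborel \<Otimes>\<^sub>M M)" by (intro sets_pair_measure_cong) auto
  then show ?thesis using borel_measurable_clamped_increment by (simp cong: measurable_cong_sets)
qed

lemma borel_measurable_bridged_grid [measurable]:
  "bridged_grid u \<in> borel_measurable (time_law u \<Otimes>\<^sub>M M)"
proof -
  have [measurable]: "(\<lambda>x. fst (fst x)) \<in> borel_measurable (time_law u \<Otimes>\<^sub>M M)" "(\<lambda>x. snd (fst x)) \<in> borel_measurable (time_law u \<Otimes>\<^sub>M M)"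
    by (rule measurable_compose[OF measurable_fst], simp)+
  show ?thesis unfolding bridged_grid_def[abs_def] by measurable
qed

definition bridge_coupling :: "real ^ 'd \<Rightarrow> (((real ^ 'd) ^ 'n::{finite,linorder}) \<times> ((real ^ 'd) ^ 'n::{finite,linorder})) measure" where
  "bridge_coupling u = distr (time_law u \<Otimes>\<^sub>M M) (borel \<Otimes>\<^sub>M borel) (\<lambda>x. (bridged_grid u x, grid_values W (snd x)))"

text \<open>The second marginal is immediate, since the path is independent of the random times. The
  first is compared with the normalised \<theta> on smooth functions with values in [0,1], where
  Fubini and \<open>theta_integral\<close> yield the same mixture of bridge means.\<close>

lemma bridge_coupling_in_couplings:
  fixes \<theta> :: "((real ^ 'd) ^ 'n::{finite,linorder}) measure"
  assumes d: "CARD('d) \<ge> 4" and u: "u \<noteq> 0" and rho: "is_rho2 M W u \<rho>" and theta: "is_theta M W \<rho> \<theta>"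
  shows "bridge_coupling u \<in> couplings (scale_measure (ennreal (1 / mass u)) \<theta>) (mu M W)"
proof -
  interpret T: prob_space "time_law u" by (rule prob_space_time_law) fact
  interpret TM: pair_prob_space "time_law u" M ..
  let ?P = "time_law u \<Otimes>\<^sub>M M"
  have Y [measurable]: "(\<lambda>x. grid_values W (snd x)) \<in> borel_measurable ?P" by measurable
  have pair: "(\<lambda>x. (bridged_grid u x, grid_values W (snd x))) \<in> measurable ?P (borel \<Otimes>\<^sub>M borel)" by measurable
  have m: "0 < mass u" by (rule mass_pos) fact
  interpret \<theta>: finite_measure \<theta> using theta by (simp add: is_theta_def)
  have sets_\<theta> [measurable_cong]: "sets \<theta> = sets borel" using theta by (simp add: is_theta_def)
  have "distr (bridge_coupling u) borel snd = distr ?P borel (\<lambda>x. grid_values W (snd x))"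
    unfolding bridge_coupling_def using pair by (subst distr_distr) (auto simp: o_def)
  also have "\<dots> = distr (distr ?P M snd) borel (grid_values W)"
    by (subst distr_distr) (auto simp: o_def)
  also have "distr ?P M snd = M"
  proof (rule measure_eqI)
    fix A assume "A \<in> sets (distr ?P M snd)"
    then have A: "A \<in> sets M" by simp
    then have "snd -` A \<inter> space ?P = space (time_law u) \<times> A"
      using sets.sets_into_space by (auto simp: space_pair_measure)
    then show "emeasure (distr ?P M snd) A = emeasure M A"
      using A T.emeasure_space_1 by (simp add: emeasure_distr emeasure_pair_measure_Times)
  qed simp
  finally have snd: "distr (bridge_coupling u) borel snd = (mu M W :: ((real ^ 'd) ^ 'n::{finite,linorder}) measure)"
    by (simp add: mu_def)
  have fst: "distr (bridge_coupling u) borel fst = scale_measure (ennreal (1 / mass u)) \<theta>"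
  proof (rule finite_measure_eqI_Cb_infinity)
    show "sets (distr (bridge_coupling u) borel fst) = sets borel" by simp
    show "sets (scale_measure (ennreal (1 / mass u)) \<theta>) = sets borel" by (simp add: sets_\<theta>)
    have eq: "distr (bridge_coupling u) borel fst = distr ?P borel (bridged_grid u :: _ \<Rightarrow> (real ^ 'd) ^ 'n::{finite,linorder})"
      unfolding bridge_coupling_def using pair by (subst distr_distr) (auto simp: o_def)
    show "finite_measure (distr (bridge_coupling u :: (((real ^ 'd) ^ 'n::{finite,linorder}) \<times> ((real ^ 'd) ^ 'n::{finite,linorder})) measure) borel fst)"
      unfolding eq by (intro prob_space.finite_measure TM.prob_space_distr) simp
    show "finite_measure (scale_measure (ennreal (1 / mass u)) \<theta>)"
      by (intro finite_measureI) (simp add: ennreal_mult_eq_top_iff \<theta>.emeasure_finite)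
    fix f :: "(real ^ 'd) ^ 'n::{finite,linorder} \<Rightarrow> real"
    assume f: "f \<in> Cb_infinity" and f01: "\<And>x. 0 \<le> f x \<and> f x \<le> 1"
    have [measurable]: "f \<in> borel_measurable borel" by (rule borel_measurable_Cb_infinity[OF f])
    let ?b = "\<lambda>p. \<integral>\<^sup>+\<omega>. ennreal (f (bridged_grid u (p, \<omega>))) \<partial>M"
    have b_meas: "?b \<in> borel_measurable (time_law u)" by measurable
    then have b_meas' [measurable]: "?b \<in> borel_measurable borel" by (simp cong: measurable_cong_sets)
    have b: "?b p = ennreal (bridge_mean f (fst p) (snd p) u)" if "p \<in> Delta2" for p
      using that bridge_mean_bounds(3)[OF f f01, of "fst p" "snd p" u]
      by (auto simp: bridged_grid_def clamped_increment_eq Delta2_eq)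
    have b0: "0 \<le> bridge_mean f (fst p) (snd p) u" if "p \<in> Delta2" for p
      using that bridge_mean_bounds(1)[OF f f01, of "fst p" "snd p" u] by (auto simp: Delta2_eq)
    let ?g = "\<lambda>p. indicator Delta2 p * (heat_kernel (snd p - fst p) u * bridge_mean f (fst p) (snd p) u)"
    \<comment> \<open>Rewriting the bridge mean through the nonnegative inner integral provides its
      measurability in (s,t).\<close>
    have g_eq: "?g = (\<lambda>p. indicator Delta2 p * (heat_kernel (snd p - fst p) u * enn2real (?b p)))"
      using b b0 by (intro ext) (simp add: indicator_def)
    have g_meas [measurable]: "?g \<in> borel_measurable borel" unfolding g_eq by measurable
    have g0: "0 \<le> ?g p" for p using b0[of p] by (simp add: indicator_def)
    have "(\<integral>\<^sup>+x. ennreal (f x) \<partial>distr (bridge_coupling u) borel fst) = (\<integral>\<^sup>+x. ennreal (f (bridged_grid u x)) \<partial>?P)"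
      unfolding eq by (subst nn_integral_distr) auto
    also have "\<dots> = (\<integral>\<^sup>+p. ?b p \<partial>time_law u)" by (rule nn_integral_fst[symmetric]) measurable
    also have "\<dots> = (\<integral>\<^sup>+p. ennreal (indicator Delta2 p * heat_kernel (snd p - fst p) u / mass u) * ?b p \<partial>lborel)"
      by (rule nn_integral_time_law) measurable
    also have "\<dots> = (\<integral>\<^sup>+p. ennreal (1 / mass u) * ennreal (?g p) \<partial>lborel)"
      using m b b0 by (intro nn_integral_cong) (auto simp: indicator_def simp flip: ennreal_mult)
    also have "\<dots> = ennreal (1 / mass u) * (\<integral>\<^sup>+p. ennreal (?g p) \<partial>lborel)"
      by (rule nn_integral_cmult) simp
    finally have 1: "(\<integral>\<^sup>+x. ennreal (f x) \<partial>distr (bridge_coupling u) borel fst) = ennreal (1 / mass u) * (\<integral>\<^sup>+p. ennreal (?g p) \<partial>lborel)" .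
    have "(\<integral>x. f x \<partial>distr (bridge_coupling u) borel fst) = 1 / mass u * (\<integral>p. ?g p \<partial>lborel)"
      using f01 m g0 by (subst (1 2) integral_eq_nn_integral) (auto simp: 1 enn2real_mult)
    also have "(\<integral>p. ?g p \<partial>lborel) = (\<integral>x. f x \<partial>\<theta>)"
      by (rule theta_integral[OF f f01 d u rho theta, symmetric])
    also have "1 / mass u * (\<integral>x. f x \<partial>\<theta>) = (\<integral>x. f x \<partial>scale_measure (ennreal (1 / mass u)) \<theta>)"
      using f01 m by (subst (1 2) integral_eq_nn_integral) (auto simp: nn_integral_scale_measure enn2real_mult cong: measurable_cong_sets)
    finally show "(\<integral>x. f x \<partial>distr (bridge_coupling u) borel fst) = (\<integral>x. f x \<partial>scale_measure (ennreal (1 / mass u)) \<theta>)" .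
  qed
  have "prob_space (bridge_coupling u :: (((real ^ 'd) ^ 'n::{finite,linorder}) \<times> ((real ^ 'd) ^ 'n::{finite,linorder})) measure)"
    unfolding bridge_coupling_def by (rule TM.prob_space_distr[OF pair])
  then show ?thesis using fst snd by (simp add: couplings_def bridge_coupling_def)
qed

lemma nn_integral_increment_cost:
  assumes st: "0 \<le> s" "s < t" "t \<le> 1"
  shows "(\<integral>\<^sup>+\<omega>. ennreal ((norm (u - (W t \<omega> - W s \<omega>)))\<^sup>2) \<partial>M) = ennreal ((norm u)\<^sup>2 + real CARD('d) * (t - s))"
proof -
  have "(\<integral>\<^sup>+\<omega>. ennreal ((norm (u - (W t \<omega> - W s \<omega>)))\<^sup>2) \<partial>M) =
    (\<integral>\<^sup>+z. ennreal (heat_kernel (t - s) z) * ennreal ((norm (u - z))\<^sup>2) \<partial>lborel)"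
    by (rule distributed_nn_integral[OF gaussian_increments[OF st], symmetric]) measurable
  also have "\<dots> = (\<integral>\<^sup>+z. ennreal (heat_kernel (t - s) z * (norm (u - z))\<^sup>2) \<partial>lborel)"
    by (simp add: ennreal_mult)
  also have "\<dots> = ennreal ((norm u)\<^sup>2 + real CARD('d) * (t - s))"
    using nn_integral_heat_kernel_shifted_norm_sq[of "t - s" u] st by simp
  finally show ?thesis .
qed

text \<open>The two components of the coupling differ by the bridge shift alone, so the cost at
  fixed times is a constant times the second moment of \<open>u - (W t - W s)\<close>. The bound
  \<open>0 \<le> R\<close> is recorded because \<open>ennreal R\<close> alone would hide a negative
  \<open>R\<close>.\<close>

lemma bridge_coupling_cost:
  fixes u :: "real ^ 'd"
  assumes u: "u \<noteq> 0" and n: "n = CARD('n::{finite,linorder})"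
  defines "\<kappa> \<equiv> 2 * real n * (1 - cos (pi / (2 * real n + 1)))"
    and "I \<equiv> (\<integral>p. indicator Delta2 p * (ln (sigma_sq n (fst p) (snd p)) * heat_kernel (snd p - fst p) u) \<partial>lborel)"
  defines "R \<equiv> 2 / \<kappa> * (- ln (2 * mass u * (2 * pi) powr (real CARD('d) / 2)) - real CARD('d) / (2 * mass u) * I)"
  shows "(\<integral>\<^sup>+(x, y). ennreal ((norm (x - y))\<^sup>2) \<partial>(bridge_coupling u :: (((real ^ 'd) ^ 'n::{finite,linorder}) \<times> ((real ^ 'd) ^ 'n::{finite,linorder})) measure)) \<le> ennreal R" (is "?cost \<le> _")
    and "0 \<le> R"
proof -
  interpret T: prob_space "time_law u" by (rule prob_space_time_law) fact
  interpret TM: pair_prob_space "time_law u" M ..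
  let ?P = "time_law u \<Otimes>\<^sub>M M"
  let ?d = "real CARD('d)"
  define m where "m = mass u"
  have m: "0 < m" unfolding m_def by (rule mass_pos) fact
  have n1: "1 \<le> n" by (simp add: n Suc_le_eq)
  have \<kappa>: "0 < \<kappa>"
  proof -
    have "pi / (2 * real n + 1) < pi" "0 < pi / (2 * real n + 1)" using n1 by (auto simp: divide_less_eq)
    then have "cos (pi / (2 * real n + 1)) < cos 0" by (intro cos_monotone_0_pi) auto
    then show ?thesis using n1 by (simp add: \<kappa>_def)
  qed
  define h where "h p = heat_kernel (snd p - fst p) u" for p :: "real \<times> real"
  define L where "L p = ln (sigma_sq n (fst p) (snd p)) * h p" for p
  define c where "c = 1 + ln (2 * m) + ?d / 2 * ln (2 * pi)"
  \<comment> \<open>The right-hand side of \<open>transport_cost_pointwise\<close>, divided by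
    \<kappa> and normalised by the mass. Its integral over \<open>Delta2\<close> is exactly
    \<open>R\<close>: the summand 1 in \<open>c\<close> cancels the constant 4/\<kappa> times the
    area 1/2.\<close>
  define r where "r p = 1 / (\<kappa> * m) * (2 * (2 * m - h p * c) - ?d * L p)" for p
  let ?S = "\<lambda>p::real \<times> real. bridge_shift (fst p) (snd p) :: real ^ 'd \<Rightarrow> (real ^ 'd) ^ 'n::{finite,linorder}"
  let ?q = "\<lambda>p. \<integral>\<^sup>+\<omega>. ennreal ((norm (?S p (u - clamped_increment p \<omega>)))\<^sup>2) \<partial>M"
  have meas: "(\<lambda>x. norm (?S (fst x) (u - clamped_increment (fst x) (snd x)))) \<in> borel_measurable ?P"
  proof -
    have [measurable]: "(\<lambda>x. fst (fst x)) \<in> borel_measurable ?P" "(\<lambda>x. snd (fst x)) \<in> borel_measurable ?P"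
      by (rule measurable_compose[OF measurable_fst], simp)+
    show ?thesis by measurable
  qed
  let ?w = "\<lambda>p. ennreal (indicator Delta2 p * heat_kernel (snd p - fst p) u / mass u)"
  have q_meas: "?q \<in> borel_measurable (time_law u)" using meas by measurable
  have "?cost =
    (\<integral>\<^sup>+x. ennreal ((norm (?S (fst x) (u - clamped_increment (fst x) (snd x))))\<^sup>2) \<partial>?P)"
    unfolding bridge_coupling_def case_prod_beta'
    by (subst nn_integral_distr) (auto simp: bridged_grid_def)
  also have "\<dots> = (\<integral>\<^sup>+p. ?q p \<partial>time_law u)" using meas by (subst nn_integral_fst[symmetric]) auto
  also have "\<dots> = (\<integral>\<^sup>+p. ?w p * ?q p \<partial>lborel)"
    using q_meas by (intro nn_integral_time_law) (simp cong: measurable_cong_sets)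
  finally have cost: "?cost = \<dots>" .
  have bound: "?w p * ?q p \<le> ennreal (indicator Delta2 p * r p)"
      "0 \<le> indicator Delta2 p * r p"
    if ng: "\<forall>k\<le>n. snd p \<noteq> real k / real n" for p
  proof -
    have "?w p * ?q p \<le> ennreal (indicator Delta2 p * r p) \<and>
      0 \<le> indicator Delta2 p * r p"
    proof (cases "p \<in> Delta2")
      case True
      then have st: "0 \<le> fst p" "fst p < snd p" "snd p \<le> 1" by (auto simp: Delta2_def)
      define \<delta> where "\<delta> = snd p - fst p"
      define \<sigma> where "\<sigma> = sigma_sq n (fst p) (snd p)"
      have \<delta>: "0 < \<delta>" using st by (simp add: \<delta>_def)
      have \<sigma>: "0 < \<sigma>" "\<sigma> \<le> \<delta>"
        using sigma_sq_pos_and_ln_bound(1)[OF True n1] ng sigma_sq_le[OF n1] by (auto simp: \<sigma>_def \<delta>_def)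
      \<comment> \<open>The bound on the squared norm of the regression coefficients from the
        discrete Wirtinger inequality.\<close>
      define C where "C = (\<delta> - \<sigma>) / \<delta>\<^sup>2 / \<kappa>"
      have C: "0 \<le> C" using \<sigma> \<delta> \<kappa> by (simp add: C_def)
      have Sq: "(norm (?S p z))\<^sup>2 \<le> C * (norm z)\<^sup>2" for z
      proof -
        have "(norm (?S p z))\<^sup>2 * \<kappa> \<le> (\<delta> - \<sigma>) / \<delta>\<^sup>2 * (norm z)\<^sup>2"
          unfolding \<kappa>_def \<delta>_def \<sigma>_def by (subst mult.commute) (rule norm_bridge_shift_sq_le[OF st n])
        then have "(norm (?S p z))\<^sup>2 \<le> (\<delta> - \<sigma>) / \<delta>\<^sup>2 * (norm z)\<^sup>2 / \<kappa>"
          using \<kappa> by (simp only: pos_le_divide_eq)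
        then show ?thesis by (simp add: C_def)
      qed
      let ?B = "1 / (\<kappa> * m) * (h p * ((\<delta> - \<sigma>) / \<delta>\<^sup>2 * ((norm u)\<^sup>2 + ?d * \<delta>)))"
      have h: "0 \<le> h p" by (simp add: h_def)
      have Wm [measurable]: "W (fst p) \<in> borel_measurable M" "W (snd p) \<in> borel_measurable M" using st by auto
      have "?q p \<le> (\<integral>\<^sup>+\<omega>. ennreal C * ennreal ((norm (u - (W (snd p) \<omega> - W (fst p) \<omega>)))\<^sup>2) \<partial>M)"
        using Sq C by (intro nn_integral_mono) (simp add: clamped_increment_eq[OF True] flip: ennreal_mult)
      also have "\<dots> = ennreal C * ennreal ((norm u)\<^sup>2 + ?d * \<delta>)"
        unfolding \<delta>_def by (subst nn_integral_cmult) (auto simp: nn_integral_increment_cost[OF st])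
      finally have "ennreal (h p / m) * ?q p \<le> ennreal (h p / m) * (ennreal C * ennreal ((norm u)\<^sup>2 + ?d * \<delta>))"
        by (rule mult_left_mono) simp
      also have "\<dots> = ennreal (h p / m * (C * ((norm u)\<^sup>2 + ?d * \<delta>)))"
        using h m C \<delta> by (simp del: ennreal_plus flip: ennreal_mult)
      also have "h p / m * (C * ((norm u)\<^sup>2 + ?d * \<delta>)) = ?B" by (simp add: C_def)
      finally have 1: "ennreal (h p / m) * ?q p \<le> ennreal (?B)" .
      have "?B \<le> r p" unfolding r_def L_def h_def c_def \<delta>_def
        using transport_cost_pointwise[OF m True n1, of u] \<sigma> \<kappa> m unfolding \<sigma>_def
        by (intro mult_left_mono) auto
      moreover have "0 \<le> ?B"
        using h \<delta> \<sigma> \<kappa> m by (intro mult_nonneg_nonneg divide_nonneg_nonneg add_nonneg_nonneg) auto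
      ultimately have "ennreal (h p / m) * ?q p \<le> ennreal (r p)" "0 \<le> r p"
        using 1 by (auto intro: order_trans[OF _ ennreal_leI])
      then show ?thesis using True by (simp add: h_def m_def)
    qed simp
    then show "?w p * ?q p \<le> ennreal (indicator Delta2 p * r p)"
      "0 \<le> indicator Delta2 p * r p" by blast+
  qed
  have ints: "integrable lborel (\<lambda>p. indicator Delta2 p * (1::real))" "integrable lborel (\<lambda>p. indicator Delta2 p * h p)"
      "integrable lborel (\<lambda>p. indicator Delta2 p * L p)" unfolding h_def L_def
    by (auto intro: integrable_Delta2_bounded[where C=1] integrable_heat_kernel_Delta2[OF u] integrable_ln_sigma_sq[OF u n1]
        simp del: mult_1_right)
  have r_eq: "(\<lambda>p. indicator Delta2 p * r p) = (\<lambda>p. (4 / \<kappa>) * (indicator Delta2 p * 1) - (2 * c / (\<kappa> * m)) * (indicator Delta2 p * h p)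
      - (?d / (\<kappa> * m)) * (indicator Delta2 p * L p))"
    using \<kappa> m by (intro ext) (simp add: r_def field_simps)
  have int_r: "integrable lborel (\<lambda>p. indicator Delta2 p * r p)"
    unfolding r_eq by (intro Bochner_Integration.integrable_diff integrable_mult_right ints)
  have "(\<integral>p. indicator Delta2 p * r p \<partial>lborel) = 4 / \<kappa> * (\<integral>p. indicator Delta2 p * 1 \<partial>lborel)
      - 2 * c / (\<kappa> * m) * (\<integral>p. indicator Delta2 p * h p \<partial>lborel) - ?d / (\<kappa> * m) * (\<integral>p. indicator Delta2 p * L p \<partial>lborel)"
    unfolding r_eq by (simp only: Bochner_Integration.integral_diff Bochner_Integration.integrable_diff integrable_mult_right
        Bochner_Integration.integral_mult_right ints integral_mult_right_zero)
  also have "(\<integral>p. indicator Delta2 p * 1 \<partial>lborel) = (1 / 2 :: real)" by (simp add: measure_Delta2)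
  also have "(\<integral>p. indicator Delta2 p * h p \<partial>lborel) = m" by (simp add: h_def m_def mass_eq)
  also have "(\<integral>p. indicator Delta2 p * L p \<partial>lborel) = I" by (simp add: I_def L_def h_def)
  also have "4 / \<kappa> * (1 / 2) - 2 * c / (\<kappa> * m) * m - ?d / (\<kappa> * m) * I = R"
  proof -
    have "ln (2 * m * (2 * pi) powr (?d / 2)) = ln (2 * m) + ?d / 2 * ln (2 * pi)"
      using m by (subst ln_mult_pos) (auto simp: ln_powr)
    then show ?thesis using \<kappa> m unfolding R_def m_def[symmetric] c_def by (simp add: field_simps)
  qed
  finally have R: "(\<integral>p. indicator Delta2 p * r p \<partial>lborel) = R" .
  have AE0: "AE p in lborel. 0 \<le> indicator Delta2 p * r p"
    using AE_snd_not_grid[of n] by (rule eventually_mono) (rule bound(2))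
  have "(\<integral>\<^sup>+p. ?w p * ?q p \<partial>lborel) \<le>
    (\<integral>\<^sup>+p. ennreal (indicator Delta2 p * r p) \<partial>lborel)"
  proof (rule nn_integral_mono_AE)
    show "AE p in lborel. ?w p * ?q p \<le> ennreal (indicator Delta2 p * r p)"
      using AE_snd_not_grid[of n] by (rule eventually_mono) (rule bound(1))
  qed
  also have "\<dots> = ennreal R" using nn_integral_eq_integral[OF int_r AE0] R by simp
  finally show "?cost \<le> ennreal R" unfolding cost .
  show "0 \<le> R" using integral_nonneg_AE[OF AE0] R by simp
qed

end

theorem proposition6:
  fixes M :: "'a measure" and W :: "real \<Rightarrow> 'a \<Rightarrow> real ^ 'd" and u :: "real ^ 'd"
    and n :: nat and \<rho> :: "nat \<Rightarrow> 'a \<Rightarrow> real"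
    and \<theta> :: "((real ^ 'd) ^ 'n::{finite,linorder}) measure"
  assumes "brownian_motion M W"
    and "CARD('d) \<ge> 4" and "u \<noteq> 0" and "n = CARD('n)"
    and "is_rho2 M W u \<rho>" and "is_theta M W \<rho> \<theta>"
  shows "enn2ereal (wasserstein2_sq (scale_measure (ennreal (1 / mass u)) \<theta>) (mu M W))
    \<le> ereal (2 / (2 * real n * (1 - cos (pi / (2 * real n + 1)))) *
        (- ln (2 * mass u * (2 * pi) powr (real CARD('d) / 2))
         - real CARD('d) / (2 * mass u) *
             (LINT (s, t):Delta2|lborel. ln (sigma_sq n s t) * heat_kernel (t - s) u)))"
proof -
  interpret brownian_motion M W by fact
  have I: "(LINT (s, t):Delta2|lborel. ln (sigma_sq n s t) * heat_kernel (t - s) u) =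
    (\<integral>p. indicator Delta2 p * (ln (sigma_sq n (fst p) (snd p)) * heat_kernel (snd p - fst p) u) \<partial>lborel)"
    by (simp add: set_lebesgue_integral_def case_prod_beta')
  note cost = bridge_coupling_cost[OF \<open>u \<noteq> 0\<close> \<open>n = CARD('n)\<close>, folded I]
  let ?R = "2 / (2 * real n * (1 - cos (pi / (2 * real n + 1)))) *
        (- ln (2 * mass u * (2 * pi) powr (real CARD('d) / 2))
         - real CARD('d) / (2 * mass u) *
             (LINT (s, t):Delta2|lborel. ln (sigma_sq n s t) * heat_kernel (t - s) u))"
  have "wasserstein2_sq (scale_measure (ennreal (1 / mass u)) \<theta>) (mu M W) \<le>
    (\<integral>\<^sup>+(x, y). ennreal ((norm (x - y))\<^sup>2) \<partial>(bridge_coupling u :: (((real ^ 'd) ^ 'n::{finite,linorder}) \<times> ((real ^ 'd) ^ 'n::{finite,linorder})) measure))"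
    unfolding wasserstein2_sq_def
    by (rule INF_lower) (rule bridge_coupling_in_couplings[OF assms(2,3,5,6)])
  also have "\<dots> \<le> ennreal ?R" by (rule cost(1))
  finally have "enn2ereal (wasserstein2_sq (scale_measure (ennreal (1 / mass u)) \<theta>) (mu M W)) \<le> enn2ereal (ennreal ?R)"
    by (simp add: less_eq_ennreal.rep_eq)
  \<comment> \<open>Nonnegativity of the bound is essential here, since \<open>ennreal\<close> sends
    negative reals to 0.\<close>
  also have "enn2ereal (ennreal ?R) = ereal ?R" using cost(2) by (rule enn2ereal_ennreal)
  finally show ?thesis .
qed

end
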